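(* Consider the Euler equation $\partial u/\partial t=\mathscr{P}(u,u)$ on $\mathbb{T}^3$. Let "solution" mean either an $H^n$-solution with fixed $n>5/2$, or an $\mathscr{A}$-solution, and let initial data $u_0$ be taken correspondingly in $H^n$ or in $\mathscr{A}$. Then for each $(S,a)\in O_h\ltimes\mathbb{T}^3$: (i) If $u:(-\mathscr{T},T)\ni t\mapsto u(t)$ is a solution, then so are $t\in(-\mathscr{T},T)\mapsto\mathscr{E}_*(S,a)u(t)$ and $t\in(-T,\mathscr{T})\mapsto-\mathscr{E}_*(S,a)u(-t)$. (ii) If $u:(-\mathscr{T},T)\ni t\mapsto u(t)$ is the maximal solution with datum $u_0$, then $t\in(-\mathscr{T},T)\mapsto\mathscr{E}_*(S,a)u(t)$ is the maximal solution with datum $\mathscr{E}_*(S,a)u_0$, and $t\in(-T,\mathscr{T})\mapsto-\mathscr{E}_*(S,a)u(-t)$ is the maximal solution with datum $-\mathscr{E}_*(S,a)u_0$. (iii) Let $u:(-\mathscr{T},T)\ni t\mapsto u(t)$ be the maximal solution with datum $u_0$. If $\mathscr{E}_*(S,a)u_0=u_0$, then $\mathscr{E}_*(S,a)u(t)=u(t)$ for all $t\in(-\mathscr{T},T)$. If $-\mathscr{E}_*(S,a)u_0=u_0$, then $\mathscr{T}=T$ and $-\mathscr{E}_*(S,a)u(-t)=u(t)$ for all $t\in(-T,T)$. Moreover, if $u_0\in H^n$ with $n>5/2$, $u:(-\mathscr{T},T)\to H^n$ is the maximal $H^n$-solution with datum $u_0$, and $-\mathscr{E}_*(S,a)u_0=u_0$,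 then $\mathscr{T}=T$ and $\|u(-t)\|_n=\|u(t)\|_n$ for all $t\in(-T,T)$.
   Context: Torus: $\mathbb{T}^3:=(\mathbb{R}/2\pi\mathbb{Z})^3$. $D'$ is the space of $\mathbb{R}^3$-valued distributions on $\mathbb{T}^3$; $v\in D'$ has Fourier coefficients $v_k\in\mathbb{C}^3$ ($k\in\mathbb{Z}^3$), $v=\sum_k v_ke^{ik\cdot x}$, $v_{-k}=\overline{v_k}$. For $a,b\in\mathbb{C}^3$, $a\cdot b=\sum_s a_sb_s$. For real $n\ge0$, $H^n:=\{v\in D' : \sum_k|k|^{2n}|v_k|^2<\infty,\ v_0=0,\ k\cdot v_k=0\ \forall k\}$, a Hilbert space with $\langle v|w\rangle_n=\sum_k|k|^{2n}\overline{v_k}\cdot w_k$ and norm $\|v\|_n$. $\mathscr{A}$ is the space of real-analytic, zero mean, divergence free vector fields $\mathbb{T}^3\to\mathbb{R}^3$. It is the union over $\rho>1$ of $\mathscr{A}_\rho:=\{v\in D':\liminf_{k\to\infty}|v_k|^{-1/(|k_1|+|k_2|+|k_3|)}>\rho,\ v_0=0,\ k\cdot v_k=0\}$ (with $0^{-1/m}:=+\infty$), each normed by $\sup|\sum_kv_kz^k|$ over $z\in\mathbb{C}^3$ with $1/\rho\le|z_s|\le\rho$ for $s=1,2,3$; $\mathscr{A}$ carries the locally convex inductive limit topology of these spaces. $\mathscr{P}(v,w):=-\mathfrak{L}(v\cdot\nabla w)$ with $\mathfrak{L}$ the Leray projection onto divergence free fields; in Fourier terms $\mathscr{P}(v,w)_k=-i\sum_{h}(v_h\cdot(k-h))\,\mathfrak{L}_kw_{k-h}$,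 where $\mathfrak{L}_kc=c-(k\cdot c)k/|k|^2$ for $k\ne0$, $\mathfrak{L}_0c=c$. For $n>5/2$, an $H^n$-solution is a map in $C((-\mathscr{T},T),H^n)\cap C^1((-\mathscr{T},T),H^{n-1})$ ($\mathscr{T},T\in(0,+\infty]$) satisfying the equation; an $\mathscr{A}$-solution is a real-analytic map $(-\mathscr{T},T)\to\mathscr{A}$ satisfying it. The solution has datum $u_0$ if $u(0)=u_0$. It is known that for every datum in $H^n$ ($n>5/2$), resp. in $\mathscr{A}$, there is a unique maximal (non-extendable) $H^n$-solution, resp. $\mathscr{A}$-solution. $O_h$ is the group of orthogonal $3\times3$ matrices with integer entries. $O_h\ltimes\mathbb{T}^3$ is the set $O_h\times\mathbb{T}^3$ with the product $(S,a)(U,b)=(SU,a+Sb)$. For $(S,a)$ in this group and a vector field $v$ in $H^n$ or $\mathscr{A}$, $(\mathscr{E}_*(S,a)v)(x):=S\,v(S^{T}(x-a))$ (with $S^T$ the transpose), i.e. $(\mathscr{E}_*(S,a)v)_k=e^{-ia\cdot k}S\,v_{S^Tk}$; $\mathscr{E}_*(S,a)$ maps $H^n$ and $\mathscr{A}$ into themselves. *)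

theory Defs
  imports
    "HOL-Analysis.Analysis"
    "HOL-Library.Function_Algebras"
    "HOL-Algebra.Group"
begin

text \<open>Real vector space structure on functions (pointwise); addition and zero are those of
  \<^theory>\<open>HOL-Library.Function_Algebras\<close>.\<close>

instantiation "fun" :: (type, scaleR) scaleR
begin
definition scaleR_fun_def: "c *\<^sub>R f = (\<lambda>x. c *\<^sub>R f x)"
instance ..
end

instance "fun" :: (type, real_vector) real_vector
  by standard (auto simp: scaleR_fun_def plus_fun_def scaleR_add_right scaleR_add_left)


section \<open>Vectors, matrices and the torus\<close>

definition rvec :: "int^3 \<Rightarrow> real^3" where
  "rvec k = (\<chi> s. of_int (k $ s))"

definition cvec :: "int^3 \<Rightarrow> complex^3" where
  "cvec k = (\<chi> s. of_int (k $ s))"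

definition rmat :: "int^3^3 \<Rightarrow> real^3^3" where
  "rmat S = (\<chi> i j. of_int (S $ i $ j))"

definition cmat :: "int^3^3 \<Rightarrow> complex^3^3" where
  "cmat S = (\<chi> i j. of_int (S $ i $ j))"

text \<open>The bilinear product, without conjugation.\<close>

definition cdot :: "complex^3 \<Rightarrow> complex^3 \<Rightarrow> complex" where
  "cdot a b = (\<Sum>s\<in>UNIV. a $ s * b $ s)"

definition torus_rel :: "real^3 \<Rightarrow> real^3 \<Rightarrow> bool" where
  "torus_rel a b \<longleftrightarrow> (\<exists>m. a - b = (2 * pi) *\<^sub>R rvec m)"

lemma rvec_arith [simp]:
  "rvec 0 = 0" "rvec (k + l) = rvec k + rvec l" "rvec (- k) = - rvec k"
  by (simp_all add: rvec_def vec_eq_iff)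

quotient_type torus = "real^3" / torus_rel
proof (rule equivpI)
  show "reflp torus_rel"
    by (rule reflpI) (auto simp: torus_rel_def intro: exI[of _ 0])
  show "symp torus_rel"
  proof (rule sympI)
    fix a b assume "torus_rel a b"
    then obtain m where "a - b = (2 * pi) *\<^sub>R rvec m" by (auto simp: torus_rel_def)
    then have "b - a = (2 * pi) *\<^sub>R rvec (- m)" by (simp add: algebra_simps)
    then show "torus_rel b a" unfolding torus_rel_def by blast
  qed
  show "transp torus_rel"
  proof (rule transpI)
    fix a b c assume "torus_rel a b" "torus_rel b c"
    then obtain m l where "a - b = (2 * pi) *\<^sub>R rvec m" "b - c = (2 * pi) *\<^sub>R rvec l"
      by (auto simp: torus_rel_def)
    then have "a - c = (2 * pi) *\<^sub>R rvec (m + l)"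
      by (simp add: scaleR_add_right algebra_simps)
    then show "torus_rel a c" unfolding torus_rel_def by blast
  qed
qed

lemma rmat_mult_rvec: "rmat S *v rvec k = rvec (S *v k)"
  by (simp add: rmat_def rvec_def vec_eq_iff matrix_vector_mult_def)

instantiation torus :: ab_group_add
begin

lift_definition zero_torus :: torus is "0" .

lift_definition plus_torus :: "torus \<Rightarrow> torus \<Rightarrow> torus" is "(+)"
proof -
  fix a b c d assume "torus_rel a b" "torus_rel c d"
  then obtain m l where "a - b = (2 * pi) *\<^sub>R rvec m" "c - d = (2 * pi) *\<^sub>R rvec l"
    by (auto simp: torus_rel_def)
  then have "a + c - (b + d) = (2 * pi) *\<^sub>R rvec (m + l)"
    by (simp add: scaleR_add_right algebra_simps)
  then show "torus_rel (a + c) (b + d)" unfolding torus_rel_def by blast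
qed

lift_definition uminus_torus :: "torus \<Rightarrow> torus" is "uminus"
proof -
  fix a b assume "torus_rel a b"
  then obtain m where "a - b = (2 * pi) *\<^sub>R rvec m"
    by (auto simp: torus_rel_def)
  then have "- a - (- b) = (2 * pi) *\<^sub>R rvec (- m)"
    by (simp add: algebra_simps)
  then show "torus_rel (- a) (- b)" unfolding torus_rel_def by blast
qed

definition minus_torus :: "torus \<Rightarrow> torus \<Rightarrow> torus" where
  "minus_torus a b = a + (- b)"

instance
proof
  fix a b c :: torus
  show "a + b + c = a + (b + c)"
    by (transfer, auto simp: algebra_simps torus_rel_def intro: exI[of _ 0])
  show "a + b = b + a"
    by (transfer, auto simp: algebra_simps torus_rel_def intro: exI[of _ 0])
  show "0 + a = a"
    by (transfer, auto simp: torus_rel_def intro: exI[of _ 0])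
  show "- a + a = 0"
    by (transfer, auto simp: torus_rel_def intro: exI[of _ 0])
  show "a - b = a + - b"
    by (simp add: minus_torus_def)
qed

end

lift_definition torus_act :: "int^3^3 \<Rightarrow> torus \<Rightarrow> torus" is "\<lambda>S a. rmat S *v a"
proof -
  fix S :: "int^3^3" and a b assume "torus_rel a b"
  then obtain m where "a - b = (2 * pi) *\<^sub>R rvec m"
    by (auto simp: torus_rel_def)
  then have "rmat S *v (a - b) = (2 * pi) *\<^sub>R rvec (S *v m)"
    by (simp add: matrix_vector_mult_scaleR rmat_mult_rvec)
  then have "rmat S *v a - rmat S *v b = (2 * pi) *\<^sub>R rvec (S *v m)"
    by (simp add: matrix_vector_mult_diff_distrib)
  then show "torus_rel (rmat S *v a) (rmat S *v b)" unfolding torus_rel_def by blast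
qed

text \<open>The character \<open>x \<mapsto> exp (i k \<bullet> x)\<close>.\<close>

lift_definition expi :: "int^3 \<Rightarrow> torus \<Rightarrow> complex" is "\<lambda>k x. cis (rvec k \<bullet> x)"
proof -
  fix k :: "int^3" and a b assume "torus_rel a b"
  then obtain m where m: "a - b = (2 * pi) *\<^sub>R rvec m"
    by (auto simp: torus_rel_def)
  define N :: int where "N = (\<Sum>s\<in>UNIV. k $ s * m $ s)"
  have "rvec k \<bullet> rvec m = of_int N"
    by (simp add: rvec_def inner_vec_def N_def)
  moreover have "rvec k \<bullet> a = rvec k \<bullet> b + rvec k \<bullet> (a - b)"
    by (simp add: inner_diff_right)
  ultimately have "rvec k \<bullet> a = rvec k \<bullet> b + 2 * pi * of_int N"
    using m by simp
  then show "cis (rvec k \<bullet> a) = cis (rvec k \<bullet> b)"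
    by (simp flip: cis_mult)
qed

definition O_h :: "(int^3^3) set" where
  "O_h = {S. orthogonal_matrix S}"

definition O_h_torus :: "((int^3^3) \<times> torus) monoid" where
  "O_h_torus = \<lparr>carrier = O_h \<times> UNIV,
     mult = (\<lambda>(S, a) (U, b). (S ** U, a + torus_act S b)),
     one = (mat 1, 0)\<rparr>"


lemma group_O_h_torus: "group O_h_torus"
proof (rule groupI)
  have tmul: "torus_act (S ** U) b = torus_act S (torus_act U b)" for S U b
    by transfer (auto simp: torus_rel_def matrix_vector_mul_assoc rmat_def matrix_matrix_mult_def
        intro!: exI[of _ 0])
  have tadd: "torus_act S (a + b) = torus_act S a + torus_act S b" for S a b
    by transfer (auto simp: torus_rel_def matrix_vector_right_distrib intro!: exI[of _ 0])
  have tone: "torus_act (mat 1) a = a" for a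
  proof transfer
    fix a :: "real^3"
    have "rmat (mat 1) = mat 1" by (simp add: rmat_def mat_def vec_eq_iff)
    then show "torus_rel (rmat (mat 1) *v a) a" by (auto simp: torus_rel_def intro!: exI[of _ 0])
  qed
  have mulc: "S ** U \<in> O_h" if "S \<in> O_h" "U \<in> O_h" for S U
  proof -
    have "transpose U ** transpose S ** (S ** U) = transpose U ** (transpose S ** S) ** U"
      "S ** U ** (transpose U ** transpose S) = S ** (U ** transpose U) ** transpose S"
      by (simp_all add: matrix_mul_assoc)
    with that show ?thesis
      by (simp add: O_h_def orthogonal_matrix_def matrix_transpose_mul)
  qed
  fix x y z
  show "\<one>\<^bsub>O_h_torus\<^esub> \<in> carrier O_h_torus"
    by (simp add: O_h_torus_def O_h_def orthogonal_matrix_def)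
  assume x: "x \<in> carrier O_h_torus"
  obtain S a where Sa: "x = (S, a)" "S \<in> O_h" using x by (auto simp: O_h_torus_def)
  show "\<one>\<^bsub>O_h_torus\<^esub> \<otimes>\<^bsub>O_h_torus\<^esub> x = x"
    by (simp add: O_h_torus_def Sa tone)
  show "\<exists>y\<in>carrier O_h_torus. y \<otimes>\<^bsub>O_h_torus\<^esub> x = \<one>\<^bsub>O_h_torus\<^esub>"
    using Sa(2) by (intro bexI[of _ "(transpose S, - torus_act (transpose S) a)"])
      (auto simp: O_h_torus_def Sa(1) O_h_def orthogonal_matrix_def)
  assume y: "y \<in> carrier O_h_torus"
  show "x \<otimes>\<^bsub>O_h_torus\<^esub> y \<in> carrier O_h_torus"
    using x y mulc by (auto simp: O_h_torus_def)
  assume z: "z \<in> carrier O_h_torus"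
  show "x \<otimes>\<^bsub>O_h_torus\<^esub> y \<otimes>\<^bsub>O_h_torus\<^esub> z =
      x \<otimes>\<^bsub>O_h_torus\<^esub> (y \<otimes>\<^bsub>O_h_torus\<^esub> z)"
    by (cases x; cases y; cases z)
       (simp add: O_h_torus_def matrix_mul_assoc tmul tadd add.assoc)
qed


section \<open>Function spaces\<close>

text \<open>A distribution on the torus is identified with the family of its Fourier coefficients; the
  families that occur are exactly those of at most polynomial growth, and the distribution is
  real iff the coefficients at opposite wave vectors are conjugate.\<close>

type_synonym vec_field = "int^3 \<Rightarrow> complex^3"

definition distributions :: "vec_field set" where
  "distributions = {v. (\<exists>C N. \<forall>k. norm (v k) \<le> C * (1 + norm (rvec k)) ^ N) \<and>
     (\<forall>k s. v (- k) $ s = cnj (v k $ s))}"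

definition solenoidal_mean_zero :: "vec_field set" where
  "solenoidal_mean_zero = {v \<in> distributions. v 0 = 0 \<and> (\<forall>k. cdot (cvec k) (v k) = 0)}"

definition H_space :: "real \<Rightarrow> vec_field set" where
  "H_space n = {v \<in> solenoidal_mean_zero.
     (\<lambda>k. norm (rvec k) powr (2 * n) * (norm (v k))\<^sup>2) summable_on UNIV}"

definition H_norm :: "real \<Rightarrow> vec_field \<Rightarrow> real" where
  "H_norm n v = sqrt (\<Sum>\<^sub>\<infinity>k. norm (rvec k) powr (2 * n) * (norm (v k))\<^sup>2)"

definition H_topology :: "real \<Rightarrow> vec_field topology" where
  "H_topology n = Metric_space.mtopology (H_space n) (\<lambda>v w. H_norm n (v - w))"

definition one_norm :: "int^3 \<Rightarrow> real" where
  "one_norm k = (\<Sum>s\<in>UNIV. \<bar>of_int (k $ s)\<bar>)"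

definition A_rho :: "real \<Rightarrow> vec_field set" where
  "A_rho \<rho> = {v \<in> solenoidal_mean_zero.
     Liminf cofinite (\<lambda>k. if v k = 0 then \<infinity> else ereal (norm (v k) powr (- 1 / one_norm k)))
       > ereal \<rho>}"

definition polyannulus :: "real \<Rightarrow> (complex^3) set" where
  "polyannulus \<rho> = {z. \<forall>s. 1 / \<rho> \<le> norm (z $ s) \<and> norm (z $ s) \<le> \<rho>}"

definition A_rho_norm :: "real \<Rightarrow> vec_field \<Rightarrow> real" where
  "A_rho_norm \<rho> v =
     (SUP z\<in>polyannulus \<rho>. norm (\<Sum>\<^sub>\<infinity>k. (\<Prod>s\<in>UNIV. z $ s powi (k $ s)) *s v k))"

definition A_space :: "vec_field set" where
  "A_space = (\<Union>\<rho>\<in>{1<..}. A_rho \<rho>)"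

text \<open>The locally convex inductive limit topology: a base of neighbourhoods of zero consists of
  the absolutely convex sets whose trace on each step of the union is a neighbourhood of zero
  there.  (Such sets are automatically absorbing; over the reals, a nonempty convex set is
  absolutely convex iff it is symmetric.)\<close>

definition A_zero_nhds :: "vec_field set set" where
  "A_zero_nhds = {U. U \<subseteq> A_space \<and> convex U \<and> (\<forall>v\<in>U. - v \<in> U) \<and>
     (\<forall>\<rho>>1. \<exists>\<delta>>0. {v \<in> A_rho \<rho>. A_rho_norm \<rho> v < \<delta>} \<subseteq> U)}"

definition A_open :: "vec_field set \<Rightarrow> bool" where
  "A_open W \<longleftrightarrow> W \<subseteq> A_space \<and> (\<forall>v\<in>W. \<exists>U\<in>A_zero_nhds. \<forall>x\<in>U. v + x \<in> W)"

definition A_topology :: "vec_field topology" where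
  "A_topology = topology A_open"

lemma A_zero_nhds_Int:
  assumes "U \<in> A_zero_nhds" "V \<in> A_zero_nhds"
  shows "U \<inter> V \<in> A_zero_nhds"
proof -
  have "\<exists>\<delta>>0. {v \<in> A_rho \<rho>. A_rho_norm \<rho> v < \<delta>} \<subseteq> U \<inter> V" if \<rho>: "\<rho> > 1" for \<rho>
  proof -
    obtain d where "d > 0" "{v \<in> A_rho \<rho>. A_rho_norm \<rho> v < d} \<subseteq> U"
      using assms(1) \<rho> unfolding A_zero_nhds_def by auto
    moreover obtain e where "e > 0" "{v \<in> A_rho \<rho>. A_rho_norm \<rho> v < e} \<subseteq> V"
      using assms(2) \<rho> unfolding A_zero_nhds_def by auto
    ultimately show ?thesis
      by (intro exI[of _ "min d e"]) auto
  qed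
  moreover have "convex (U \<inter> V)"
    using assms by (simp add: A_zero_nhds_def convex_Int)
  ultimately show ?thesis
    using assms by (simp add: A_zero_nhds_def le_infI1)
qed

lemma istopology_A_open: "istopology A_open"
  unfolding istopology_def
proof (intro conjI allI impI)
  fix W Z assume W: "A_open W" and Z: "A_open Z"
  show "A_open (W \<inter> Z)"
    unfolding A_open_def
  proof (intro conjI ballI)
    show "W \<inter> Z \<subseteq> A_space" using W by (auto simp: A_open_def)
    fix v assume "v \<in> W \<inter> Z"
    then obtain U V where "U \<in> A_zero_nhds" "\<forall>x\<in>U. v + x \<in> W" "V \<in> A_zero_nhds" "\<forall>x\<in>V. v + x \<in> Z"
      using W Z unfolding A_open_def by blast
    then show "\<exists>U\<in>A_zero_nhds. \<forall>x\<in>U. v + x \<in> W \<inter> Z"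
      by (intro bexI[of _ "U \<inter> V"] A_zero_nhds_Int) auto
  qed
next
  fix \<K> assume K: "\<forall>K\<in>\<K>. A_open K"
  show "A_open (\<Union>\<K>)"
    unfolding A_open_def
  proof (intro conjI ballI)
    show "\<Union>\<K> \<subseteq> A_space" using K by (auto simp: A_open_def)
    fix v assume "v \<in> \<Union>\<K>"
    then obtain W where "W \<in> \<K>" "v \<in> W" by blast
    moreover from this obtain U where "U \<in> A_zero_nhds" "\<forall>x\<in>U. v + x \<in> W"
      using K unfolding A_open_def by blast
    ultimately show "\<exists>U\<in>A_zero_nhds. \<forall>x\<in>U. v + x \<in> \<Union>\<K>" by blast
  qed
qed

lemma openin_A_topology: "openin A_topology W \<longleftrightarrow> A_open W"
  by (simp add: A_topology_def topology_inverse'[OF istopology_A_open])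


section \<open>The Euler equation\<close>

definition leray :: "int^3 \<Rightarrow> complex^3 \<Rightarrow> complex^3" where
  "leray k c = (if k = 0 then c
     else c - (cdot (cvec k) c / of_real ((norm (rvec k))\<^sup>2)) *s cvec k)"

definition euler_P :: "vec_field \<Rightarrow> vec_field \<Rightarrow> vec_field" where
  "euler_P v w = (\<lambda>k. - \<i> *s (\<Sum>\<^sub>\<infinity>h. cdot (v h) (cvec (k - h)) *s leray k (w (k - h))))"

text \<open>The open time interval from \<open>- Tm\<close> to \<open>Tp\<close>; the end points may be infinite.\<close>

definition time_interval :: "ereal \<Rightarrow> ereal \<Rightarrow> real set" where
  "time_interval Tm Tp = {t. - Tm < ereal t \<and> ereal t < Tp}"

definition has_derivative_in :: "vec_field topology \<Rightarrow> (real \<Rightarrow> vec_field) \<Rightarrow> vec_field \<Rightarrow> real \<Rightarrow> bool" where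
  "has_derivative_in X u d t \<longleftrightarrow> limitin X (\<lambda>h. (1 / h) *\<^sub>R (u (t + h) - u t)) d (at 0)"

definition C0_map :: "vec_field topology \<Rightarrow> real set \<Rightarrow> (real \<Rightarrow> vec_field) \<Rightarrow> bool" where
  "C0_map X I u \<longleftrightarrow> continuous_map (top_of_set I) X u"

definition C1_map :: "vec_field topology \<Rightarrow> real set \<Rightarrow> (real \<Rightarrow> vec_field) \<Rightarrow> bool" where
  "C1_map X I u \<longleftrightarrow> C0_map X I u \<and>
     (\<exists>u'. C0_map X I u' \<and> (\<forall>t\<in>I. has_derivative_in X u (u' t) t))"

text \<open>Real-analytic maps into \<open>A_space\<close>: locally the sum of a power series with coefficients in \<open>A_space\<close>,
  convergent in the inductive limit topology.\<close>

definition A_analytic_map :: "real set \<Rightarrow> (real \<Rightarrow> vec_field) \<Rightarrow> bool" where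
  "A_analytic_map I u \<longleftrightarrow> (\<forall>t\<^sub>0\<in>I. \<exists>\<epsilon>>0. \<exists>c :: nat \<Rightarrow> vec_field. (\<forall>j. c j \<in> A_space) \<and>
     (\<forall>t\<in>I. \<bar>t - t\<^sub>0\<bar> < \<epsilon> \<longrightarrow>
        limitin A_topology (\<lambda>N. \<Sum>j<N. (t - t\<^sub>0) ^ j *\<^sub>R c j) (u t) sequentially))"

definition satisfies_Euler :: "vec_field topology \<Rightarrow> real set \<Rightarrow> (real \<Rightarrow> vec_field) \<Rightarrow> bool" where
  "satisfies_Euler X I u \<longleftrightarrow> (\<forall>t\<in>I. has_derivative_in X u (euler_P (u t) (u t)) t)"

datatype setting = Sobolev real | Analytic

fun admissible :: "setting \<Rightarrow> bool" where
  "admissible (Sobolev n) \<longleftrightarrow> n > 5 / 2"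
| "admissible Analytic \<longleftrightarrow> True"

fun data_space :: "setting \<Rightarrow> vec_field set" where
  "data_space (Sobolev n) = H_space n"
| "data_space Analytic = A_space"

definition H_solution :: "real \<Rightarrow> ereal \<Rightarrow> ereal \<Rightarrow> (real \<Rightarrow> vec_field) \<Rightarrow> bool" where
  "H_solution n Tm Tp u \<longleftrightarrow> 0 < Tm \<and> 0 < Tp \<and>
     C0_map (H_topology n) (time_interval Tm Tp) u \<and>
     C1_map (H_topology (n - 1)) (time_interval Tm Tp) u \<and>
     satisfies_Euler (H_topology (n - 1)) (time_interval Tm Tp) u"

definition A_solution :: "ereal \<Rightarrow> ereal \<Rightarrow> (real \<Rightarrow> vec_field) \<Rightarrow> bool" where
  "A_solution Tm Tp u \<longleftrightarrow> 0 < Tm \<and> 0 < Tp \<and>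
     A_analytic_map (time_interval Tm Tp) u \<and>
     satisfies_Euler A_topology (time_interval Tm Tp) u"

fun solution :: "setting \<Rightarrow> ereal \<Rightarrow> ereal \<Rightarrow> (real \<Rightarrow> vec_field) \<Rightarrow> bool" where
  "solution (Sobolev n) Tm Tp u \<longleftrightarrow> H_solution n Tm Tp u"
| "solution Analytic Tm Tp u \<longleftrightarrow> A_solution Tm Tp u"

text \<open>A solution is a function on its interval; the values of \<open>u\<close> elsewhere are irrelevant.
  Maximal means non-extendable.\<close>

definition maximal_solution ::
  "setting \<Rightarrow> vec_field \<Rightarrow> ereal \<Rightarrow> ereal \<Rightarrow> (real \<Rightarrow> vec_field) \<Rightarrow> bool" where
  "maximal_solution r u\<^sub>0 Tm Tp u \<longleftrightarrow> solution r Tm Tp u \<and> u 0 = u\<^sub>0 \<and>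
     (\<forall>Tm' Tp' w. solution r Tm' Tp' w \<and> Tm \<le> Tm' \<and> Tp \<le> Tp' \<and>
        (\<forall>t\<in>time_interval Tm Tp. w t = u t) \<longrightarrow> Tm' = Tm \<and> Tp' = Tp)"


section \<open>The symmetry action\<close>

definition E_star :: "(int^3^3) \<times> torus \<Rightarrow> vec_field \<Rightarrow> vec_field" where
  "E_star = (\<lambda>(S, a) v k. expi (- k) a *s (cmat S *v v (transpose S *v k)))"

text \<open>On absolutely convergent Fourier series this is the push-forward
  \<open>x \<mapsto> S v (S\<^sup>T (x - a))\<close>.\<close>

definition field_value :: "vec_field \<Rightarrow> torus \<Rightarrow> complex^3" where
  "field_value v x = (\<Sum>\<^sub>\<infinity>k. expi k x *s v k)"

lemma expi_add: "expi k (x + y) = expi k x * expi k y"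
  by transfer (simp add: inner_add_right cis_mult)

lemma expi_minus: "expi k (- x) = expi (- k) x"
  by transfer simp

lemma expi_torus_act: "expi k (torus_act S x) = expi (transpose S *v k) x"
proof transfer
  fix k S and x :: "real^3"
  have "rvec k \<bullet> (rmat S *v x) = rvec (transpose S *v k) \<bullet> x"
    by (simp add: rmat_def rvec_def transpose_def inner_vec_def matrix_vector_mult_def sum_3
        algebra_simps del: transpose_matrix_vector)
  then show "cis (rvec k \<bullet> (rmat S *v x)) = cis (rvec (transpose S *v k) \<bullet> x)" by simp
qed

lemma norm_expi: "norm (expi k x) = 1"
  by transfer simp

lemma bij_O_h:
  assumes "S \<in> O_h"
  shows "bij (\<lambda>k. transpose S *v k)"
proof (rule o_bij[of "\<lambda>k. S *v k"])
  show "(\<lambda>k. S *v k) \<circ> (\<lambda>k. transpose S *v k) = id"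
    using assms by (auto simp: O_h_def orthogonal_matrix_def matrix_vector_mul_assoc
        simp del: transpose_matrix_vector)
  show "(\<lambda>k. transpose S *v k) \<circ> (\<lambda>k. S *v k) = id"
    using assms by (auto simp: O_h_def orthogonal_matrix_def matrix_vector_mul_assoc
        simp del: transpose_matrix_vector)
qed

lemma field_value_E_star:
  assumes S: "S \<in> O_h" and v: "(\<lambda>k. norm (v k)) summable_on UNIV"
  shows "field_value (E_star (S, a) v) x = cmat S *v field_value v (torus_act (transpose S) (x - a))"
proof -
  have key: "expi k x *s E_star (S, a) v k =
     cmat S *v (expi (transpose S *v k) (torus_act (transpose S) (x - a)) *s v (transpose S *v k))" for k
  proof -
    have "S *v (transpose S *v k) = k"
      using S by (simp add: O_h_def orthogonal_matrix_def matrix_vector_mul_assoc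
          del: transpose_matrix_vector)
    then have "expi (transpose S *v k) (torus_act (transpose S) (x - a)) = expi k (x - a)"
      by (simp add: expi_torus_act del: transpose_matrix_vector)
    also have "\<dots> = expi k x * expi (- k) a"
      by (simp only: diff_conv_add_uminus expi_add expi_minus)
    finally show ?thesis
      by (simp only: E_star_def split vector_scalar_commute[symmetric] vector_smult_assoc mult.assoc)
  qed
  let ?f = "\<lambda>k. expi k (torus_act (transpose S) (x - a)) *s v k"
  have nrm: "norm (c *s w) = norm c * norm w" for c and w :: "complex^3"
    by (simp add: norm_vec_def L2_set_right_distrib norm_mult)
  have sf: "?f summable_on UNIV"
    by (rule abs_summable_summable) (simp add: nrm norm_expi v)
  have bl: "bounded_linear (\<lambda>w :: complex^3. cmat S *v w)"
    by (intro linear_conv_bounded_linear[THEN iffD1] linearI)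
       (simp_all add: matrix_vector_right_distrib, simp add: matrix_vector_mult_def vec_eq_iff scaleR_sum_right)
  have "field_value (E_star (S, a) v) x = (\<Sum>\<^sub>\<infinity>k. cmat S *v ?f (transpose S *v k))"
    unfolding field_value_def by (simp add: key del: transpose_matrix_vector)
  also have "\<dots> = (\<Sum>\<^sub>\<infinity>k. cmat S *v ?f k)"
    by (rule infsum_reindex_bij_betw[OF bij_O_h[OF S], where f = "\<lambda>k. cmat S *v ?f k"])
  also have "\<dots> = cmat S *v (\<Sum>\<^sub>\<infinity>k. ?f k)"
    by (rule infsumI has_sum_bounded_linear[OF bl] has_sum_infsum sf)+
  finally show ?thesis by (simp add: field_value_def)
qed

end

theory Submission
  imports Defs "HOL-Library.Real_Mod"
begin

text \<open>Symmetry transformations and time reversal map solutions to solutions and are invertible, so they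
  map maximal solutions to maximal solutions. The statements about symmetric data then follow from
  uniqueness. For uniqueness, the difference \<open>\<delta>\<close> of two solutions \<open>u\<close>, \<open>w\<close> satisfies
  \<open>d/dt |\<delta>|\<^sup>2 = 2 \<langle>\<delta>, P(u, \<delta>)\<rangle> + 2 \<langle>\<delta>, P(\<delta>, w)\<rangle>\<close> in \<open>L\<^sup>2\<close>; the first product vanishes by incompressibility
  and the second is at most \<open>|\<delta>|\<^sup>2 \<Sum>\<^sub>k |k| |w\<^sub>k|\<close>, a sum that is controlled by the \<open>H\<^sup>n\<close> norm of \<open>w\<close> because
  \<open>n > 5/2\<close>. Analytic solutions are covered too, because the inductive limit topology is finer than
  every \<open>H\<^sup>m\<close> topology; this rests on Cauchy's estimate for the Fourier coefficients, which also
  shows that the neighbourhoods of zero can be described by the moduli \<open>|v\<^sub>k|\<close> and the \<open>\<ell>\<^sup>1\<close> norm of \<open>k\<close>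
  only, and hence that the lattice symmetries act continuously.\<close>
section \<open>Square summable families\<close>

text \<open>The function spaces of the statement are sets of coefficient families carrying
  topologies, and derivatives are limits of difference quotients in these topologies. To
  differentiate the energy and to use compactness in time, a field v is replaced by the weighted
  family |k|^m v_k, an element of the inner product space \<open>ell2\<close>. The energy lives in
  H^0 because the time derivative of an H^n-solution is known only in H^(n-1), one order below the
  solution itself, and n - 1 is nonnegative.

  The Leray projection disappears from the energy: it only removes multiples of k, to which
  divergence free coefficients are orthogonal.

  Maximality means non-extendability, so uniqueness on a common interval does not by itself identify
  two maximal solutions. They are glued to a solution that extends both; this works because being a
  solution depends only on the germ at each time, which is what \<open>local_solution\<close>
  expresses.\<close>

lemma summable_on_norm_add_sq:
  fixes f g :: "'i \<Rightarrow> 'a::real_inner"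
  assumes "(\<lambda>i. (norm (f i))\<^sup>2) summable_on A" "(\<lambda>i. (norm (g i))\<^sup>2) summable_on A"
  shows "(\<lambda>i. (norm (f i + g i))\<^sup>2) summable_on A"
proof (rule summable_on_comparison_test)
  show "(\<lambda>i. 2 * (norm (f i))\<^sup>2 + 2 * (norm (g i))\<^sup>2) summable_on A"
    by (intro summable_on_add summable_on_cmult_right assms)
  fix i
  have "(norm (f i + g i))\<^sup>2 \<le> (norm (f i) + norm (g i))\<^sup>2"
    by (intro power_mono norm_triangle_ineq) auto
  also have "\<dots> \<le> 2 * (norm (f i))\<^sup>2 + 2 * (norm (g i))\<^sup>2"
    using sum_squares_bound[of "norm (f i)" "norm (g i)"] by (simp add: power2_sum)
  finally show "(norm (f i + g i))\<^sup>2 \<le> 2 * (norm (f i))\<^sup>2 + 2 * (norm (g i))\<^sup>2" .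
qed auto

lemma summable_on_norm_scaleR_sq:
  fixes f :: "'i \<Rightarrow> 'a::real_inner"
  assumes "(\<lambda>i. (norm (f i))\<^sup>2) summable_on A"
  shows "(\<lambda>i. (norm (c *\<^sub>R f i))\<^sup>2) summable_on A"
  using summable_on_cmult_right[OF assms, of "c\<^sup>2"] by (simp add: power_mult_distrib)

lemma summable_on_inner:
  fixes f g :: "'i \<Rightarrow> 'a::real_inner"
  assumes "(\<lambda>i. (norm (f i))\<^sup>2) summable_on A" "(\<lambda>i. (norm (g i))\<^sup>2) summable_on A"
  shows "(\<lambda>i. f i \<bullet> g i) summable_on A"
proof (rule abs_summable_summable, rule summable_on_comparison_test)
  show "(\<lambda>i. (norm (f i))\<^sup>2 + (norm (g i))\<^sup>2) summable_on A"
    by (intro summable_on_add assms)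
  fix i
  have "norm (f i \<bullet> g i) \<le> norm (f i) * norm (g i)" by (simp add: Cauchy_Schwarz_ineq2)
  also have "\<dots> \<le> (norm (f i))\<^sup>2 + (norm (g i))\<^sup>2"
    using sum_squares_bound[of "norm (f i)" "norm (g i)"] mult_nonneg_nonneg[OF norm_ge_zero[of "f i"] norm_ge_zero[of "g i"]] by linarith
  finally show "norm (f i \<bullet> g i) \<le> (norm (f i))\<^sup>2 + (norm (g i))\<^sup>2" .
qed auto

text \<open>Wrapping the square summable families into a type makes
  \<open>has_vector_derivative\<close>, the inner product calculus and compactness arguments
  available for them. Sobolev spaces of every order are mapped into one and the same instance of
  it.\<close>

typedef (overloaded) ('i, 'a::real_inner) ell2 =
  "{f :: 'i \<Rightarrow> 'a. (\<lambda>i. (norm (f i))\<^sup>2) summable_on UNIV}"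
  morphisms ell2_coeff Ell2
  by (rule exI[of _ "\<lambda>_. 0"]) simp

setup_lifting type_definition_ell2

instantiation ell2 :: (type, real_inner) real_vector
begin

lift_definition zero_ell2 :: "('a, 'b) ell2" is "\<lambda>_. 0" by simp

lift_definition plus_ell2 :: "('a, 'b) ell2 \<Rightarrow> ('a, 'b) ell2 \<Rightarrow> ('a, 'b) ell2"
  is "\<lambda>f g i. f i + g i" by (rule summable_on_norm_add_sq)

lift_definition uminus_ell2 :: "('a, 'b) ell2 \<Rightarrow> ('a, 'b) ell2" is "\<lambda>f i. - f i" by simp

lift_definition minus_ell2 :: "('a, 'b) ell2 \<Rightarrow> ('a, 'b) ell2 \<Rightarrow> ('a, 'b) ell2"
  is "\<lambda>f g i. f i - g i"
  using summable_on_norm_add_sq[where g = "\<lambda>i. - g i" for g :: "'a \<Rightarrow> 'b"] by simp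

lift_definition scaleR_ell2 :: "real \<Rightarrow> ('a, 'b) ell2 \<Rightarrow> ('a, 'b) ell2"
  is "\<lambda>c f i. c *\<^sub>R f i" by (rule summable_on_norm_scaleR_sq)

instance
proof
  fix x y z :: "('a, 'b) ell2" and a b :: real
  show "x + y + z = x + (y + z)" by transfer (simp add: add.assoc)
  show "x + y = y + x" by transfer (simp add: add.commute)
  show "0 + x = x" by transfer simp
  show "- x + x = 0" by transfer simp
  show "x - y = x + - y" by transfer simp
  show "a *\<^sub>R (x + y) = a *\<^sub>R x + a *\<^sub>R y" by transfer (simp add: scaleR_add_right)
  show "(a + b) *\<^sub>R x = a *\<^sub>R x + b *\<^sub>R x" by transfer (simp add: scaleR_add_left)
  show "a *\<^sub>R b *\<^sub>R x = (a * b) *\<^sub>R x" by transfer simp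
  show "1 *\<^sub>R x = x" by transfer simp
qed

end

instantiation ell2 :: (type, real_inner) real_inner
begin

lift_definition inner_ell2 :: "('a, 'b) ell2 \<Rightarrow> ('a, 'b) ell2 \<Rightarrow> real"
  is "\<lambda>f g. \<Sum>\<^sub>\<infinity>i. f i \<bullet> g i" .

definition norm_ell2 :: "('a, 'b) ell2 \<Rightarrow> real" where "norm_ell2 x = sqrt (x \<bullet> x)"

definition sgn_ell2 :: "('a, 'b) ell2 \<Rightarrow> ('a, 'b) ell2" where "sgn_ell2 x = x /\<^sub>R norm x"

definition dist_ell2 :: "('a, 'b) ell2 \<Rightarrow> ('a, 'b) ell2 \<Rightarrow> real" where "dist_ell2 x y = norm (x - y)"

definition uniformity_ell2 :: "(('a, 'b) ell2 \<times> ('a, 'b) ell2) filter" where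
  "uniformity_ell2 = (INF e\<in>{0<..}. principal {(x, y). dist x y < e})"

definition open_ell2 :: "('a, 'b) ell2 set \<Rightarrow> bool" where
  "open_ell2 U \<longleftrightarrow> (\<forall>x\<in>U. \<forall>\<^sub>F (x', y) in uniformity. x' = x \<longrightarrow> y \<in> U)"

instance
proof
  fix x y z :: "('a, 'b) ell2" and a b :: real
  show "x \<bullet> y = y \<bullet> x" by transfer (simp add: inner_commute)
  show "(x + y) \<bullet> z = x \<bullet> z + y \<bullet> z"
    by transfer (simp add: inner_add_left infsum_add summable_on_inner)
  show "a *\<^sub>R x \<bullet> y = a * (x \<bullet> y)"
    by transfer (simp add: infsum_cmult_right')
  show "0 \<le> x \<bullet> x" by transfer (simp add: infsum_nonneg)
  show "x \<bullet> x = 0 \<longleftrightarrow> x = 0"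
  proof transfer
    fix f :: "'a \<Rightarrow> 'b" assume f: "(\<lambda>i. (norm (f i))\<^sup>2) summable_on UNIV"
    then have s: "(\<lambda>i. f i \<bullet> f i) summable_on UNIV" by (simp add: power2_norm_eq_inner)
    show "(\<Sum>\<^sub>\<infinity>i. f i \<bullet> f i) = 0 \<longleftrightarrow> f = (\<lambda>_. 0)"
    proof
      assume "(\<Sum>\<^sub>\<infinity>i. f i \<bullet> f i) = 0"
      then have "f i \<bullet> f i = 0" for i
        using nonneg_infsum_le_0D[of "\<lambda>i. f i \<bullet> f i" UNIV i] s by simp
      then show "f = (\<lambda>_. 0)" by auto
    qed simp
  qed
qed (simp_all add: norm_ell2_def sgn_ell2_def dist_ell2_def uniformity_ell2_def open_ell2_def)

end

lemma norm_ell2: "norm (x :: ('i, 'a::real_inner) ell2) = sqrt (\<Sum>\<^sub>\<infinity>i. (norm (ell2_coeff x i))\<^sup>2)"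
  by (simp add: norm_ell2_def inner_ell2.rep_eq power2_norm_eq_inner)

section \<open>Sums over the lattice\<close>

lemma summable_on_int_powr:
  assumes "s > 1"
  shows "(\<lambda>i::int. (1 + \<bar>of_int i\<bar>) powr (- s) :: real) summable_on UNIV"
proof -
  let ?f = "\<lambda>i::int. (1 + \<bar>of_int i\<bar>) powr (- s) :: real"
  have "summable (\<lambda>n. of_nat n powr (- s) :: real)"
    using assms by (simp add: summable_real_powr_iff)
  then have "summable (\<lambda>n. of_nat (Suc n) powr (- s) :: real)"
    by (subst summable_Suc_iff[of "\<lambda>n. of_nat n powr (- s) :: real"])
  then have s: "(\<lambda>n. of_nat (Suc n) powr (- s) :: real) summable_on UNIV"
    by (intro summable_nonneg_imp_summable_on) auto
  have "(?f \<circ> int) summable_on UNIV" "(?f \<circ> (\<lambda>n. - int n)) summable_on UNIV"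
    using s by (simp_all add: o_def)
  then have "?f summable_on range int" "?f summable_on range (\<lambda>n. - int n)"
    by (subst summable_on_reindex; simp add: inj_on_def)+
  then have "?f summable_on (range int \<union> range (\<lambda>n. - int n))"
    by (rule summable_on_union)
  moreover have "range int \<union> range (\<lambda>n. - int n) = UNIV"
  proof -
    have "x \<in> range int \<union> range (\<lambda>n. - int n)" for x by (cases x rule: int_cases2) auto
    then show ?thesis by blast
  qed
  ultimately show ?thesis by simp
qed

text \<open>The terms are nonnegative, so it suffices to bound finite partial sums. A finite set of
  vectors lies in the box of its coordinate projections, and over a box the sum of products is a
  product of sums, each at most \<open>infsum f UNIV\<close>.\<close>

lemma summable_on_prod_components:
  fixes f :: "'a \<Rightarrow> real"
  assumes f: "f summable_on UNIV" and nonneg: "\<And>i. f i \<ge> 0"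
  shows "(\<lambda>k :: 'a ^ 'n. \<Prod>s\<in>UNIV. f (k $ s)) summable_on UNIV"
proof (rule nonneg_bdd_above_summable_on)
  have "sum (\<lambda>k :: 'a ^ 'n. \<Prod>s\<in>UNIV. f (k $ s)) F \<le> infsum f UNIV ^ CARD('n)" if F: "finite F" for F
  proof -
    define B where "B = (\<lambda>s. (\<lambda>k :: 'a ^ 'n. k $ s) ` F)"
    have "(\<Sum>k\<in>F. \<Prod>s\<in>UNIV. f (k $ s)) = (\<Sum>g\<in>vec_nth ` F. \<Prod>s\<in>UNIV. f (g s))"
      by (subst sum.reindex) (auto simp: inj_on_def vec_nth_inject)
    also have "\<dots> \<le> (\<Sum>g\<in>PiE UNIV B. \<Prod>s\<in>UNIV. f (g s))"
      using F nonneg by (intro sum_mono2 finite_PiE prod_nonneg) (auto simp: B_def)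
    also have "\<dots> = (\<Prod>s\<in>UNIV. \<Sum>i\<in>B s. f i)"
      using F by (intro prod_sum_PiE[symmetric]) (auto simp: B_def)
    also have "\<dots> \<le> (\<Prod>s\<in>(UNIV::'n set). infsum f UNIV)"
      using F nonneg by (intro prod_mono conjI sum_nonneg finite_sum_le_infsum f) (auto simp: B_def)
    finally show ?thesis by simp
  qed
  then show "bdd_above (sum (\<lambda>k :: 'a ^ 'n. \<Prod>s\<in>UNIV. f (k $ s)) ` {F. F \<subseteq> UNIV \<and> finite F})"
    by (intro bdd_aboveI) auto
qed (simp add: nonneg prod_nonneg)

lemma norm_rvec_ge_1:
  assumes "k \<noteq> 0" shows "1 \<le> norm (rvec k)"
proof -
  obtain s where "k $ s \<noteq> 0" using assms by (auto simp: vec_eq_iff)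
  then have "1 \<le> \<bar>k $ s\<bar>" by linarith
  then have "1 \<le> \<bar>rvec k $ s\<bar>" by (simp add: rvec_def flip: of_int_abs)
  then show ?thesis using component_le_norm_cart order_trans by blast
qed

lemma norm_rvec_eq_0_iff [simp]: "norm (rvec k) = 0 \<longleftrightarrow> k = 0"
  using norm_rvec_ge_1[of k] by fastforce

lemma rvec_eq_0_iff [simp]: "rvec k = 0 \<longleftrightarrow> k = 0"
  using norm_rvec_eq_0_iff[of k] by simp

lemma norm_rvec_le_one_norm: "norm (rvec k) \<le> one_norm k"
  using norm_le_l1_cart[of "rvec k"] by (simp add: one_norm_def rvec_def)

lemma one_norm_nonneg: "0 \<le> one_norm k"
  by (simp add: one_norm_def sum_nonneg)

lemma one_norm_ge_1: "k \<noteq> 0 \<Longrightarrow> 1 \<le> one_norm k"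
  using norm_rvec_ge_1 norm_rvec_le_one_norm order_trans by blast

text \<open>The exponent is shared equally among the three coordinates: each |k_i| is at most |k|,
  which reduces the lattice sum to a product of one-dimensional sums with exponent s / 3 >
  1.\<close>

lemma summable_on_lattice_powr:
  assumes "s > 3"
  shows "(\<lambda>k. (1 + norm (rvec k)) powr (- s)) summable_on UNIV"
proof (rule summable_on_comparison_test)
  show "(\<lambda>k::int^3. \<Prod>i\<in>UNIV. (1 + \<bar>of_int (k $ i)\<bar>) powr (- (s / 3)) :: real) summable_on UNIV"
    using assms by (intro summable_on_prod_components summable_on_int_powr) auto
  fix k :: "int^3"
  have "(1 + norm (rvec k)) powr (- s) = (\<Prod>i\<in>(UNIV::3 set). (1 + norm (rvec k)) powr (- (s / 3)))"
    by (simp add: powr_powr flip: powr_realpow')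
  also have "\<dots> \<le> (\<Prod>i\<in>UNIV. (1 + \<bar>of_int (k $ i)\<bar>) powr (- (s / 3)))"
  proof (intro prod_mono conjI powr_mono2')
    fix i show "1 + \<bar>of_int (k $ i)\<bar> \<le> 1 + norm (rvec k)"
      using component_le_norm_cart[of "rvec k" i] by (simp add: rvec_def)
  qed (use assms in auto)
  finally show "(1 + norm (rvec k)) powr (- s) \<le> (\<Prod>i\<in>UNIV. (1 + \<bar>of_int (k $ i)\<bar>) powr (- (s / 3)))" .
qed auto

lemma exponential_le_powr:
  fixes q p :: real
  assumes q: "0 < q" "q < 1"
  obtains C where "C > 0" "\<And>x. x \<ge> 0 \<Longrightarrow> q powr x \<le> C * (1 + x) powr (- p)"
proof -
  define c where "c = - ln q"
  have c: "c > 0" using q by (simp add: c_def)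
  define m where "m = Suc (nat \<lceil>p\<rceil>)"
  have m: "p \<le> m" "m > 0" by (auto simp: m_def) linarith
  have "q powr x \<le> (exp c * (m / c) ^ m) * (1 + x) powr (- p)" if x: "x \<ge> 0" for x
  proof -
    \<comment> \<open>The inequality y <= exp y at y = c (1 + x) / m, raised to the power m,
      produces the constant (m / c)^m; passing from x to 1 + x costs the factor exp c.\<close>
    have "c * (1 + x) / m \<le> exp (c * (1 + x) / m)"
      using exp_ge_add_one_self[of "c * (1 + x) / m"] by linarith
    then have "(c * (1 + x) / m) ^ m \<le> exp (c * (1 + x) / m) ^ m"
      using c x by (intro power_mono) auto
    also have "\<dots> = exp (c * (1 + x))"
      using m by (simp add: exp_of_nat_mult [symmetric])
    also have "\<dots> = exp c / q powr x"
      using q by (simp add: c_def powr_def exp_add [symmetric] exp_diff [symmetric] algebra_simps)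
    finally have "q powr x * (c * (1 + x) / m) ^ m \<le> exp c"
      using q by (simp add: field_simps)
    then have "q powr x * (c * (1 + x) / m) ^ m * (m / c) ^ m \<le> exp c * (m / c) ^ m"
      using c by (intro mult_right_mono) auto
    moreover have "(c * (1 + x) / m) ^ m * (m / c) ^ m = (1 + x) ^ m"
      using c m by (simp flip: power_mult_distrib)
    ultimately have "q powr x * (1 + x) ^ m \<le> exp c * (m / c) ^ m"
      by (simp add: mult.assoc)
    moreover have "(1 + x) powr p \<le> (1 + x) ^ m"
      using m x powr_mono[of p "real m" "1 + x"] by (simp add: powr_realpow)
    ultimately have "q powr x * (1 + x) powr p \<le> exp c * (m / c) ^ m"
      using q by (meson mult_left_mono order_trans powr_ge_zero)
    then have "q powr x \<le> (exp c * (m / c) ^ m) / (1 + x) powr p"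
      by (subst pos_le_divide_eq) (use x in auto)
    then show ?thesis by (simp only: powr_minus_divide times_divide_eq_right mult_1_right)
  qed
  then show ?thesis using that[of "exp c * (m / c) ^ m"] c m by simp
qed

lemma summable_on_lattice_exponential:
  assumes "0 < q" "q < 1"
  shows "(\<lambda>k. (1 + norm (rvec k)) powr p * q powr one_norm k) summable_on UNIV"
proof -
  \<comment> \<open>Four orders more than p leave the decay (1 + |k|)^(-4), which is summable in
    dimension three.\<close>
  obtain C where C: "C > 0" "\<And>x. x \<ge> 0 \<Longrightarrow> q powr x \<le> C * (1 + x) powr (- (p + 4))"
    using exponential_le_powr[OF assms, of "p + 4"] by blast
  show ?thesis
  proof (rule summable_on_comparison_test)
    show "(\<lambda>k. C * (1 + norm (rvec k)) powr (- 4)) summable_on UNIV"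
      by (intro summable_on_cmult_right summable_on_lattice_powr) simp
    fix k
    let ?x = "norm (rvec k)"
    have "q powr one_norm k \<le> q powr ?x"
      using assms norm_rvec_le_one_norm by (simp add: powr_mono')
    also have "\<dots> \<le> C * (1 + ?x) powr (- (p + 4))" by (rule C) simp
    finally have "(1 + ?x) powr p * q powr one_norm k \<le> (1 + ?x) powr p * (C * (1 + ?x) powr (- (p + 4)))"
      by (intro mult_left_mono) auto
    also have "\<dots> = C * ((1 + ?x) powr p * (1 + ?x) powr (- (p + 4)))" by simp
    also have "\<dots> = C * (1 + ?x) powr (- 4)" by (simp flip: powr_add)
    finally show "(1 + ?x) powr p * q powr one_norm k \<le> C * (1 + ?x) powr (- 4)" .
  qed simp
qed

text \<open>With either index as the inner one, the inner sum runs over a translate or a reflected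
  translate of \<open>c\<close> and equals \<open>infsum c UNIV\<close> whatever the outer index is.
  Nonnegativity makes the double family summable.\<close>

lemma
  fixes f c :: "'g::ab_group_add \<Rightarrow> real"
  assumes f: "f summable_on UNIV" "\<And>k. 0 \<le> f k" and c: "c summable_on UNIV" "\<And>k. 0 \<le> c k"
  shows has_sum_convolution_left:
      "((\<lambda>(k, l). f k * c (k - l)) has_sum (infsum f UNIV * infsum c UNIV)) UNIV"
    and has_sum_convolution_right:
      "((\<lambda>(k, l). f l * c (k - l)) has_sum (infsum f UNIV * infsum c UNIV)) UNIV"
proof -
  have prod: "((\<lambda>(k, l). f k * g (k, l)) has_sum (infsum f UNIV * infsum c UNIV)) (UNIV \<times> UNIV)"
    if g: "\<And>k. ((\<lambda>l. g (k, l)) has_sum infsum c UNIV) UNIV" and nn: "\<And>x. 0 \<le> g x" for g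
  proof (rule has_sum_SigmaI)
    show a: "((\<lambda>l. case (k, l) of (k, l) \<Rightarrow> f k * g (k, l)) has_sum f k * infsum c UNIV) UNIV" for k
      using has_sum_cmult_right[OF g] by simp
    show b: "((\<lambda>k. f k * infsum c UNIV) has_sum infsum f UNIV * infsum c UNIV) UNIV"
      by (intro has_sum_cmult_left has_sum_infsum f)
    show "(\<lambda>(k, l). f k * g (k, l)) summable_on UNIV \<times> UNIV"
      by (rule summable_on_SigmaI[OF a]) (use b f nn in \<open>auto simp: summable_on_def\<close>)
  qed
  have r1: "((\<lambda>l. c (k - l)) has_sum infsum c UNIV) UNIV" for k
    using has_sum_infsum[OF c(1)]
    by (subst has_sum_reindex_bij_witness[of UNIV "\<lambda>h. k - h" "\<lambda>l. k - l" UNIV c]) auto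
  have r2: "((\<lambda>l. c (l - k)) has_sum infsum c UNIV) UNIV" for k
    using has_sum_infsum[OF c(1)]
    by (subst has_sum_reindex_bij_witness[of UNIV "\<lambda>h. k + h" "\<lambda>l. l - k" UNIV c]) auto
  show "((\<lambda>(k, l). f k * c (k - l)) has_sum (infsum f UNIV * infsum c UNIV)) UNIV"
    using prod[of "\<lambda>(k, l). c (k - l)"] r1 c by (simp add: case_prod_unfold)
  have "((\<lambda>(k, l). f k * c (l - k)) has_sum (infsum f UNIV * infsum c UNIV)) (UNIV \<times> UNIV)"
    using prod[of "\<lambda>(k, l). c (l - k)"] r2 c by (simp add: case_prod_unfold)
  then show "((\<lambda>(k, l). f l * c (k - l)) has_sum (infsum f UNIV * infsum c UNIV)) UNIV"
    by (subst (asm) has_sum_swap) (simp add: case_prod_unfold)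
qed

text \<open>Schur's test for the kernel \<open>c (k - l)\<close>, in the weak form given by AM-GM.\<close>

lemma
  fixes a b c :: "'g::ab_group_add \<Rightarrow> real"
  assumes a: "(\<lambda>k. (a k)\<^sup>2) summable_on UNIV" "\<And>k. 0 \<le> a k"
    and b: "(\<lambda>k. (b k)\<^sup>2) summable_on UNIV" "\<And>k. 0 \<le> b k"
    and c: "c summable_on UNIV" "\<And>k. 0 \<le> c k"
  shows summable_on_convolution_form: "(\<lambda>(k, l). a k * b l * c (k - l)) summable_on UNIV"
    and infsum_convolution_form_le:
      "(\<Sum>\<^sub>\<infinity>(k, l). a k * b l * c (k - l)) \<le>
         ((\<Sum>\<^sub>\<infinity>k. (a k)\<^sup>2) + (\<Sum>\<^sub>\<infinity>k. (b k)\<^sup>2)) / 2 * infsum c UNIV"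
proof -
  let ?F = "\<lambda>x. ((case x of (k, l) \<Rightarrow> (a k)\<^sup>2 * c (k - l)) + (case x of (k, l) \<Rightarrow> (b l)\<^sup>2 * c (k - l))) / 2"
  let ?S = "((\<Sum>\<^sub>\<infinity>k. (a k)\<^sup>2) * infsum c UNIV + (\<Sum>\<^sub>\<infinity>k. (b k)\<^sup>2) * infsum c UNIV) / 2"
  have F: "(?F has_sum ?S) UNIV"
    using has_sum_cmult_right[OF has_sum_add[OF has_sum_convolution_left[OF a(1) _ c]
        has_sum_convolution_right[OF b(1) _ c]], of "1 / 2"] by simp
  have le: "(case x of (k, l) \<Rightarrow> a k * b l * c (k - l)) \<le> ?F x" for x
  proof (cases x)
    case (Pair k l)
    have "2 * a k * b l \<le> (a k)\<^sup>2 + (b l)\<^sup>2" by (rule sum_squares_bound)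
    from mult_right_mono[OF this, of "c (k - l)"] c show ?thesis
      by (simp add: Pair field_simps)
  qed
  show s: "(\<lambda>(k, l). a k * b l * c (k - l)) summable_on UNIV"
    by (rule summable_on_comparison_test[OF has_sum_imp_summable[OF F]]) (use le a b c in auto)
  have "(\<Sum>\<^sub>\<infinity>(k, l). a k * b l * c (k - l)) \<le> ?S"
    using has_sum_mono[OF has_sum_infsum[OF s] F] le by simp
  then show "(\<Sum>\<^sub>\<infinity>(k, l). a k * b l * c (k - l)) \<le>
         ((\<Sum>\<^sub>\<infinity>k. (a k)\<^sup>2) + (\<Sum>\<^sub>\<infinity>k. (b k)\<^sup>2)) / 2 * infsum c UNIV"
    by (simp add: field_simps)
qed

section \<open>Sobolev spaces\<close>

lemma norm_vector_smult: "norm (c *s (w :: complex^'n)) = norm c * norm w"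
  by (simp add: norm_vec_def L2_set_right_distrib norm_mult)

lemma norm_cdot_le: "norm (cdot a b) \<le> norm a * norm b"
proof -
  have "norm (cdot a b) \<le> (\<Sum>s\<in>UNIV. \<bar>norm (a $ s)\<bar> * \<bar>norm (b $ s)\<bar>)"
    unfolding cdot_def by (rule order_trans[OF norm_sum]) (simp add: norm_mult)
  also have "\<dots> \<le> norm a * norm b" unfolding norm_vec_def by (rule L2_set_mult_ineq)
  finally show ?thesis .
qed

lemma norm_cvec [simp]: "norm (cvec k) = norm (rvec k)"
  by (simp add: norm_vec_def cvec_def rvec_def)

lemma cvec_arith [simp]:
  "cvec 0 = 0" "cvec (k + l) = cvec k + cvec l" "cvec (- k) = - cvec k" "cvec (k - l) = cvec k - cvec l"
  by (simp_all add: cvec_def vec_eq_iff)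

lemma cdot_arith [simp]:
  "cdot 0 b = 0" "cdot a 0 = 0"
  "cdot (a + a') b = cdot a b + cdot a' b" "cdot a (b + b') = cdot a b + cdot a b'"
  "cdot (- a) b = - cdot a b" "cdot a (- b) = - cdot a b"
  "cdot (a - a') b = cdot a b - cdot a' b" "cdot a (b - b') = cdot a b - cdot a b'"
  "cdot (c *s a) b = c * cdot a b" "cdot a (c *s b) = c * cdot a b"
  "cdot (x *\<^sub>R a) b = x *\<^sub>R cdot a b" "cdot a (x *\<^sub>R b) = x *\<^sub>R cdot a b"
  by (simp_all add: cdot_def sum.distrib sum_negf sum_subtractf sum_distrib_left scaleR_sum_right algebra_simps)

lemma cdot_commute: "cdot a b = cdot b a"
  by (simp add: cdot_def mult.commute)

lemma fun_scaleR_apply [simp]: "(c *\<^sub>R (f :: 'a \<Rightarrow> 'b::real_vector)) x = c *\<^sub>R f x"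
  by (simp add: scaleR_fun_def)

lemma distributions_add: "v \<in> distributions \<Longrightarrow> w \<in> distributions \<Longrightarrow> v + w \<in> distributions"
proof -
  assume v: "v \<in> distributions" and w: "w \<in> distributions"
  obtain C N where C: "\<And>k. norm (v k) \<le> C * (1 + norm (rvec k)) ^ N"
    using v by (auto simp: distributions_def)
  obtain D M where D: "\<And>k. norm (w k) \<le> D * (1 + norm (rvec k)) ^ M"
    using w by (auto simp: distributions_def)
  have "norm ((v + w) k) \<le> (\<bar>C\<bar> + \<bar>D\<bar>) * (1 + norm (rvec k)) ^ (max N M)" for k
  proof -
    have "norm ((v + w) k) \<le> C * (1 + norm (rvec k)) ^ N + D * (1 + norm (rvec k)) ^ M"
      using norm_triangle_ineq[of "v k" "w k"] C[of k] D[of k] by simp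
    also have "\<dots> \<le> \<bar>C\<bar> * (1 + norm (rvec k)) ^ (max N M) + \<bar>D\<bar> * (1 + norm (rvec k)) ^ (max N M)"
      by (intro add_mono mult_mono power_increasing) auto
    finally show ?thesis by (simp add: distrib_right)
  qed
  moreover have "(v + w) (- k) $ s = cnj ((v + w) k $ s)" for k s
    using v w by (simp add: distributions_def)
  ultimately show ?thesis unfolding distributions_def by blast
qed

lemma distributions_scaleR: "v \<in> distributions \<Longrightarrow> c *\<^sub>R v \<in> distributions"
proof -
  assume v: "v \<in> distributions"
  obtain C N where C: "\<And>k. norm (v k) \<le> C * (1 + norm (rvec k)) ^ N"
    using v by (auto simp: distributions_def)
  have "norm ((c *\<^sub>R v) k) \<le> (\<bar>c\<bar> * C) * (1 + norm (rvec k)) ^ N" for k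
    using mult_left_mono[OF C[of k], of "\<bar>c\<bar>"] by (simp add: mult.assoc)
  moreover have "(c *\<^sub>R v) (- k) $ s = cnj ((c *\<^sub>R v) k $ s)" for k s
    using v by (simp add: distributions_def)
  ultimately show ?thesis unfolding distributions_def by blast
qed

lemma solenoidal_add:
  "v \<in> solenoidal_mean_zero \<Longrightarrow> w \<in> solenoidal_mean_zero \<Longrightarrow> v + w \<in> solenoidal_mean_zero"
  by (simp add: solenoidal_mean_zero_def distributions_add)

lemma solenoidal_scaleR: "v \<in> solenoidal_mean_zero \<Longrightarrow> c *\<^sub>R v \<in> solenoidal_mean_zero"
  by (simp add: solenoidal_mean_zero_def distributions_scaleR)

lemma solenoidal_at_0: "v \<in> solenoidal_mean_zero \<Longrightarrow> v 0 = 0"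
  by (simp add: solenoidal_mean_zero_def)

lemma solenoidal_cdot: "v \<in> solenoidal_mean_zero \<Longrightarrow> cdot (v k) (cvec k) = 0"
  by (subst cdot_commute) (simp add: solenoidal_mean_zero_def)

lemma solenoidal_reality: "v \<in> solenoidal_mean_zero \<Longrightarrow> v (- k) $ s = cnj (v k $ s)"
  by (simp add: solenoidal_mean_zero_def distributions_def)

lemma powr_norm_sq_eq: "norm (rvec k) powr (2 * n) * (norm (w::complex^3))\<^sup>2 = (norm ((norm (rvec k) powr n) *\<^sub>R w))\<^sup>2"
proof -
  have "norm (rvec k) powr (2 * n) = (norm (rvec k) powr n)\<^sup>2"
    by (simp only: mult_2 power2_eq_square powr_add)
  then show ?thesis by (simp add: power_mult_distrib)
qed

lemma H_space_iff:
  "v \<in> H_space n \<longleftrightarrow> v \<in> solenoidal_mean_zero \<and>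
     (\<lambda>k. (norm ((norm (rvec k) powr n) *\<^sub>R v k))\<^sup>2) summable_on UNIV"
  by (simp add: H_space_def powr_norm_sq_eq)

lemma H_space_solenoidal: "v \<in> H_space n \<Longrightarrow> v \<in> solenoidal_mean_zero"
  by (simp add: H_space_iff)

lemma H_space_add: "v \<in> H_space n \<Longrightarrow> w \<in> H_space n \<Longrightarrow> v + w \<in> H_space n"
  using summable_on_norm_add_sq[of "\<lambda>k. (norm (rvec k) powr n) *\<^sub>R v k" UNIV "\<lambda>k. (norm (rvec k) powr n) *\<^sub>R w k"]
  by (simp add: H_space_iff solenoidal_add scaleR_add_right)

lemma H_space_scaleR: "v \<in> H_space n \<Longrightarrow> c *\<^sub>R v \<in> H_space n"
  using summable_on_norm_scaleR_sq[of "\<lambda>k. (norm (rvec k) powr n) *\<^sub>R v k" UNIV c]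
  by (simp add: H_space_iff solenoidal_scaleR algebra_simps)

lemma minus_eq_scaleR: "- v = (- 1) *\<^sub>R (v :: vec_field)"
  and diff_eq_add_scaleR: "v - w = v + (- 1) *\<^sub>R (w :: vec_field)"
  by (auto simp: fun_eq_iff)

lemma H_space_minus: "v \<in> H_space n \<Longrightarrow> - v \<in> H_space n"
  unfolding minus_eq_scaleR by (rule H_space_scaleR)

lemma H_space_diff: "v \<in> H_space n \<Longrightarrow> w \<in> H_space n \<Longrightarrow> v - w \<in> H_space n"
  unfolding diff_eq_add_scaleR by (intro H_space_add H_space_scaleR)

text \<open>Nonzero wave vectors have length at least 1, so a larger exponent gives a larger weight
  there; at k = 0 the coefficient vanishes.\<close>

lemma H_space_mono: "m \<le> n \<Longrightarrow> H_space n \<subseteq> H_space m"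
  and H_norm_mono: "m \<le> n \<Longrightarrow> v \<in> H_space n \<Longrightarrow> H_norm m v \<le> H_norm n v"
proof -
  assume mn: "m \<le> n"
  have le: "norm (rvec k) powr (2 * m) * (norm (v k))\<^sup>2 \<le> norm (rvec k) powr (2 * n) * (norm (v k))\<^sup>2"
    if "v \<in> solenoidal_mean_zero" for v k
  proof (cases "k = 0")
    case False
    then show ?thesis using mn norm_rvec_ge_1 by (intro mult_right_mono powr_mono) auto
  qed (simp add: solenoidal_at_0[OF that])
  show sub: "H_space n \<subseteq> H_space m"
    by (auto simp: H_space_def intro: summable_on_comparison_test le)
  assume v: "v \<in> H_space n"
  then have "v \<in> H_space m" using sub by blast
  with v show "H_norm m v \<le> H_norm n v"
    unfolding H_norm_def by (intro real_sqrt_le_mono infsum_mono le) (auto simp: H_space_def)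
qed

text \<open>An isometry of H^n into \<open>ell2\<close>. Outside \<open>H_space n\<close> the family
  need not be square summable and \<open>Ell2\<close> of it is unspecified, hence the membership
  hypotheses in the lemmas below. The weight at k = 0 is 0, which loses no information because the
  fields have mean zero.\<close>

definition sobolev_embed :: "real \<Rightarrow> vec_field \<Rightarrow> (int^3, complex^3) ell2" where
  "sobolev_embed n v = Ell2 (\<lambda>k. (norm (rvec k) powr n) *\<^sub>R v k)"

lemma ell2_coeff_sobolev_embed:
  "v \<in> H_space n \<Longrightarrow> ell2_coeff (sobolev_embed n v) = (\<lambda>k. (norm (rvec k) powr n) *\<^sub>R v k)"
  unfolding sobolev_embed_def by (rule Ell2_inverse) (simp add: H_space_iff)

lemma H_norm_eq: "v \<in> H_space n \<Longrightarrow> H_norm n v = norm (sobolev_embed n v)"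
  by (simp only: norm_ell2 ell2_coeff_sobolev_embed H_norm_def powr_norm_sq_eq)

lemma sobolev_embed_add:
  "v \<in> H_space n \<Longrightarrow> w \<in> H_space n \<Longrightarrow> sobolev_embed n (v + w) = sobolev_embed n v + sobolev_embed n w"
  by (simp add: ell2_coeff_inject[symmetric] plus_ell2.rep_eq ell2_coeff_sobolev_embed H_space_add scaleR_add_right)

lemma sobolev_embed_scaleR:
  "v \<in> H_space n \<Longrightarrow> sobolev_embed n (c *\<^sub>R v) = c *\<^sub>R sobolev_embed n v"
  by (simp add: ell2_coeff_inject[symmetric] scaleR_ell2.rep_eq ell2_coeff_sobolev_embed H_space_scaleR algebra_simps)

lemma sobolev_embed_diff:
  "v \<in> H_space n \<Longrightarrow> w \<in> H_space n \<Longrightarrow> sobolev_embed n (v - w) = sobolev_embed n v - sobolev_embed n w"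
  by (simp add: ell2_coeff_inject[symmetric] minus_ell2.rep_eq ell2_coeff_sobolev_embed H_space_diff scaleR_diff_right)

lemma sobolev_embed_eq_0_iff: "v \<in> H_space n \<Longrightarrow> sobolev_embed n v = 0 \<longleftrightarrow> v = 0"
proof -
  assume v: "v \<in> H_space n"
  have "(norm (rvec k) powr n) *\<^sub>R v k = 0 \<longleftrightarrow> v k = 0" for k
    using solenoidal_at_0[OF H_space_solenoidal[OF v]] by (cases "k = 0") auto
  then show ?thesis
    by (simp add: ell2_coeff_inject[symmetric] zero_ell2.rep_eq ell2_coeff_sobolev_embed v fun_eq_iff)
qed

lemma H_norm_minus [simp]: "H_norm n (- v) = H_norm n v"
  by (simp add: H_norm_def)

lemma H_norm_nonneg: "0 \<le> H_norm n v"
  by (simp add: H_norm_def infsum_nonneg)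

lemma H_norm_triangle:
  "v \<in> H_space n \<Longrightarrow> w \<in> H_space n \<Longrightarrow> H_norm n (v + w) \<le> H_norm n v + H_norm n w"
  by (simp add: H_norm_eq H_space_add sobolev_embed_add norm_triangle_ineq)

lemma H_norm_scaleR: "v \<in> H_space n \<Longrightarrow> H_norm n (c *\<^sub>R v) = \<bar>c\<bar> * H_norm n v"
  by (simp add: H_norm_eq H_space_scaleR sobolev_embed_scaleR)

lemma Metric_space_H: "Metric_space (H_space n) (\<lambda>v w. H_norm n (v - w))"
proof
  fix x y z
  show "0 \<le> H_norm n (x - y)" by (rule H_norm_nonneg)
  show "H_norm n (x - y) = H_norm n (y - x)"
    using H_norm_minus[of n "x - y"] by simp
  assume x: "x \<in> H_space n" and y: "y \<in> H_space n"
  show "H_norm n (x - y) = 0 \<longleftrightarrow> x = y"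
    by (simp add: x y H_norm_eq H_space_diff sobolev_embed_eq_0_iff)
  assume z: "z \<in> H_space n"
  show "H_norm n (x - z) \<le> H_norm n (x - y) + H_norm n (y - z)"
    using H_norm_triangle[OF H_space_diff[OF x y] H_space_diff[OF y z]] by simp
qed

section \<open>Convergence and derivatives in the Sobolev topologies\<close>

lemma limitin_H_topology:
  "limitin (H_topology n) f l F \<longleftrightarrow>
     l \<in> H_space n \<and> (\<forall>\<epsilon>>0. \<forall>\<^sub>F x in F. f x \<in> H_space n \<and> H_norm n (f x - l) < \<epsilon>)"
  by (simp add: H_topology_def Metric_space.limitin_metric[OF Metric_space_H])

lemma limitin_H_topology_mono:
  assumes "m \<le> n" "limitin (H_topology n) f l F"
  shows "limitin (H_topology m) f l F"
  unfolding limitin_H_topology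
proof (intro conjI allI impI)
  show "l \<in> H_space m" using assms H_space_mono by (auto simp: limitin_H_topology)
  fix \<epsilon> :: real assume "\<epsilon> > 0"
  then have ev: "\<forall>\<^sub>F x in F. f x \<in> H_space n \<and> H_norm n (f x - l) < \<epsilon>" and l: "l \<in> H_space n"
    using assms by (auto simp: limitin_H_topology)
  from ev show "\<forall>\<^sub>F x in F. f x \<in> H_space m \<and> H_norm m (f x - l) < \<epsilon>"
  proof eventually_elim
    case (elim x)
    then show ?case
      using H_norm_mono[OF assms(1) H_space_diff[of "f x" n l]] H_space_mono[OF assms(1)] l by auto
  qed
qed

lemma limitin_H_imp_tendsto:
  assumes "limitin (H_topology n) f l F"
  shows "((\<lambda>x. sobolev_embed n (f x)) \<longlongrightarrow> sobolev_embed n l) F"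
proof (rule tendstoI)
  fix e :: real assume "e > 0"
  then have "\<forall>\<^sub>F x in F. f x \<in> H_space n \<and> H_norm n (f x - l) < e" and l: "l \<in> H_space n"
    using assms by (auto simp: limitin_H_topology)
  then show "\<forall>\<^sub>F x in F. dist (sobolev_embed n (f x)) (sobolev_embed n l) < e"
    by (auto elim!: eventually_mono simp: dist_norm H_norm_eq H_space_diff simp flip: sobolev_embed_diff)
qed

lemma tendsto_imp_limitin_H:
  assumes "((\<lambda>x. sobolev_embed n (f x)) \<longlongrightarrow> sobolev_embed n l) F"
    and "\<forall>\<^sub>F x in F. f x \<in> H_space n" and "l \<in> H_space n"
  shows "limitin (H_topology n) f l F"
  unfolding limitin_H_topology
proof (intro conjI allI impI)
  fix e :: real assume "e > 0"
  from tendstoD[OF assms(1) this] assms(2)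
  show "\<forall>\<^sub>F x in F. f x \<in> H_space n \<and> H_norm n (f x - l) < e"
    by eventually_elim (simp add: dist_norm H_norm_eq H_space_diff assms flip: sobolev_embed_diff)
qed (rule assms)

text \<open>The embedding is known to be linear only on \<open>H_space n\<close>, so membership is
  required at t and at all nearby times before it can be moved through the difference
  quotient.\<close>

lemma has_derivative_in_H_imp_vector_derivative:
  assumes d: "has_derivative_in (H_topology n) u d t"
    and u: "\<forall>\<^sub>F s in at t. u s \<in> H_space n" "u t \<in> H_space n"
  shows "((\<lambda>s. sobolev_embed n (u s)) has_vector_derivative sobolev_embed n d) (at t)"
proof -
  have "((\<lambda>h. sobolev_embed n ((1 / h) *\<^sub>R (u (t + h) - u t))) \<longlongrightarrow> sobolev_embed n d) (at 0)"
    using limitin_H_imp_tendsto[OF d[unfolded has_derivative_in_def]] .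
  moreover have "\<forall>\<^sub>F h in at 0. u (t + h) \<in> H_space n"
    using u(1) by (subst (asm) at_to_0) (simp add: eventually_filtermap add.commute)
  then have "\<forall>\<^sub>F h in at 0. sobolev_embed n ((1 / h) *\<^sub>R (u (t + h) - u t)) =
      (sobolev_embed n (u (t + h)) - sobolev_embed n (u t)) /\<^sub>R h"
    by eventually_elim (simp add: sobolev_embed_scaleR sobolev_embed_diff H_space_diff u divide_inverse)
  ultimately have "((\<lambda>h. (sobolev_embed n (u (t + h)) - sobolev_embed n (u t)) /\<^sub>R h) \<longlongrightarrow> sobolev_embed n d) (at 0)"
    by (rule Lim_transform_eventually)
  from tendsto_norm_zero[OF LIM_zero[OF this]]
  have "((\<lambda>h. norm (sobolev_embed n (u (t + h)) - sobolev_embed n (u t) - h *\<^sub>R sobolev_embed n d) / norm h)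
      \<longlongrightarrow> 0) (at 0)"
  proof (rule Lim_transform_eventually)
    have "norm ((x - y) /\<^sub>R h - z) = norm (x - y - h *\<^sub>R z) / norm h"
      if "h \<noteq> 0" for x y z :: "(int^3, complex^3) ell2" and h :: real
    proof -
      have "(x - y) /\<^sub>R h - z = (x - y - h *\<^sub>R z) /\<^sub>R h"
        using that by (simp add: scaleR_diff_right)
      then show ?thesis by (simp add: divide_inverse_commute)
    qed
    then show "\<forall>\<^sub>F h in at 0. norm ((sobolev_embed n (u (t + h)) - sobolev_embed n (u t)) /\<^sub>R h - sobolev_embed n d) =
        norm (sobolev_embed n (u (t + h)) - sobolev_embed n (u t) - h *\<^sub>R sobolev_embed n d) / norm h"
      by (auto simp: eventually_at intro!: exI[of _ 1])
  qed
  then show ?thesis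
    by (simp add: has_vector_derivative_def has_derivative_at bounded_linear_scaleR_left)
qed

section \<open>Analytic vector fields\<close>

lemma summable_on_powr_one_norm:
  "0 < q \<Longrightarrow> q < 1 \<Longrightarrow> (\<lambda>k. q powr one_norm k) summable_on UNIV"
  using summable_on_lattice_exponential[of q 0] by (simp add: add_nonneg_eq_0_iff)

lemma has_sum_sum:
  fixes f :: "'j \<Rightarrow> 'i \<Rightarrow> 'a::topological_comm_monoid_add"
  assumes "\<And>j. j \<in> J \<Longrightarrow> (f j has_sum s j) A"
  shows "((\<lambda>x. \<Sum>j\<in>J. f j x) has_sum (\<Sum>j\<in>J. s j)) A"
  using assms by (induction J rule: infinite_finite_induct) (auto intro: has_sum_add)

lemma has_sum_diff:
  fixes f g :: "'i \<Rightarrow> 'a::real_normed_vector"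
  assumes "(f has_sum s) A" "(g has_sum t) A"
  shows "((\<lambda>x. f x - g x) has_sum (s - t)) A"
  using has_sum_add[OF assms(1), of "\<lambda>x. - g x" "- t"] assms(2) by (simp add: has_sum_uminus)

lemma finite_infsum_tail_le:
  fixes f :: "'i \<Rightarrow> real"
  assumes "f summable_on UNIV" "\<And>i. 0 \<le> f i" "\<epsilon> > 0"
  obtains F where "finite F" "infsum f UNIV - sum f F \<le> \<epsilon>"
  using infsum_finite_approximation[OF assms(1,3)] by (auto simp: dist_real_def)

lemma summable_on_imp_eventually_cofinite_le:
  fixes f :: "'i \<Rightarrow> real"
  assumes "f summable_on UNIV" "\<And>i. 0 \<le> f i" "\<epsilon> > 0"
  shows "\<forall>\<^sub>F i in cofinite. f i \<le> \<epsilon>"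
proof -
  obtain F where F: "finite F" "infsum f UNIV - sum f F \<le> \<epsilon>"
    using finite_infsum_tail_le[OF assms] .
  have "f i \<le> \<epsilon>" if "i \<notin> F" for i
  proof -
    have "sum f (insert i F) \<le> infsum f UNIV"
      using F assms by (intro finite_sum_le_infsum) auto
    then show ?thesis using F that by simp
  qed
  then have "{i. \<not> f i \<le> \<epsilon>} \<subseteq> F" by blast
  then show ?thesis unfolding eventually_cofinite using F finite_subset by blast
qed

text \<open>This is the root test: a lower limit strictly above \<rho> leaves room for some r beyond
  \<rho> such that the coefficients decay like r to the power -\<open>one_norm k\<close>, up to a
  constant.\<close>

lemma A_rho_iff:
  assumes \<rho>: "\<rho> > 1"
  shows "v \<in> A_rho \<rho> \<longleftrightarrow> v \<in> solenoidal_mean_zero \<and>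
     (\<exists>r>\<rho>. \<exists>C. \<forall>k. norm (v k) \<le> C * r powr (- one_norm k))"
proof (cases "v \<in> solenoidal_mean_zero")
  case True
  let ?g = "\<lambda>k. if v k = 0 then \<infinity> else ereal (norm (v k) powr (- 1 / one_norm k))"
  have "Liminf cofinite ?g > ereal \<rho> \<longleftrightarrow> (\<exists>r>\<rho>. \<exists>C. \<forall>k. norm (v k) \<le> C * r powr (- one_norm k))"
  proof
    assume "Liminf cofinite ?g > ereal \<rho>"
    then obtain r where r: "\<rho> < r" "ereal r < Liminf cofinite ?g"
      using ereal_dense2 by force
    \<comment> \<open>\<open>E\<close> consists of the finitely many exceptions to the root bound,
      together with the index 0, where \<open>one_norm\<close> vanishes and no root can be taken.
      The sum in \<open>C\<close> absorbs them, and its summand 1 serves all other indices.\<close>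
    define E where "E = insert 0 {k. \<not> ereal r < ?g k}"
    have E: "finite E"
      using less_LiminfD[OF r(2)] by (simp add: E_def eventually_cofinite)
    define C where "C = 1 + (\<Sum>k\<in>E. norm (v k) * r powr one_norm k)"
    have C: "1 \<le> C" by (simp add: C_def sum_nonneg)
    have "norm (v k) \<le> C * r powr (- one_norm k)" for k
    proof (cases "k \<in> E")
      case True
      then have "norm (v k) * r powr one_norm k \<le> C"
        using member_le_sum[of k E "\<lambda>k. norm (v k) * r powr one_norm k"] E by (simp add: C_def)
      then have "norm (v k) \<le> C / r powr one_norm k"
        by (subst pos_le_divide_eq) (use \<rho> r in auto)
      then show ?thesis by (simp add: powr_minus divide_inverse)
    next
      case False
      then have k: "k \<noteq> 0" "r < norm (v k) powr (- 1 / one_norm k) \<or> v k = 0"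
        by (auto simp: E_def split: if_splits)
      have "norm (v k) \<le> r powr (- one_norm k)"
      proof (cases "v k = 0")
        case False
        have o: "0 < one_norm k" using one_norm_ge_1[OF k(1)] by simp
        have "(norm (v k) powr (- 1 / one_norm k)) powr (- one_norm k) < r powr (- one_norm k)"
          using k False o \<rho> r by (intro powr_less_mono2_neg) auto
        then show ?thesis using o False by (simp add: powr_powr)
      qed simp
      also have "\<dots> \<le> C * r powr (- one_norm k)" using C mult_right_mono by fastforce
      finally show ?thesis .
    qed
    then show "\<exists>r>\<rho>. \<exists>C. \<forall>k. norm (v k) \<le> C * r powr (- one_norm k)" using r by blast
  next
    assume "\<exists>r>\<rho>. \<exists>C. \<forall>k. norm (v k) \<le> C * r powr (- one_norm k)"
    then obtain r C where r: "r > \<rho>" and C: "\<And>k. norm (v k) \<le> C * r powr (- one_norm k)" by blast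
    \<comment> \<open>The gap between s and r pays for the constant: (s / r) to the power
      \<open>one_norm k\<close> eventually drops below 1 / max C 1. The gap between \<rho> and s
      keeps the final inequality strict.\<close>
    obtain s where s: "\<rho> < s" "s < r" using r dense by blast
    have "0 < 1 / max C 1" by simp
    from summable_on_imp_eventually_cofinite_le[OF summable_on_powr_one_norm[of "s / r"] _ this]
    have "\<forall>\<^sub>F k in cofinite. (s / r) powr one_norm k \<le> 1 / max C 1"
      using \<rho> s by simp
    moreover have "\<forall>\<^sub>F k in cofinite. k \<noteq> (0::int^3)" by (simp add: eventually_cofinite)
    ultimately have "\<forall>\<^sub>F k in cofinite. ereal s \<le> ?g k"
    proof eventually_elim
      case (elim k)
      have o: "0 < one_norm k" using one_norm_ge_1 elim(2) by fastforce
      have "max C 1 * (s / r) powr one_norm k \<le> 1"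
        using elim(1) pos_le_divide_eq[of "max C 1" "(s / r) powr one_norm k" 1] by (simp add: mult.commute)
      then have "max C 1 * r powr (- one_norm k) \<le> s powr (- one_norm k)"
        using \<rho> s by (simp add: powr_divide powr_minus field_simps)
      moreover have "C * r powr (- one_norm k) \<le> max C 1 * r powr (- one_norm k)"
        by (intro mult_right_mono) auto
      ultimately have le: "norm (v k) \<le> s powr (- one_norm k)" using C[of k] by linarith
      have "s \<le> norm (v k) powr (- 1 / one_norm k)" if "v k \<noteq> 0"
      proof -
        have "(s powr (- one_norm k)) powr (- 1 / one_norm k) \<le> norm (v k) powr (- 1 / one_norm k)"
          using o le that by (intro powr_mono2') auto
        then show ?thesis using o \<rho> s by (simp add: powr_powr)
      qed
      then show ?case by simp
    qed
    then have "ereal s \<le> Liminf cofinite ?g" by (rule Liminf_bounded)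
    moreover have "ereal \<rho> < ereal s" using s by simp
    ultimately show "Liminf cofinite ?g > ereal \<rho>" by (rule order_less_le_trans[rotated])
  qed
  then show ?thesis using True by (simp add: A_rho_def)
qed (simp add: A_rho_def)

lemma A_space_iff:
  "v \<in> A_space \<longleftrightarrow> v \<in> solenoidal_mean_zero \<and>
     (\<exists>r>1. \<exists>C. \<forall>k. norm (v k) \<le> C * r powr (- one_norm k))" (is "_ \<longleftrightarrow> ?R")
proof
  assume "v \<in> A_space"
  then obtain \<rho> where \<rho>: "\<rho> > 1" "v \<in> A_rho \<rho>" by (auto simp: A_space_def)
  then obtain r C where "r > \<rho>" "\<forall>k. norm (v k) \<le> C * r powr (- one_norm k)" "v \<in> solenoidal_mean_zero"
    using A_rho_iff by blast
  moreover have "r > 1" using \<rho> \<open>r > \<rho>\<close> by simp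
  ultimately show ?R by blast
next
  assume ?R
  then obtain r C where r: "r > 1" "\<And>k. norm (v k) \<le> C * r powr (- one_norm k)" and v: "v \<in> solenoidal_mean_zero"
    by blast
  obtain \<rho> where \<rho>: "1 < \<rho>" "\<rho> < r" using r dense by blast
  then have "v \<in> A_rho \<rho>" using A_rho_iff[OF \<rho>(1)] v r by blast
  then show "v \<in> A_space" using \<rho> by (auto simp: A_space_def)
qed

lemma A_space_add: "v \<in> A_space \<Longrightarrow> w \<in> A_space \<Longrightarrow> v + w \<in> A_space"
proof -
  assume "v \<in> A_space" "w \<in> A_space"
  then obtain r C s D where r: "r > 1" "\<And>k. norm (v k) \<le> C * r powr (- one_norm k)"
    and s: "s > 1" "\<And>k. norm (w k) \<le> D * s powr (- one_norm k)"
    and sol: "v \<in> solenoidal_mean_zero" "w \<in> solenoidal_mean_zero"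
    unfolding A_space_iff by blast
  define t where "t = min r s"
  have t: "t > 1" "t \<le> r" "t \<le> s" using r s by (auto simp: t_def)
  have "norm ((v + w) k) \<le> (\<bar>C\<bar> + \<bar>D\<bar>) * t powr (- one_norm k)" for k
  proof -
    have "norm (v k) \<le> \<bar>C\<bar> * t powr (- one_norm k)"
      by (rule order_trans[OF r(2)]) (intro mult_mono powr_mono2', use t one_norm_nonneg in auto)
    moreover have "norm (w k) \<le> \<bar>D\<bar> * t powr (- one_norm k)"
      by (rule order_trans[OF s(2)]) (intro mult_mono powr_mono2', use t one_norm_nonneg in auto)
    ultimately show ?thesis
      using norm_triangle_ineq[of "v k" "w k"] by (simp add: distrib_right)
  qed
  then show ?thesis unfolding A_space_iff using sol t by (auto intro: solenoidal_add)
qed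

lemma A_space_scaleR: "v \<in> A_space \<Longrightarrow> c *\<^sub>R v \<in> A_space"
proof -
  assume "v \<in> A_space"
  then obtain r C where r: "r > 1" "\<And>k. norm (v k) \<le> C * r powr (- one_norm k)"
    and sol: "v \<in> solenoidal_mean_zero"
    unfolding A_space_iff by blast
  have "norm ((c *\<^sub>R v) k) \<le> (\<bar>c\<bar> * C) * r powr (- one_norm k)" for k
    using mult_left_mono[OF r(2)[of k], of "\<bar>c\<bar>"] by (simp add: mult.assoc)
  then show ?thesis unfolding A_space_iff using sol r by (auto intro: solenoidal_scaleR)
qed

lemma A_space_minus: "v \<in> A_space \<Longrightarrow> - v \<in> A_space"
  unfolding minus_eq_scaleR by (rule A_space_scaleR)

section \<open>Sup norms on polyannuli and the size of Fourier coefficients\<close>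

lemma powi_le_powr_abs:
  fixes x \<rho> :: real
  assumes "1 / \<rho> \<le> x" "x \<le> \<rho>" "\<rho> > 1"
  shows "x powi m \<le> \<rho> powr \<bar>of_int m\<bar>"
proof -
  have x: "0 < x" using assms by (smt (verit) divide_pos_pos)
  show ?thesis
  proof (cases "m \<ge> 0")
    case True
    then have "x powi m \<le> \<rho> powi m" using assms x by (intro power_int_mono) auto
    then show ?thesis using True assms by (simp add: powr_real_of_int')
  next
    case False
    have "inverse x \<le> \<rho>" using assms x by (simp add: field_simps)
    then have "inverse x powi (- m) \<le> \<rho> powi (- m)" using assms x False by (intro power_int_mono) auto
    moreover have "\<rho> powr \<bar>of_int m\<bar> = \<rho> powi (- m)"
      using False assms powr_real_of_int'[of \<rho> "- m"] by simp
    moreover have "inverse x powi (- m) = x powi m"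
      by (simp add: power_int_minus power_int_inverse)
    ultimately show ?thesis by simp
  qed
qed

lemma norm_monomial_le:
  assumes "z \<in> polyannulus \<rho>" "\<rho> > 1"
  shows "norm (\<Prod>s\<in>UNIV. z $ s powi (k $ s)) \<le> \<rho> powr one_norm k"
proof -
  have "norm (\<Prod>s\<in>UNIV. z $ s powi (k $ s)) = (\<Prod>s\<in>UNIV. norm (z $ s) powi (k $ s))"
    by (simp add: prod_norm[symmetric] norm_power_int)
  also have "\<dots> \<le> (\<Prod>s\<in>UNIV. \<rho> powr \<bar>of_int (k $ s)\<bar>)"
    using assms by (intro prod_mono conjI powi_le_powr_abs) (auto simp: polyannulus_def)
  also have "\<dots> = \<rho> powr one_norm k"
    using assms by (simp add: one_norm_def powr_sum)
  finally show ?thesis .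
qed

lemma summable_on_A_rho:
  assumes "v \<in> A_rho \<rho>" "\<rho> > 1"
  shows "(\<lambda>k. \<rho> powr one_norm k * norm (v k)) summable_on UNIV"
proof -
  obtain r C where r: "r > \<rho>" "\<And>k. norm (v k) \<le> C * r powr (- one_norm k)"
    using assms A_rho_iff by blast
  show ?thesis
  proof (rule summable_on_comparison_test)
    show "(\<lambda>k. C * (\<rho> / r) powr one_norm k) summable_on UNIV"
      using assms r by (intro summable_on_cmult_right summable_on_powr_one_norm) auto
    fix k
    have "\<rho> powr one_norm k * norm (v k) \<le> \<rho> powr one_norm k * (C * r powr (- one_norm k))"
      by (intro mult_left_mono r) auto
    also have "\<dots> = C * (\<rho> powr one_norm k / r powr one_norm k)"
      by (simp add: powr_minus divide_inverse)
    also have "\<dots> = C * (\<rho> / r) powr one_norm k"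
      using assms r by (simp add: powr_divide)
    finally show "\<rho> powr one_norm k * norm (v k) \<le> C * (\<rho> / r) powr one_norm k" .
  qed simp
qed

lemma
  assumes v: "(\<lambda>k. \<rho> powr one_norm k * norm (v k)) summable_on UNIV"
    and \<rho>: "\<rho> > 1" and z: "z \<in> polyannulus \<rho>"
  shows summable_on_monomials: "(\<lambda>k. (\<Prod>s\<in>UNIV. z $ s powi (k $ s)) *s v k) summable_on UNIV"
    and norm_infsum_monomials_le: "norm (\<Sum>\<^sub>\<infinity>k. (\<Prod>s\<in>UNIV. z $ s powi (k $ s)) *s v k)
       \<le> (\<Sum>\<^sub>\<infinity>k. \<rho> powr one_norm k * norm (v k))"
proof -
  have le: "norm ((\<Prod>s\<in>UNIV. z $ s powi (k $ s)) *s v k) \<le> \<rho> powr one_norm k * norm (v k)" for k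
    unfolding norm_vector_smult by (intro mult_right_mono norm_monomial_le z \<rho>) auto
  show s: "(\<lambda>k. (\<Prod>s\<in>UNIV. z $ s powi (k $ s)) *s v k) summable_on UNIV"
    by (rule abs_summable_summable, rule summable_on_comparison_test[OF v le]) auto
  show "norm (\<Sum>\<^sub>\<infinity>k. (\<Prod>s\<in>UNIV. z $ s powi (k $ s)) *s v k) \<le> (\<Sum>\<^sub>\<infinity>k. \<rho> powr one_norm k * norm (v k))"
    by (rule norm_infsum_le[OF has_sum_infsum[OF s] has_sum_infsum[OF v] le])
qed

text \<open>Cauchy's estimate. Averaging over \<open>N\<close>-th roots of unity isolates the coefficients whose
  index is congruent to \<open>k\<close> modulo \<open>N\<close>; all of these but \<open>k\<close> lie in the tail of the series
  when \<open>N\<close> is large.\<close>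

lemma sum_roots_of_unity:
  assumes "N > 0" "\<bar>m\<bar> < int N"
  shows "(\<Sum>i<N. cis (2 * pi * real i * of_int m / N)) = (if m = 0 then of_nat N else 0)"
proof (cases "m = 0")
  case False
  let ?q = "cis (2 * pi * of_int m / N)"
  have "?q \<noteq> 1"
  proof
    assume "?q = 1"
    then obtain n :: int where "2 * pi * of_int m / N = of_int n * (2 * pi)" by (auto simp: cis_eq_1_iff)
    then have "(of_int m :: real) = of_int (n * int N)" using assms by (simp add: field_simps)
    then have m: "m = n * int N" by linarith
    then have "int N \<le> \<bar>m\<bar>" using False mult_right_mono[of 1 "\<bar>n\<bar>" "int N"] by (auto simp: abs_mult)
    then show False using assms by simp
  qed
  moreover have "?q ^ N = 1"
    using assms by (simp add: Complex.DeMoivre)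
  ultimately have "(\<Sum>i<N. ?q ^ i) = 0" by (simp add: geometric_sum)
  then show ?thesis using False by (simp add: Complex.DeMoivre mult_ac)
qed simp

lemma A_rho_norm_coeff:
  assumes v: "v \<in> A_rho \<rho>" and \<rho>: "\<rho> > 1"
  shows "norm (v k) \<le> A_rho_norm \<rho> v * \<rho> powr (- one_norm k)"
proof -
  let ?g = "\<lambda>l. \<rho> powr one_norm l * norm (v l)"
  let ?f = "\<lambda>z. \<Sum>\<^sub>\<infinity>l. (\<Prod>s\<in>UNIV. z $ s powi (l $ s)) *s v l"
  note sv = summable_on_A_rho[OF v \<rho>]
  \<comment> \<open>In each coordinate the modulus is \<rho> or 1 / \<rho> according to the sign of
    the component of k, so that the monomial with index k attains its largest possible modulus on
    the polyannulus.\<close>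
  define y :: "complex^3" where "y = (\<chi> s. if k $ s \<ge> 0 then of_real \<rho> else of_real (1 / \<rho>))"
  have y: "y \<in> polyannulus \<rho>"
    using \<rho> less_1_mult[OF \<rho> \<rho>] by (auto simp: y_def polyannulus_def norm_divide field_simps)
  define Y where "Y = (\<lambda>l::int^3. \<Prod>s\<in>UNIV. y $ s powi (l $ s))"
  have Y_le: "norm (Y l *s v l) \<le> ?g l" for l
    unfolding Y_def norm_vector_smult by (intro mult_right_mono norm_monomial_le y \<rho>) auto
  have "norm (y $ s) = (if k $ s \<ge> 0 then \<rho> else inverse \<rho>)" for s
    using \<rho> by (simp add: y_def norm_divide inverse_eq_divide)
  then have "norm (y $ s powi (k $ s)) = \<rho> powr \<bar>of_int (k $ s)\<bar>" for s
    using \<rho> powr_real_of_int'[of \<rho> "k $ s"] powr_real_of_int'[of \<rho> "- (k $ s)"]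
    by (simp add: norm_power_int power_int_minus power_int_inverse)
  then have Yk: "norm (Y k) = \<rho> powr one_norm k"
    using \<rho> by (simp add: Y_def one_norm_def powr_sum prod_norm[symmetric])
  have bdd: "bdd_above ((\<lambda>z. norm (?f z)) ` polyannulus \<rho>)"
    by (rule bdd_aboveI2[of _ _ "\<Sum>\<^sub>\<infinity>l. ?g l"]) (rule norm_infsum_monomials_le[OF sv \<rho>])
  have "norm (Y k *s v k) \<le> A_rho_norm \<rho> v + \<epsilon>" if \<epsilon>: "\<epsilon> > 0" for \<epsilon>
  proof -
    obtain F0 where F0: "finite F0" "infsum ?g UNIV - sum ?g F0 \<le> \<epsilon>"
      using finite_infsum_tail_le[OF sv _ \<epsilon>] by auto
    define F where "F = insert k F0"
    have F: "finite F" "k \<in> F" using F0 by (auto simp: F_def)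
    have "sum ?g F0 \<le> sum ?g F" using F by (intro sum_mono2) (auto simp: F_def)
    with F0 have tail: "infsum ?g UNIV - sum ?g F \<le> \<epsilon>" by simp
    \<comment> \<open>N exceeds every coordinate difference between k and an element of F, so k is
      the only member of F that is congruent to k modulo N in all coordinates.\<close>
    define N where "N = Suc (\<Sum>l\<in>F. \<Sum>s\<in>UNIV. nat \<bar>l $ s - k $ s\<bar>)"
    have N: "N > 0" "\<bar>l $ s - k $ s\<bar> < int N" if "l \<in> F" for l s
    proof -
      have "nat \<bar>l $ s - k $ s\<bar> \<le> (\<Sum>s\<in>UNIV. nat \<bar>l $ s - k $ s\<bar>)"
        by (rule member_le_sum) auto
      also have "\<dots> \<le> (\<Sum>l\<in>F. \<Sum>s\<in>UNIV. nat \<bar>l $ s - k $ s\<bar>)"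
        by (rule member_le_sum[of l F "\<lambda>l. \<Sum>s\<in>UNIV. nat \<bar>l $ s - k $ s\<bar>"]) (use F that in auto)
      finally show "\<bar>l $ s - k $ s\<bar> < int N" unfolding N_def by arith
    qed (simp add: N_def)
    define J where "J = PiE (UNIV::3 set) (\<lambda>_. {..<N})"
    have J: "finite J" "card J = N ^ 3" by (auto simp: J_def card_PiE intro: finite_PiE)
    \<comment> \<open>\<open>Z j\<close> rotates \<open>y\<close> by N-th roots of unity and so
      stays in the polyannulus; \<open>w j\<close> is the conjugate character at k. Averaging over j
      multiplies the l-th term by the factor \<open>A l\<close> defined below, which is 1 at k, 0 on
      the rest of F, and at most 1 in modulus everywhere.\<close>
    define Z where "Z = (\<lambda>j. \<chi> s. y $ s * cis (2 * pi * real (j s) / N))"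
    define w where "w = (\<lambda>j. \<Prod>s\<in>UNIV. cis (- (2 * pi * real (j s) * of_int (k $ s) / N)))"
    have Z: "Z j \<in> polyannulus \<rho>" for j
      using y by (simp add: Z_def polyannulus_def norm_mult)
    have w: "norm (w j) = 1" for j by (simp add: w_def prod_norm[symmetric])
    define A where "A = (\<lambda>l::int^3. (\<Prod>s\<in>UNIV. (\<Sum>i<N. cis (2 * pi * real i * of_int (l $ s - k $ s) / N))) / of_nat N ^ 3)"
    have A_sum: "(\<Sum>j\<in>J. w j * (\<Prod>s\<in>UNIV. Z j $ s powi (l $ s))) = of_nat N ^ 3 * (A l * Y l)" for l
    proof -
      have "w j * (\<Prod>s\<in>UNIV. Z j $ s powi (l $ s)) =
          Y l * (\<Prod>s\<in>UNIV. cis (2 * pi * real (j s) * of_int (l $ s - k $ s) / N))" for j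
        by (simp add: w_def Z_def Y_def power_int_mult_distrib cis_power_int prod.distrib[symmetric] cis_mult mult_ac
            add_divide_distrib diff_divide_distrib right_diff_distrib)
      then have "(\<Sum>j\<in>J. w j * (\<Prod>s\<in>UNIV. Z j $ s powi (l $ s))) =
          Y l * (\<Sum>j\<in>J. \<Prod>s\<in>UNIV. cis (2 * pi * real (j s) * of_int (l $ s - k $ s) / N))"
        by (simp add: sum_distrib_left)
      also have "(\<Sum>j\<in>J. \<Prod>s\<in>UNIV. cis (2 * pi * real (j s) * of_int (l $ s - k $ s) / N)) =
          (\<Prod>s\<in>UNIV. \<Sum>i<N. cis (2 * pi * real i * of_int (l $ s - k $ s) / N))"
        unfolding J_def by (rule prod_sum_PiE[symmetric]) auto
      finally show ?thesis by (simp add: A_def N_def del: of_nat_Suc)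
    qed
    have A_F: "A l = (if l = k then 1 else 0)" if "l \<in> F" for l
    proof -
      have "A l = (\<Prod>s\<in>UNIV. if l $ s - k $ s = 0 then of_nat N else 0) / of_nat N ^ 3"
        unfolding A_def by (simp only: sum_roots_of_unity[OF N[OF that]])
      also have "\<dots> = (if l = k then 1 else 0)"
        by (auto simp: vec_eq_iff N_def simp del: of_nat_Suc)
      finally show ?thesis .
    qed
    have A_le: "norm (A l) \<le> 1" for l
    proof -
      have "norm (\<Sum>i<N. cis (2 * pi * real i * of_int (l $ s - k $ s) / N)) \<le> N" for s
        by (rule order_trans[OF norm_sum]) simp
      then have "(\<Prod>s\<in>UNIV. norm (\<Sum>i<N. cis (2 * pi * real i * of_int (l $ s - k $ s) / N))) \<le> (\<Prod>s\<in>(UNIV::3 set). real N)"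
        by (intro prod_mono) auto
      then show ?thesis
        by (simp add: A_def norm_divide norm_power prod_norm[symmetric] N_def del: of_nat_Suc)
    qed
    have sAY: "(\<lambda>l. (A l * Y l) *s v l) summable_on UNIV"
    proof (rule abs_summable_summable, rule summable_on_comparison_test[OF sv])
      fix l
      have "norm ((A l * Y l) *s v l) = norm (A l) * norm (Y l *s v l)"
        by (simp add: norm_vector_smult norm_mult)
      also have "\<dots> \<le> 1 * ?g l" by (intro mult_mono A_le Y_le) auto
      finally show "norm ((A l * Y l) *s v l) \<le> ?g l" by simp
    qed simp
    have avg: "norm (\<Sum>\<^sub>\<infinity>l. (A l * Y l) *s v l) \<le> A_rho_norm \<rho> v"
    proof -
      have bl: "bounded_linear (\<lambda>x :: complex^3. c *s x)" for c
        by (intro linear_conv_bounded_linear[THEN iffD1] linearI)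
          (simp_all add: vec_eq_iff algebra_simps)
      have "((\<lambda>l. \<Sum>j\<in>J. w j *s ((\<Prod>s\<in>UNIV. Z j $ s powi (l $ s)) *s v l)) has_sum (\<Sum>j\<in>J. w j *s ?f (Z j))) UNIV"
        using summable_on_monomials[OF sv \<rho> Z]
        by (intro has_sum_sum has_sum_bounded_linear[OF bl] has_sum_infsum)
      moreover have "(\<Sum>j\<in>J. w j *s ((\<Prod>s\<in>UNIV. Z j $ s powi (l $ s)) *s v l)) = of_nat N ^ 3 *s ((A l * Y l) *s v l)" for l
        by (simp add: vector_smult_assoc A_sum[symmetric] vec_eq_iff sum_distrib_right)
      ultimately have "((\<lambda>l. of_nat N ^ 3 *s ((A l * Y l) *s v l)) has_sum (\<Sum>j\<in>J. w j *s ?f (Z j))) UNIV"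
        by simp
      moreover have "((\<lambda>l. of_nat N ^ 3 *s ((A l * Y l) *s v l)) has_sum (of_nat N ^ 3 *s (\<Sum>\<^sub>\<infinity>l. (A l * Y l) *s v l))) UNIV"
        by (intro has_sum_bounded_linear[OF bl] has_sum_infsum sAY)
      ultimately have eq: "of_nat N ^ 3 *s (\<Sum>\<^sub>\<infinity>l. (A l * Y l) *s v l) = (\<Sum>j\<in>J. w j *s ?f (Z j))"
        by (rule has_sum_unique[rotated])
      have "real N ^ 3 * norm (\<Sum>\<^sub>\<infinity>l. (A l * Y l) *s v l) =
          norm (of_nat N ^ 3 *s (\<Sum>\<^sub>\<infinity>l. (A l * Y l) *s v l))"
        by (simp add: norm_vector_smult norm_power)
      also have "\<dots> = norm (\<Sum>j\<in>J. w j *s ?f (Z j))" by (simp only: eq)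
      also have "\<dots> \<le> (\<Sum>j\<in>J. A_rho_norm \<rho> v)"
      proof (rule order_trans[OF norm_sum], rule sum_mono)
        fix j
        show "norm (w j *s ?f (Z j)) \<le> A_rho_norm \<rho> v"
          unfolding norm_vector_smult w A_rho_norm_def mult_1 by (rule cSUP_upper[OF Z bdd])
      qed
      also have "\<dots> = real N ^ 3 * A_rho_norm \<rho> v" by (simp add: J)
      finally show ?thesis by (simp add: N_def del: of_nat_Suc)
    qed
    \<comment> \<open>On F the averaged series reproduces exactly the k-th term, and off F it is
      dominated by \<open>?g\<close>; the total error is therefore at most the tail of the
      majorant.\<close>
    let ?d = "\<lambda>l. (if l \<in> F then 0 else ?g l)"
    have d: "(?d has_sum (infsum ?g UNIV - sum ?g F)) UNIV"
    proof -
      have "((\<lambda>l. if l \<in> F then ?g l else 0) has_sum sum ?g F) UNIV"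
        by (rule has_sum_finite_neutralI[OF F(1)]) auto
      from has_sum_diff[OF has_sum_infsum[OF sv] this]
      show ?thesis by (rule has_sum_cong[THEN iffD1, rotated]) auto
    qed
    have kk: "((\<lambda>l. if l = k then Y k *s v k else 0) has_sum Y k *s v k) UNIV"
      by (rule has_sum_finite_neutralI[of "{k}"]) auto
    have "norm ((\<Sum>\<^sub>\<infinity>l. (A l * Y l) *s v l) - Y k *s v k) \<le> infsum ?g UNIV - sum ?g F"
    proof (rule norm_infsum_le[OF has_sum_diff[OF has_sum_infsum[OF sAY] kk] d])
      fix l
      have "norm ((A l * Y l) *s v l) \<le> ?g l"
        using mult_mono[OF A_le[of l] Y_le[of l]] by (simp add: norm_vector_smult norm_mult)
      then show "norm ((A l * Y l) *s v l - (if l = k then Y k *s v k else 0)) \<le> ?d l"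
        using F(2) A_F[of l] by auto
    qed
    then show ?thesis
      using avg tail norm_triangle_ineq2[of "Y k *s v k" "\<Sum>\<^sub>\<infinity>l. (A l * Y l) *s v l"]
      by (simp add: norm_minus_commute)
  qed
  then have "norm (Y k *s v k) \<le> A_rho_norm \<rho> v" by (rule field_le_epsilon)
  then have "norm (v k) * \<rho> powr one_norm k \<le> A_rho_norm \<rho> v"
    by (simp add: norm_vector_smult Yk mult.commute)
  then have "norm (v k) \<le> A_rho_norm \<rho> v / \<rho> powr one_norm k"
    by (subst pos_le_divide_eq) (use \<rho> in auto)
  then show ?thesis by (simp add: powr_minus divide_inverse)
qed

section \<open>Zero neighbourhoods and convergence in the inductive limit topology\<close>

lemma A_spaceI:
  "v \<in> solenoidal_mean_zero \<Longrightarrow> r > 1 \<Longrightarrow> (\<And>k. norm (v k) \<le> C * r powr (- one_norm k)) \<Longrightarrow> v \<in> A_space"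
  unfolding A_space_iff by blast

text \<open>In one direction, Cauchy's estimate bounds the coefficients by the norm with the same
  radius. In the other, coefficients decaying at rate \<rho> are summed against powers of a smaller
  r; since the radius ranges over all numbers above 1, this loss is harmless.\<close>

lemma A_zero_nhds_iff:
  "U \<in> A_zero_nhds \<longleftrightarrow> U \<subseteq> A_space \<and> convex U \<and> (\<forall>v\<in>U. - v \<in> U) \<and>
     (\<forall>\<rho>>1. \<exists>\<delta>>0. \<forall>v\<in>solenoidal_mean_zero.
        (\<forall>k. norm (v k) \<le> \<delta> * \<rho> powr (- one_norm k)) \<longrightarrow> v \<in> U)"
proof -
  have "(\<forall>\<rho>>1. \<exists>\<delta>>0. {v \<in> A_rho \<rho>. A_rho_norm \<rho> v < \<delta>} \<subseteq> U) \<longleftrightarrow>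
    (\<forall>\<rho>>1. \<exists>\<delta>>0. \<forall>v\<in>solenoidal_mean_zero.
        (\<forall>k. norm (v k) \<le> \<delta> * \<rho> powr (- one_norm k)) \<longrightarrow> v \<in> U)" (is "?L \<longleftrightarrow> ?R")
  proof
    assume L: ?L
    show ?R
    proof (intro allI impI)
      fix \<rho> :: real assume "\<rho> > 1"
      then obtain r where r: "1 < r" "r < \<rho>" using dense by blast
      then obtain d where d: "d > 0" "{v \<in> A_rho r. A_rho_norm r v < d} \<subseteq> U" using L by blast
      \<comment> \<open>\<open>K\<close> is the factor lost in summing the geometric majorant.
        Dividing by K + 1 keeps the denominator positive and makes the resulting bound strictly
        smaller than d.\<close>
      define K where "K = (\<Sum>\<^sub>\<infinity>k. (r / \<rho>) powr one_norm k)"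
      have sK: "(\<lambda>k. (r / \<rho>) powr one_norm k) summable_on UNIV"
        using r by (intro summable_on_powr_one_norm) auto
      have K: "0 \<le> K" unfolding K_def by (intro infsum_nonneg) simp
      have "v \<in> U" if v: "v \<in> solenoidal_mean_zero"
        "\<And>k. norm (v k) \<le> d / (K + 1) * \<rho> powr (- one_norm k)" for v
      proof -
        have A: "v \<in> A_rho r" using A_rho_iff[OF r(1)] v r by blast
        have le: "r powr one_norm k * norm (v k) \<le> d / (K + 1) * (r / \<rho>) powr one_norm k" for k
        proof -
          have "r powr one_norm k * norm (v k) \<le> r powr one_norm k * (d / (K + 1) * \<rho> powr (- one_norm k))"
            by (intro mult_left_mono v) simp
          also have "\<dots> = d / (K + 1) * (r powr one_norm k / \<rho> powr one_norm k)"
            by (simp add: powr_minus divide_inverse)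
          also have "\<dots> = d / (K + 1) * (r / \<rho>) powr one_norm k" using r by (simp add: powr_divide)
          finally show ?thesis .
        qed
        note s = summable_on_A_rho[OF A r(1)]
        \<comment> \<open>A bound for the supremum requires a nonempty index set; this point
          provides an element.\<close>
        have "(\<chi> s. 1) \<in> polyannulus r" using r by (simp add: polyannulus_def)
        then have "A_rho_norm r v \<le> (\<Sum>\<^sub>\<infinity>k. r powr one_norm k * norm (v k))"
          unfolding A_rho_norm_def
          by (intro cSUP_least norm_infsum_monomials_le[OF s r(1)]) auto
        also have "\<dots> \<le> (\<Sum>\<^sub>\<infinity>k. d / (K + 1) * (r / \<rho>) powr one_norm k)"
          by (intro infsum_mono s summable_on_cmult_right sK le)
        also have "\<dots> = d / (K + 1) * K" unfolding K_def by (rule infsum_cmult_right) (rule sK)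
        also have "\<dots> < d" using d K by (simp add: field_simps)
        finally show ?thesis using A d by blast
      qed
      moreover have "d / (K + 1) > 0" using d K by simp
      ultimately show "\<exists>\<delta>>0. \<forall>v\<in>solenoidal_mean_zero. (\<forall>k. norm (v k) \<le> \<delta> * \<rho> powr (- one_norm k)) \<longrightarrow> v \<in> U"
        by blast
    qed
  next
    assume R: ?R
    show ?L
    proof (intro allI impI)
      fix \<rho> :: real assume \<rho>: "\<rho> > 1"
      then obtain \<delta> where \<delta>: "\<delta> > 0"
        "\<forall>v\<in>solenoidal_mean_zero. (\<forall>k. norm (v k) \<le> \<delta> * \<rho> powr (- one_norm k)) \<longrightarrow> v \<in> U"
        using R by blast
      have "v \<in> U" if v: "v \<in> A_rho \<rho>" "A_rho_norm \<rho> v < \<delta>" for v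
      proof (rule \<delta>(2)[rule_format])
        show "v \<in> solenoidal_mean_zero" using v by (simp add: A_rho_def)
        have "A_rho_norm \<rho> v * \<rho> powr (- one_norm k) \<le> \<delta> * \<rho> powr (- one_norm k)" for k
          using v by (intro mult_right_mono) auto
        then show "norm (v k) \<le> \<delta> * \<rho> powr (- one_norm k)" for k
          using A_rho_norm_coeff[OF v(1) \<rho>] order_trans by blast
      qed
      then show "\<exists>\<delta>>0. {v \<in> A_rho \<rho>. A_rho_norm \<rho> v < \<delta>} \<subseteq> U" using \<delta>(1) by (intro exI[of _ \<delta>]) auto
    qed
  qed
  then show ?thesis unfolding A_zero_nhds_def by blast
qed

lemma A_zero_nhdsD:
  assumes "U \<in> A_zero_nhds" "\<rho> > 1"
  obtains \<delta> where "\<delta> > 0"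
    "\<And>v. v \<in> solenoidal_mean_zero \<Longrightarrow> (\<And>k. norm (v k) \<le> \<delta> * \<rho> powr (- one_norm k)) \<Longrightarrow> v \<in> U"
proof -
  obtain \<delta> where \<delta>: "\<delta> > 0"
    "\<forall>v\<in>solenoidal_mean_zero. (\<forall>k. norm (v k) \<le> \<delta> * \<rho> powr (- one_norm k)) \<longrightarrow> v \<in> U"
    using assms unfolding A_zero_nhds_iff by blast
  show thesis by (rule that[of \<delta>]) (use \<delta> in auto)
qed

lemma zero_solenoidal: "0 \<in> solenoidal_mean_zero"
proof -
  have "(0 :: vec_field) \<in> distributions"
    unfolding distributions_def by (auto intro!: exI[of _ 0])
  then show ?thesis by (simp add: solenoidal_mean_zero_def)
qed

lemma zero_in_A_zero_nhds: "U \<in> A_zero_nhds \<Longrightarrow> 0 \<in> U"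
  by (rule A_zero_nhdsD[of U 2]) (auto simp: zero_solenoidal)

text \<open>Continuity at zero for linear maps that preserve exponential decay at every rate up to
  one common factor K. It is applied to multiplication by 2 and to the symmetry action.\<close>

lemma A_zero_nhds_vimage:
  assumes U: "U \<in> A_zero_nhds"
    and lin: "\<And>v w. f (v + w) = f v + f w" "\<And>c v. f (c *\<^sub>R v) = c *\<^sub>R f v"
    and sol: "\<And>v. v \<in> solenoidal_mean_zero \<Longrightarrow> f v \<in> solenoidal_mean_zero"
    and K: "K > 0" "\<And>v M r. (\<And>k. norm (v k) \<le> M * r powr (- one_norm k)) \<Longrightarrow>
       (\<And>k. norm (f v k) \<le> K * M * r powr (- one_norm k))"
  shows "{v \<in> A_space. f v \<in> U} \<in> A_zero_nhds"
  unfolding A_zero_nhds_iff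
proof (intro conjI allI impI ballI)
  have cU: "convex U" using U by (simp add: A_zero_nhds_iff)
  show "convex {v \<in> A_space. f v \<in> U}"
  proof (rule convexI)
    fix x y and a b :: real assume "x \<in> {v \<in> A_space. f v \<in> U}" "y \<in> {v \<in> A_space. f v \<in> U}" "0 \<le> a" "0 \<le> b" "a + b = 1"
    then show "a *\<^sub>R x + b *\<^sub>R y \<in> {v \<in> A_space. f v \<in> U}"
      using convexD[OF cU] by (auto simp: lin intro: A_space_add A_space_scaleR)
  qed
  fix v assume "v \<in> {v \<in> A_space. f v \<in> U}"
  moreover have "f (- v) = - f v" using lin(2)[of "- 1" v] by (simp add: minus_eq_scaleR[symmetric])
  ultimately show "- v \<in> {v \<in> A_space. f v \<in> U}"
    using U by (auto simp: A_zero_nhds_iff intro: A_space_minus)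
next
  fix \<rho> :: real assume \<rho>: "\<rho> > 1"
  obtain d where d: "d > 0"
    "\<And>v. v \<in> solenoidal_mean_zero \<Longrightarrow> (\<And>k. norm (v k) \<le> d * \<rho> powr (- one_norm k)) \<Longrightarrow> v \<in> U"
    using A_zero_nhdsD[OF U \<rho>] by blast
  have "v \<in> {v \<in> A_space. f v \<in> U}" if v: "v \<in> solenoidal_mean_zero"
    "\<And>k. norm (v k) \<le> d / K * \<rho> powr (- one_norm k)" for v
  proof -
    have "v \<in> A_space" unfolding A_space_iff using v \<rho> by blast
    moreover have "f v \<in> U" using d(2)[OF sol[OF v(1)]] K(2)[OF v(2)] K(1) by simp
    ultimately show ?thesis by simp
  qed
  then show "\<exists>\<delta>>0. \<forall>v\<in>solenoidal_mean_zero. (\<forall>k. norm (v k) \<le> \<delta> * \<rho> powr (- one_norm k)) \<longrightarrow>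
      v \<in> {v \<in> A_space. f v \<in> U}"
    using d(1) K(1) by (intro exI[of _ "d / K"]) auto
qed auto

lemma A_space_A_zero_nhds: "A_space \<in> A_zero_nhds"
  unfolding A_zero_nhds_iff
proof (intro conjI allI impI)
  show "convex A_space" by (auto simp: convex_def intro: A_space_add A_space_scaleR)
  fix \<rho> :: real assume "\<rho> > 1"
  then show "\<exists>\<delta>>0. \<forall>v\<in>solenoidal_mean_zero. (\<forall>k. norm (v k) \<le> \<delta> * \<rho> powr (- one_norm k)) \<longrightarrow> v \<in> A_space"
    using A_spaceI[of _ \<rho> 1] by (intro exI[of _ 1]) auto
qed (auto intro: A_space_minus)

lemma topspace_A_topology: "topspace A_topology = A_space"
proof -
  have "A_open A_space"
    unfolding A_open_def using A_space_A_zero_nhds A_space_add by blast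
  then show ?thesis
    unfolding topspace_def openin_A_topology by (auto simp: A_open_def)
qed

text \<open>A translate l + U of a zero neighbourhood need not be open, so the forward direction
  inserts an open set between l and l + U. Its openness is where the convexity of zero
  neighbourhoods enters.\<close>

lemma limitin_A_topology:
  "limitin A_topology f l F \<longleftrightarrow> l \<in> A_space \<and> (\<forall>U\<in>A_zero_nhds. \<forall>\<^sub>F x in F. f x - l \<in> U)"
proof
  assume L: "limitin A_topology f l F"
  then have l: "l \<in> A_space" by (simp add: limitin_def topspace_A_topology)
  have "\<forall>\<^sub>F x in F. f x - l \<in> U" if U: "U \<in> A_zero_nhds" for U
  proof -
    \<comment> \<open>The interior of l + U: the points around which a full translated zero
      neighbourhood still lies in l + U.\<close>
    define W where "W = {x \<in> A_space. \<exists>V\<in>A_zero_nhds. \<forall>y\<in>V. x + y - l \<in> U}"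
    have "A_open W" unfolding A_open_def
    proof (intro conjI ballI)
      fix x assume "x \<in> W"
      then obtain V where x: "x \<in> A_space" and V: "V \<in> A_zero_nhds" "\<And>y. y \<in> V \<Longrightarrow> x + y - l \<in> U"
        by (auto simp: W_def)
      \<comment> \<open>Half of V: for y and y' in \<open>V2\<close>, the sum y + y' is the midpoint
        of 2 y and 2 y', hence belongs to the convex set V.\<close>
      define V2 where "V2 = {v \<in> A_space. 2 *\<^sub>R v \<in> V}"
      have V2: "V2 \<in> A_zero_nhds"
        unfolding V2_def
        by (rule A_zero_nhds_vimage[OF V(1), where K = 2]) (auto simp: scaleR_add_right intro: solenoidal_scaleR)
      have "x + y \<in> W" if y: "y \<in> V2" for y
      proof -
        have "x + y + y' - l \<in> U" if y': "y' \<in> V2" for y'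
        proof -
          have "(1/2) *\<^sub>R (2 *\<^sub>R y) + (1/2) *\<^sub>R (2 *\<^sub>R y') \<in> V"
            using y y' V(1) by (intro convexD) (auto simp: V2_def A_zero_nhds_iff)
          then show ?thesis using V(2)[of "y + y'"] by (simp add: add.assoc)
        qed
        moreover have "x + y \<in> A_space" using x y by (auto simp: V2_def intro: A_space_add)
        ultimately show ?thesis unfolding W_def using V2 by blast
      qed
      then show "\<exists>U\<in>A_zero_nhds. \<forall>y\<in>U. x + y \<in> W" using V2 by blast
    qed (auto simp: W_def)
    moreover have "l \<in> W" unfolding W_def using l U by auto
    ultimately have "\<forall>\<^sub>F x in F. x \<in> f -` W" using L by (simp add: limitin_def openin_A_topology)
    then show ?thesis
    proof (rule eventually_mono)
      fix x assume "x \<in> f -` W"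
      then obtain V where "V \<in> A_zero_nhds" "\<And>y. y \<in> V \<Longrightarrow> f x + y - l \<in> U" by (auto simp: W_def)
      then show "f x - l \<in> U" using zero_in_A_zero_nhds[of V] by force
    qed
  qed
  with l show "l \<in> A_space \<and> (\<forall>U\<in>A_zero_nhds. \<forall>\<^sub>F x in F. f x - l \<in> U)" by blast
next
  assume R: "l \<in> A_space \<and> (\<forall>U\<in>A_zero_nhds. \<forall>\<^sub>F x in F. f x - l \<in> U)"
  show "limitin A_topology f l F"
    unfolding limitin_def topspace_A_topology openin_A_topology
  proof (intro conjI allI impI)
    fix W assume "A_open W \<and> l \<in> W"
    then obtain U where "U \<in> A_zero_nhds" and U: "\<And>x. x \<in> U \<Longrightarrow> l + x \<in> W"
      by (auto simp: A_open_def)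
    then have "\<forall>\<^sub>F x in F. f x - l \<in> U" using R by blast
    then show "\<forall>\<^sub>F x in F. f x \<in> W"
      by (rule eventually_mono) (use U in force)
  qed (use R in blast)
qed

section \<open>Comparison of the analytic topology with the Sobolev topologies\<close>

text \<open>Squaring the decay gives the factor (1 / r^2) to the power \<open>one_norm k\<close>,
  which is summable against every power of 1 + |k|. The norm bound is linear in |M| with a factor
  depending on m and r only; this makes the trace of each H^m ball on \<open>A_space\<close> a zero
  neighbourhood.\<close>

lemma
  assumes v: "v \<in> solenoidal_mean_zero" "\<And>k. norm (v k) \<le> M * r powr (- one_norm k)"
    and r: "r > 1" and m: "0 \<le> m"
  shows decay_imp_H_space: "v \<in> H_space m"
    and H_norm_le_decay:
      "H_norm m v \<le> \<bar>M\<bar> * sqrt (\<Sum>\<^sub>\<infinity>k. (1 + norm (rvec k)) powr (2 * m) * (1 / r\<^sup>2) powr one_norm k)"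
proof -
  let ?h = "\<lambda>k. (1 + norm (rvec k)) powr (2 * m) * (1 / r\<^sup>2) powr one_norm k"
  have h: "?h summable_on UNIV"
    using r by (intro summable_on_lattice_exponential) (auto simp: power2_eq_square less_1_mult)
  have le: "norm (rvec k) powr (2 * m) * (norm (v k))\<^sup>2 \<le> M\<^sup>2 * ?h k" for k
  proof -
    have "(norm (v k))\<^sup>2 \<le> (M * r powr (- one_norm k))\<^sup>2"
      using v(2) by (intro power_mono) auto
    also have "\<dots> = M\<^sup>2 * (1 / r\<^sup>2) powr one_norm k"
    proof -
      have "(r powr (- one_norm k))\<^sup>2 = (1 / r powr one_norm k) * (1 / r powr one_norm k)"
        by (simp only: powr_minus_divide power2_eq_square)
      also have "\<dots> = (1 / r\<^sup>2) powr one_norm k"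
        using r by (simp add: powr_divide powr_mult power2_eq_square)
      finally show ?thesis by (simp add: power_mult_distrib)
    qed
    finally have "(norm (v k))\<^sup>2 \<le> M\<^sup>2 * (1 / r\<^sup>2) powr one_norm k" .
    moreover have "norm (rvec k) powr (2 * m) \<le> (1 + norm (rvec k)) powr (2 * m)"
      using m by (intro powr_mono2) auto
    ultimately have "norm (rvec k) powr (2 * m) * (norm (v k))\<^sup>2 \<le>
        (1 + norm (rvec k)) powr (2 * m) * (M\<^sup>2 * (1 / r\<^sup>2) powr one_norm k)"
      by (intro mult_mono) auto
    then show ?thesis by (simp add: mult_ac)
  qed
  have s: "(\<lambda>k. norm (rvec k) powr (2 * m) * (norm (v k))\<^sup>2) summable_on UNIV"
    by (rule summable_on_comparison_test[OF summable_on_cmult_right[OF h] le]) simp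
  then show "v \<in> H_space m" by (simp add: H_space_def v)
  have "H_norm m v \<le> sqrt (\<Sum>\<^sub>\<infinity>k. M\<^sup>2 * ?h k)"
    unfolding H_norm_def by (intro real_sqrt_le_mono infsum_mono s summable_on_cmult_right h le)
  also have "\<dots> = \<bar>M\<bar> * sqrt (\<Sum>\<^sub>\<infinity>k. ?h k)"
    by (simp only: infsum_cmult_right[OF h] real_sqrt_mult real_sqrt_abs)
  finally show "H_norm m v \<le> \<bar>M\<bar> * sqrt (\<Sum>\<^sub>\<infinity>k. ?h k)" .
qed

lemma A_space_subset_H_space: "0 \<le> m \<Longrightarrow> A_space \<subseteq> H_space m"
proof
  fix v assume m: "0 \<le> m" and "v \<in> A_space"
  then obtain r C where "v \<in> solenoidal_mean_zero" "r > 1" "\<And>k. norm (v k) \<le> C * r powr (- one_norm k)"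
    unfolding A_space_iff by blast
  then show "v \<in> H_space m" using m by (intro decay_imp_H_space)
qed

lemma H_ball_A_zero_nhds:
  assumes m: "0 \<le> m" and \<epsilon>: "\<epsilon> > 0"
  shows "{v \<in> A_space. H_norm m v < \<epsilon>} \<in> A_zero_nhds"
  unfolding A_zero_nhds_iff
proof (intro conjI allI impI ballI)
  note sub = A_space_subset_H_space[OF m, THEN subsetD]
  show "convex {v \<in> A_space. H_norm m v < \<epsilon>}"
  proof (rule convexI)
    fix x y and a b :: real
    assume xy: "x \<in> {v \<in> A_space. H_norm m v < \<epsilon>}" "y \<in> {v \<in> A_space. H_norm m v < \<epsilon>}"
      and ab: "0 \<le> a" "0 \<le> b" "a + b = 1"
    have "H_norm m (a *\<^sub>R x + b *\<^sub>R y) \<le> a * H_norm m x + b * H_norm m y"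
      using H_norm_triangle[of "a *\<^sub>R x" m "b *\<^sub>R y"] xy ab
      by (simp add: H_norm_scaleR H_space_scaleR sub)
    also have "\<dots> < \<epsilon>"
      using xy ab by (intro convex_bound_lt) auto
    finally show "a *\<^sub>R x + b *\<^sub>R y \<in> {v \<in> A_space. H_norm m v < \<epsilon>}"
      using xy by (auto intro: A_space_add A_space_scaleR)
  qed
next
  fix \<rho> :: real assume \<rho>: "\<rho> > 1"
  define K where "K = sqrt (\<Sum>\<^sub>\<infinity>k. (1 + norm (rvec k)) powr (2 * m) * (1 / \<rho>\<^sup>2) powr one_norm k)"
  have K: "0 \<le> K" by (simp add: K_def infsum_nonneg)
  have "v \<in> {v \<in> A_space. H_norm m v < \<epsilon>}" if v: "v \<in> solenoidal_mean_zero"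
    "\<And>k. norm (v k) \<le> \<epsilon> / (K + 1) * \<rho> powr (- one_norm k)" for v
  proof -
    have "H_norm m v \<le> \<epsilon> / (K + 1) * K"
      using H_norm_le_decay[OF v \<rho> m] K \<epsilon> by (simp add: K_def)
    also have "\<dots> < \<epsilon>" using K \<epsilon> by (simp add: field_simps)
    finally show ?thesis using A_spaceI[OF v(1) \<rho> v(2)] by simp
  qed
  then show "\<exists>\<delta>>0. \<forall>v\<in>solenoidal_mean_zero. (\<forall>k. norm (v k) \<le> \<delta> * \<rho> powr (- one_norm k)) \<longrightarrow>
      v \<in> {v \<in> A_space. H_norm m v < \<epsilon>}"
    using K \<epsilon> by (intro exI[of _ "\<epsilon> / (K + 1)"]) auto
qed (auto intro: A_space_minus)

lemma limitin_A_imp_limitin_H: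
  assumes m: "0 \<le> m" and L: "limitin A_topology f l F"
  shows "limitin (H_topology m) f l F"
  unfolding limitin_H_topology
proof (intro conjI allI impI)
  have l: "l \<in> A_space" using L by (simp add: limitin_A_topology)
  then show lH: "l \<in> H_space m" using A_space_subset_H_space[OF m] by blast
  fix \<epsilon> :: real assume "\<epsilon> > 0"
  then have "\<forall>\<^sub>F x in F. f x - l \<in> {v \<in> A_space. H_norm m v < \<epsilon>}"
    using L H_ball_A_zero_nhds[OF m] unfolding limitin_A_topology by blast
  then show "\<forall>\<^sub>F x in F. f x \<in> H_space m \<and> H_norm m (f x - l) < \<epsilon>"
  proof (rule eventually_mono)
    fix x assume x: "f x - l \<in> {v \<in> A_space. H_norm m v < \<epsilon>}"
    then have "(f x - l) + l \<in> H_space m"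
      using lH A_space_subset_H_space[OF m] by (intro H_space_add) auto
    then show "f x \<in> H_space m \<and> H_norm m (f x - l) < \<epsilon>" using x by simp
  qed
qed

section \<open>The symmetry action\<close>

lemma matrix_vector_mult_minus_right: "(A :: 'a::ring_1^'n^'m) *v (- x) = - (A *v x)"
  by (simp add: matrix_vector_mult_def vec_eq_iff sum_negf)

lemma scaleR_eq_vector_smult: "c *\<^sub>R (w :: complex^'n) = of_real c *s w"
  by (simp add: vec_eq_iff scaleR_conv_of_real[where 'a = complex])

lemma O_h_transpose: "S \<in> O_h \<Longrightarrow> transpose S \<in> O_h"
  by (simp add: O_h_def orthogonal_matrix_def)

lemma O_h_cancel [simp]:
  assumes "S \<in> O_h"
  shows "S *v (transpose S *v k) = k" "transpose S *v (S *v k) = k"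
  using assms by (simp_all add: O_h_def orthogonal_matrix_def matrix_vector_mul_assoc
      del: transpose_matrix_vector)

lemma orthogonal_rmat: "S \<in> O_h \<Longrightarrow> orthogonal_matrix (rmat S)"
proof -
  assume "S \<in> O_h"
  then have "(transpose S ** S) $ i $ j = mat 1 $ i $ j" for i j
    by (simp add: O_h_def orthogonal_matrix_def)
  then have "(of_int ((transpose S ** S) $ i $ j) :: real) = of_int (mat 1 $ i $ j)" for i j
    by (simp only:)
  then show ?thesis
    by (simp add: orthogonal_matrix vec_eq_iff matrix_matrix_mult_def transpose_def rmat_def mat_def if_distrib cong: if_cong)
qed

lemma norm_rvec_O_h: "S \<in> O_h \<Longrightarrow> norm (rvec (S *v k)) = norm (rvec k)"
  unfolding rmat_mult_rvec[symmetric]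
  using orthogonal_rmat orthogonal_transformation_matrix[of "(*v) (rmat S)"] orthogonal_transformation_norm
  by (auto simp: matrix_vector_mul_linear)

lemma int_abs_le_square: "\<bar>x\<bar> \<le> x * x" for x :: int
  using mult_left_mono[of 1 "\<bar>x\<bar>" "\<bar>x\<bar>"] by (cases "x = 0") auto

text \<open>The columns of an integral orthogonal matrix have unit Euclidean norm, hence at most unit \<open>\<ell>\<^sup>1\<close> norm.\<close>

lemma one_norm_O_h_le:
  assumes S: "S \<in> O_h"
  shows "one_norm (S *v k) \<le> one_norm k"
proof -
  have col: "(\<Sum>i\<in>UNIV. \<bar>S $ i $ j\<bar>) \<le> 1" for j
  proof -
    have "(\<Sum>i\<in>UNIV. \<bar>S $ i $ j\<bar>) \<le> (\<Sum>i\<in>UNIV. S $ i $ j * S $ i $ j)"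
      by (intro sum_mono int_abs_le_square)
    also have "\<dots> = (transpose S ** S) $ j $ j" by (simp add: matrix_matrix_mult_def transpose_def)
    also have "\<dots> = 1" using S by (simp add: O_h_def orthogonal_matrix_def mat_def)
    finally show ?thesis .
  qed
  have "(\<Sum>i\<in>UNIV. \<bar>(S *v k) $ i\<bar>) \<le> (\<Sum>i\<in>UNIV. \<Sum>j\<in>UNIV. \<bar>S $ i $ j\<bar> * \<bar>k $ j\<bar>)"
    unfolding matrix_vector_mult_def by (intro sum_mono) (simp, rule order_trans[OF sum_abs], simp add: abs_mult)
  also have "\<dots> = (\<Sum>j\<in>UNIV. (\<Sum>i\<in>UNIV. \<bar>S $ i $ j\<bar>) * \<bar>k $ j\<bar>)"
    by (subst sum.swap) (simp add: sum_distrib_right)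
  also have "\<dots> \<le> (\<Sum>j\<in>UNIV. 1 * \<bar>k $ j\<bar>)" by (intro sum_mono mult_right_mono col) auto
  finally have "(\<Sum>i\<in>UNIV. \<bar>(S *v k) $ i\<bar>) \<le> (\<Sum>j\<in>UNIV. \<bar>k $ j\<bar>)" by simp
  moreover have "one_norm l = of_int (\<Sum>i\<in>UNIV. \<bar>l $ i\<bar>)" for l by (simp add: one_norm_def)
  ultimately show ?thesis by (simp only: of_int_le_iff)
qed

lemma one_norm_O_h: "S \<in> O_h \<Longrightarrow> one_norm (S *v k) = one_norm k"
  using one_norm_O_h_le[of S k] one_norm_O_h_le[of "transpose S" "S *v k"]
  by (simp add: O_h_transpose del: transpose_matrix_vector)

lemma orthogonal_cmat: "S \<in> O_h \<Longrightarrow> transpose (cmat S) ** cmat S = mat 1"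
proof -
  assume "S \<in> O_h"
  then have "(transpose S ** S) $ i $ j = mat 1 $ i $ j" for i j
    by (simp add: O_h_def orthogonal_matrix_def)
  then have "(of_int ((transpose S ** S) $ i $ j) :: complex) = of_int (mat 1 $ i $ j)" for i j
    by (simp only:)
  then show ?thesis
    by (simp add: vec_eq_iff matrix_matrix_mult_def transpose_def cmat_def mat_def if_distrib cong: if_cong)
qed

lemma transpose_cmat: "transpose (cmat S) = cmat (transpose S)"
  by (simp add: cmat_def transpose_def vec_eq_iff)

lemma cmat_cvec: "cmat S *v cvec k = cvec (S *v k)"
  by (simp add: cmat_def cvec_def vec_eq_iff matrix_vector_mult_def)

lemma cmat_cancel [simp]:
  assumes "S \<in> O_h"
  shows "cmat S *v (cmat (transpose S) *v k) = k" "cmat (transpose S) *v (cmat S *v k) = k"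
  using orthogonal_cmat[OF assms] orthogonal_cmat[OF O_h_transpose[OF assms]]
  by (simp_all add: transpose_cmat matrix_vector_mul_assoc)

lemma cdot_mult_right: "cdot a (A *v b) = cdot (transpose A *v a) b"
  by (simp add: cdot_def matrix_vector_mult_def transpose_def sum_3 algebra_simps del: transpose_matrix_vector)

lemma cdot_cmat: "S \<in> O_h \<Longrightarrow> cdot (cmat S *v a) (cmat S *v b) = cdot a b"
  by (simp add: cdot_mult_right transpose_cmat del: transpose_matrix_vector)

lemma norm_sq_cdot: "of_real ((norm (w :: complex^3))\<^sup>2) = cdot (\<chi> s. cnj (w $ s)) w"
  by (simp add: cdot_def norm_vec_def L2_set_def sum_nonneg complex_norm_square mult.commute del: of_real_power)

text \<open>The entries of S are real, so conjugation commutes with \<open>cmat S\<close>; the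
  Hermitian norm thus reduces to the bilinear product preserved by \<open>cdot_cmat\<close>.\<close>

lemma norm_cmat: "S \<in> O_h \<Longrightarrow> norm (cmat S *v w) = norm w"
proof -
  assume S: "S \<in> O_h"
  have "(\<chi> s. cnj ((cmat S *v w) $ s)) = cmat S *v (\<chi> s. cnj (w $ s))"
    by (simp add: vec_eq_iff matrix_vector_mult_def cmat_def)
  then have "complex_of_real ((norm (cmat S *v w))\<^sup>2) = of_real ((norm w)\<^sup>2)"
    unfolding norm_sq_cdot by (simp add: cdot_cmat S)
  then show ?thesis by (simp only: of_real_eq_iff) simp
qed

lemma E_star_apply: "E_star (S, a) v k = expi (- k) a *s (cmat S *v v (transpose S *v k))"
  by (simp add: E_star_def)

lemma norm_E_star: "S \<in> O_h \<Longrightarrow> norm (E_star (S, a) v k) = norm (v (transpose S *v k))"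
  by (simp add: E_star_apply norm_vector_smult norm_expi norm_cmat)

lemma expi_0 [simp]: "expi 0 a = 1"
  by transfer simp

lemma expi_add_index: "expi (k + l) a = expi k a * expi l a"
  by transfer (simp add: inner_add_left cis_mult)

lemma expi_uminus: "expi (- k) a = cnj (expi k a)"
  by transfer (simp add: cis_cnj)

lemma E_star_add: "E_star g (v + w) = E_star g v + E_star g w"
  by (cases g) (simp add: fun_eq_iff E_star_apply matrix_vector_right_distrib vector_add_ldistrib)

lemma E_star_scaleR: "E_star g (c *\<^sub>R v) = c *\<^sub>R E_star g v"
  by (cases g) (simp add: fun_eq_iff E_star_apply scaleR_eq_vector_smult vector_scalar_commute vector_smult_assoc mult_ac
      del: transpose_matrix_vector)

lemma E_star_diff: "E_star g (v - w) = E_star g v - E_star g w"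
  unfolding diff_eq_add_scaleR by (simp only: E_star_add E_star_scaleR)

text \<open>The acting element on the left is the inverse of (S, a) in the semidirect product. It
  carries extensions of a transformed solution back to extensions of the original one.\<close>

lemma E_star_inverse:
  assumes S: "S \<in> O_h"
  shows "E_star (transpose S, - torus_act (transpose S) a) (E_star (S, a) v) = v"
proof -
  have e: "expi k (- torus_act (transpose S) a) = expi (- (S *v k)) a" for k
    by (simp only: expi_minus expi_torus_act transpose_transpose matrix_vector_mult_minus_right)
  have c: "expi k a * expi (- k) a = 1" "expi (- k) a * expi k a = 1" for k
    using expi_add_index[of k "- k" a] expi_add_index[of "- k" k a] by auto
  show "E_star (transpose S, - torus_act (transpose S) a) (E_star (S, a) v) = v"
    by (rule ext) (simp add: E_star_apply S e matrix_vector_mult_minus_right vector_scalar_commute vector_smult_assoc c del: transpose_matrix_vector)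
qed

lemma E_star_solenoidal:
  assumes S: "S \<in> O_h" and v: "v \<in> solenoidal_mean_zero"
  shows "E_star (S, a) v \<in> solenoidal_mean_zero"
proof -
  note [simp del] = transpose_matrix_vector
  have conj: "(cmat S *v v (- l)) $ s = cnj ((cmat S *v v l) $ s)" for l s
    by (simp add: matrix_vector_mult_def cmat_def solenoidal_reality[OF v])
  obtain C N where C: "\<And>k. norm (v k) \<le> C * (1 + norm (rvec k)) ^ N"
    using v by (auto simp: solenoidal_mean_zero_def distributions_def)
  have "norm (E_star (S, a) v k) \<le> C * (1 + norm (rvec k)) ^ N" for k
    using C[of "transpose S *v k"] by (simp add: norm_E_star S norm_rvec_O_h O_h_transpose)
  moreover have "E_star (S, a) v (- k) $ s = cnj (E_star (S, a) v k $ s)" for k s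
    by (simp add: E_star_apply expi_uminus matrix_vector_mult_minus_right conj)
  ultimately have "E_star (S, a) v \<in> distributions" unfolding distributions_def by blast
  moreover have "E_star (S, a) v 0 = 0"
    by (simp add: E_star_apply solenoidal_at_0[OF v])
  moreover have "cdot (cvec k) (E_star (S, a) v k) = 0" for k
  proof -
    have "cvec k = cmat S *v cvec (transpose S *v k)" by (simp add: cmat_cvec S)
    then have "cdot (cvec k) (E_star (S, a) v k) = expi (- k) a * cdot (cvec (transpose S *v k)) (v (transpose S *v k))"
      by (simp add: E_star_apply cdot_cmat S)
    then show ?thesis using v by (simp add: solenoidal_mean_zero_def)
  qed
  ultimately show ?thesis by (simp add: solenoidal_mean_zero_def)
qed

lemma
  assumes S: "S \<in> O_h"
  shows E_star_H_space: "v \<in> H_space n \<Longrightarrow> E_star (S, a) v \<in> H_space n"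
    and H_norm_E_star: "H_norm n (E_star (S, a) v) = H_norm n v"
proof -
  note [simp del] = transpose_matrix_vector
  let ?f = "\<lambda>k. norm (rvec k) powr (2 * n) * (norm (v k))\<^sup>2"
  have eq: "norm (rvec k) powr (2 * n) * (norm (E_star (S, a) v k))\<^sup>2 = ?f (transpose S *v k)" for k
    by (simp add: norm_E_star S norm_rvec_O_h O_h_transpose)
  show "H_norm n (E_star (S, a) v) = H_norm n v"
    unfolding H_norm_def eq by (simp only: infsum_reindex_bij_betw[OF bij_O_h[OF S], of ?f])
  show "E_star (S, a) v \<in> H_space n" if "v \<in> H_space n"
    using that unfolding H_space_def mem_Collect_eq eq
    by (simp only: E_star_solenoidal[OF S] summable_on_reindex_bij_betw[OF bij_O_h[OF S], of ?f])
qed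

text \<open>S maps the direction of S^T k to that of k and preserves the bilinear product and
  lengths, so it intertwines the two projections.\<close>

lemma leray_E_star:
  assumes S: "S \<in> O_h"
  shows "leray k (cmat S *v c) = cmat S *v leray (transpose S *v k) c"
proof (cases "k = 0")
  case False
  note [simp del] = transpose_matrix_vector
  have ne: "transpose S *v k \<noteq> 0"
  proof
    assume "transpose S *v k = 0"
    then have "S *v (transpose S *v k) = 0" by simp
    then show False using False S by simp
  qed
  have k: "cvec k = cmat S *v cvec (transpose S *v k)" by (simp add: cmat_cvec S)
  show ?thesis
    using False ne
    by (simp add: leray_def norm_rvec_O_h O_h_transpose S matrix_vector_mult_diff_distrib vector_scalar_commute
        cmat_cvec cdot_cmat[OF S, of "cvec (transpose S *v k)", unfolded cmat_cvec O_h_cancel(1)[OF S]])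
qed (simp add: leray_def)

lemma leray_smult: "leray k (c *s w) = c *s leray k w"
  by (simp add: leray_def vector_smult_assoc vector_ssub_ldistrib mult.assoc)

lemma bounded_linear_vector_smult: "bounded_linear (\<lambda>x :: complex^'n. c *s x)"
  by (intro linear_conv_bounded_linear[THEN iffD1] linearI) (simp_all add: vec_eq_iff algebra_simps)

lemma bounded_linear_matrix_vector_mult: "bounded_linear (\<lambda>x :: complex^'n. (A :: complex^'n^'m) *v x)"
  by (intro linear_conv_bounded_linear[THEN iffD1] linearI)
    (simp_all add: matrix_vector_right_distrib, simp add: matrix_vector_mult_def vec_eq_iff scaleR_sum_right)

text \<open>The convolution sum is reindexed by S^T. The wave vectors of the two factors add up to
  k, so their phases multiply to that of k and no longer depend on the summation index.\<close>

lemma euler_P_E_star: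
  assumes S: "S \<in> O_h"
  shows "euler_P (E_star (S, a) v) (E_star (S, a) w) = E_star (S, a) (euler_P v w)"
proof
  fix k
  note [simp del] = transpose_matrix_vector
  let ?l = "transpose S *v k"
  let ?t = "\<lambda>h. cdot (v h) (cvec (?l - h)) *s leray ?l (w (?l - h))"
  define c where "c = expi (- k) a"
  have c0: "c \<noteq> 0" using norm_expi[of "- k" a] by (auto simp: c_def)
  \<comment> \<open>\<open>?L'\<close> is a bounded left inverse of \<open>?L\<close>, so applying
    \<open>?L\<close> neither creates nor destroys summability. Hence \<open>?L\<close> can be taken
    out of the sum even for a divergent series, whose sum is 0 by convention.\<close>
  let ?L = "\<lambda>x. c *s (cmat S *v x)" and ?L' = "\<lambda>x. cmat (transpose S) *v (inverse c *s x)"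
  have L: "bounded_linear ?L" "bounded_linear ?L'"
    by (rule bounded_linear_compose[OF bounded_linear_vector_smult bounded_linear_matrix_vector_mult])
       (rule bounded_linear_compose[OF bounded_linear_matrix_vector_mult bounded_linear_vector_smult])
  have LL: "?L' (?L x) = x" for x
    using c0 by (simp add: vector_smult_assoc S)
  have summand: "cdot (E_star (S, a) v h) (cvec (k - h)) *s leray k (E_star (S, a) w (k - h)) = ?L (?t (transpose S *v h))" for h
  proof -
    have kh: "transpose S *v (k - h) = ?l - transpose S *v h"
      by (simp add: matrix_vector_mult_diff_distrib)
    have "cvec (k - h) = cmat S *v cvec (?l - transpose S *v h)"
      by (simp only: cmat_cvec kh[symmetric] O_h_cancel(1)[OF S])
    then have 1: "cdot (E_star (S, a) v h) (cvec (k - h)) =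
        expi (- h) a * cdot (v (transpose S *v h)) (cvec (?l - transpose S *v h))"
      by (simp only: E_star_apply cdot_arith cdot_cmat[OF S])
    have 2: "leray k (E_star (S, a) w (k - h)) =
        expi (- (k - h)) a *s (cmat S *v leray ?l (w (?l - transpose S *v h)))"
      by (simp only: E_star_apply leray_smult leray_E_star[OF S] kh)
    have 3: "expi (- h) a * expi (- (k - h)) a = c"
      by (simp add: c_def expi_add_index[symmetric])
    have 4: "(p * d) *s (q *s (cmat S *v x)) = (p * q) *s (cmat S *v (d *s x))" for p q d x
      by (simp add: vector_scalar_commute vector_smult_assoc mult_ac)
    show ?thesis unfolding 1 2 4 3 ..
  qed
  have "(\<Sum>\<^sub>\<infinity>h. cdot (E_star (S, a) v h) (cvec (k - h)) *s leray k (E_star (S, a) w (k - h))) =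
      (\<Sum>\<^sub>\<infinity>h. ?L (?t (transpose S *v h)))"
    by (simp only: summand)
  also have "\<dots> = (\<Sum>\<^sub>\<infinity>h. ?L (?t h))"
    by (rule infsum_reindex_bij_betw[OF bij_O_h[OF S], where f = "\<lambda>h. ?L (?t h)"])
  also have "\<dots> = ?L (\<Sum>\<^sub>\<infinity>h. ?t h)"
    by (rule infsum_bounded_linear_strong[OF summable_on_bounded_linear_iff[OF L LL] L(1)])
  finally have eq: "(\<Sum>\<^sub>\<infinity>h. cdot (E_star (S, a) v h) (cvec (k - h)) *s leray k (E_star (S, a) w (k - h))) =
      ?L (\<Sum>\<^sub>\<infinity>h. ?t h)" .
  have "p *s (q *s (cmat S *v x)) = q *s (cmat S *v (p *s x))" for p q x
    by (simp only: vector_scalar_commute vector_smult_assoc mult.commute)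
  then show "euler_P (E_star (S, a) v) (E_star (S, a) w) k = E_star (S, a) (euler_P v w) k"
    unfolding euler_P_def eq unfolding E_star_apply c_def .
qed

lemma euler_P_minus: "euler_P (- v) (- w) = euler_P v w"
proof -
  have "leray k (- c) = - leray k c" for k c
    using leray_smult[of k "- 1" c] by (simp add: vector_sneg_minus1[symmetric])
  then show ?thesis by (simp add: euler_P_def)
qed

section \<open>The energy estimate\<close>

text \<open>The AM-GM inequality splits 2 |k| |v_k| into (1 + |k|)^(2 - 2 n), summable over the
  lattice because 2 n - 2 > 3, and (1 + |k|)^(2 n) |v_k|^2. For nonzero k one has 1 + |k| <= 2 |k|,
  whence the factor 2^(2 n). The bound is quadratic in the norm, which suffices for a bound that is
  uniform on compact time intervals.\<close>

lemma
  assumes v: "v \<in> H_space n" and n: "n > 5 / 2"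
  shows summable_on_H_gradient: "(\<lambda>k. norm (rvec k) * norm (v k)) summable_on UNIV"
    and H_gradient_sum_le: "2 * (\<Sum>\<^sub>\<infinity>k. norm (rvec k) * norm (v k)) \<le>
      (\<Sum>\<^sub>\<infinity>k. (1 + norm (rvec k)) powr (- (2 * n - 2))) + 2 powr (2 * n) * (H_norm n v)\<^sup>2"
proof -
  let ?Z = "\<lambda>k. (1 + norm (rvec k)) powr (- (2 * n - 2))"
  let ?g = "\<lambda>k. norm (rvec k) powr (2 * n) * (norm (v k))\<^sup>2"
  have Z: "?Z summable_on UNIV" using n by (intro summable_on_lattice_powr) auto
  have g: "?g summable_on UNIV" using v by (simp add: H_space_def)
  have le: "2 * (norm (rvec k) * norm (v k)) \<le> ?Z k + 2 powr (2 * n) * ?g k" for k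
  proof (cases "k = 0")
    case False
    let ?x = "norm (rvec k)"
    have x: "1 \<le> ?x" using False by (rule norm_rvec_ge_1)
    have "2 * ((1 + ?x) powr (1 - n)) * ((1 + ?x) powr n * norm (v k)) \<le>
        ((1 + ?x) powr (1 - n))\<^sup>2 + ((1 + ?x) powr n * norm (v k))\<^sup>2"
      by (rule sum_squares_bound)
    moreover have "(1 + ?x) powr (1 - n) * (1 + ?x) powr n = 1 + ?x" using x by (simp flip: powr_add)
    then have "2 * ((1 + ?x) powr (1 - n)) * ((1 + ?x) powr n * norm (v k)) = 2 * ((1 + ?x) * norm (v k))"
      by (simp add: mult.assoc[symmetric])
    moreover have "((1 + ?x) powr (1 - n))\<^sup>2 = ?Z k"
      by (simp add: power2_eq_square flip: powr_add)
    moreover have "((1 + ?x) powr n * norm (v k))\<^sup>2 \<le> 2 powr (2 * n) * ?g k"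
    proof -
      have "(1 + ?x) powr n \<le> (2 * ?x) powr n" using x n by (intro powr_mono2) auto
      also have "\<dots> = 2 powr n * ?x powr n" by (simp add: powr_mult)
      finally have "((1 + ?x) powr n)\<^sup>2 \<le> (2 powr n * ?x powr n)\<^sup>2" by (intro power_mono) auto
      also have "\<dots> = 2 powr (2 * n) * ?x powr (2 * n)"
        by (simp only: power_mult_distrib power2_eq_square mult_2 powr_add) (simp only: mult_ac)
      finally have "((1 + ?x) powr n)\<^sup>2 * (norm (v k))\<^sup>2 \<le> 2 powr (2 * n) * ?x powr (2 * n) * (norm (v k))\<^sup>2"
        by (rule mult_right_mono) simp
      then show ?thesis by (simp only: power_mult_distrib mult.assoc)
    qed
    moreover have "2 * (?x * norm (v k)) \<le> 2 * ((1 + ?x) * norm (v k))"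
      by (simp add: distrib_right)
    ultimately show ?thesis by linarith
  qed (simp add: solenoidal_at_0[OF H_space_solenoidal[OF v]])
  have s: "(\<lambda>k. ?Z k + 2 powr (2 * n) * ?g k) summable_on UNIV"
    by (intro summable_on_add summable_on_cmult_right Z g)
  have "(\<lambda>k. 2 * (norm (rvec k) * norm (v k))) summable_on UNIV"
    by (rule summable_on_comparison_test[OF s le]) simp
  then show *: "(\<lambda>k. norm (rvec k) * norm (v k)) summable_on UNIV"
    by (subst (asm) summable_on_cmult_right') auto
  have "2 * (\<Sum>\<^sub>\<infinity>k. norm (rvec k) * norm (v k)) = (\<Sum>\<^sub>\<infinity>k. 2 * (norm (rvec k) * norm (v k)))"
    by (rule infsum_cmult_right[OF *, symmetric])
  also have "\<dots> \<le> (\<Sum>\<^sub>\<infinity>k. ?Z k + 2 powr (2 * n) * ?g k)"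
    by (intro infsum_mono summable_on_cmult_right * s le)
  also have "\<dots> = (\<Sum>\<^sub>\<infinity>k. ?Z k) + 2 powr (2 * n) * (\<Sum>\<^sub>\<infinity>k. ?g k)"
    by (simp only: infsum_add[OF Z summable_on_cmult_right[OF g]] infsum_cmult_right[OF g])
  also have "(\<Sum>\<^sub>\<infinity>k. ?g k) = (H_norm n v)\<^sup>2" by (simp add: H_norm_def infsum_nonneg)
  finally show "2 * (\<Sum>\<^sub>\<infinity>k. norm (rvec k) * norm (v k)) \<le> (\<Sum>\<^sub>\<infinity>k. ?Z k) + 2 powr (2 * n) * (H_norm n v)\<^sup>2" .
qed

lemma H_space_imp_summable:
  assumes v: "v \<in> H_space n" and n: "n > 5 / 2"
  shows "(\<lambda>k. norm (v k)) summable_on UNIV"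
    and "(\<lambda>k. (norm (v k))\<^sup>2) summable_on UNIV"
    and "(\<lambda>k. (norm (rvec k) * norm (v k))\<^sup>2) summable_on UNIV"
proof -
  have v0: "v 0 = 0" using solenoidal_at_0[OF H_space_solenoidal[OF v]] .
  have "norm (v k) \<le> norm (rvec k) * norm (v k)" for k
    using norm_rvec_ge_1[of k] mult_right_mono[of 1 "norm (rvec k)" "norm (v k)"] v0 by (cases "k = 0") auto
  then show "(\<lambda>k. norm (v k)) summable_on UNIV"
    by (intro summable_on_comparison_test[OF summable_on_H_gradient[OF v n]]) auto
  have sq: "(\<lambda>k. norm (rvec k) powr (2 * m) * (norm (v k))\<^sup>2) summable_on UNIV" if "m \<le> n" for m
    using v H_space_mono[OF that] by (auto simp: H_space_def)
  \<comment> \<open>The value of \<open>0 powr 0\<close> is 0, so at the zero wave vector the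
    equation rests on v_0 = 0.\<close>
  have e0: "norm (rvec k) powr (2 * 0) * (norm (v k))\<^sup>2 = (norm (v k))\<^sup>2" for k
    using v0 by (cases "k = 0") auto
  show "(\<lambda>k. (norm (v k))\<^sup>2) summable_on UNIV" using sq[of 0] n unfolding e0 by simp
  have "norm (rvec k) powr (2 * 1) * (norm (v k))\<^sup>2 = (norm (rvec k) * norm (v k))\<^sup>2" for k
    by (simp add: power_mult_distrib)
  then show "(\<lambda>k. (norm (rvec k) * norm (v k))\<^sup>2) summable_on UNIV" using sq[of 1] n by simp
qed

section \<open>The trilinear form of the nonlinearity\<close>

definition cconj :: "complex^'n \<Rightarrow> complex^'n" where
  "cconj x = (\<chi> s. cnj (x $ s))"

lemma inner_eq_Re_cdot: "x \<bullet> y = Re (cdot (cconj x) y)"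
  by (simp add: inner_vec_def cdot_def cconj_def inner_complex_def)

lemma cdot_cconj: "cdot (cconj x) y = cnj (cdot x (cconj y))"
  by (simp add: cdot_def cconj_def)

lemma cconj_cvec [simp]: "cconj (cvec k) = cvec k"
  by (simp add: cconj_def cvec_def vec_eq_iff)

lemma norm_leray_le: "norm (leray k c) \<le> 2 * norm c"
proof (cases "k = 0")
  case False
  let ?x = "norm (rvec k)"
  have x: "?x > 0" using norm_rvec_ge_1[OF False] by linarith
  have "norm (cdot (cvec k) c) \<le> ?x * norm c" using norm_cdot_le[of "cvec k" c] by simp
  then have "norm (cdot (cvec k) c) / ?x\<^sup>2 * ?x \<le> ?x * norm c / ?x\<^sup>2 * ?x"
    by (intro mult_right_mono divide_right_mono) auto
  also have "\<dots> = norm c" using x by (simp add: power2_eq_square)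
  finally have "norm ((cdot (cvec k) c / of_real (?x\<^sup>2)) *s cvec k) \<le> norm c"
    by (simp add: norm_vector_smult norm_divide norm_power)
  then show ?thesis
    using False norm_triangle_ineq4[of c "(cdot (cvec k) c / of_real (?x\<^sup>2)) *s cvec k"] by (simp add: leray_def)
qed (simp add: leray_def)

text \<open>The projection subtracts a multiple of \<open>cvec k\<close>. This vector is real, so
  the vanishing of the bilinear product with it is also orthogonality in the Hermitian
  sense.\<close>

lemma inner_leray:
  assumes "cdot d (cvec k) = 0"
  shows "d \<bullet> (c *s leray k w) = d \<bullet> (c *s w)"
proof (cases "k = 0")
  case False
  have "cdot (cconj d) (cvec k) = 0" using assms by (simp add: cdot_cconj)
  then show ?thesis using False by (simp add: inner_eq_Re_cdot leray_def)
qed (simp add: leray_def)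

text \<open>The trilinear form \<open>- \<integral> d \<cdot> (v \<cdot> \<nabla>) w\<close>, as a double series.\<close>

definition euler_form :: "vec_field \<Rightarrow> vec_field \<Rightarrow> vec_field \<Rightarrow> (int^3) \<times> (int^3) \<Rightarrow> real" where
  "euler_form d v w = (\<lambda>(k, l). d k \<bullet> ((- \<i> * cdot (v (k - l)) (cvec l)) *s w l))"

lemma abs_euler_form_le:
  "\<bar>euler_form d v w (k, l)\<bar> \<le> norm (d k) * norm (v (k - l)) * (norm (rvec l) * norm (w l))"
proof -
  have "\<bar>euler_form d v w (k, l)\<bar> \<le> norm (d k) * norm ((- \<i> * cdot (v (k - l)) (cvec l)) *s w l)"
    unfolding euler_form_def by (simp add: Cauchy_Schwarz_ineq2)
  also have "\<dots> \<le> norm (d k) * (norm (v (k - l)) * norm (rvec l) * norm (w l))"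
    unfolding norm_vector_smult using norm_cdot_le[of "v (k - l)" "cvec l"]
    by (intro mult_left_mono mult_right_mono) (auto simp: norm_mult)
  finally show ?thesis by (simp add: mult.assoc)
qed

text \<open>Schur's test with kernel |v_(k-l)|, summable because n > 5/2, applied to |d_k| and |l|
  |w_l|, both square summable.\<close>

lemma summable_on_euler_form:
  assumes "d \<in> H_space n" "v \<in> H_space n" "w \<in> H_space n" and n: "n > 5 / 2"
  shows "euler_form d v w summable_on UNIV"
proof (rule abs_summable_summable, rule summable_on_comparison_test)
  show "(\<lambda>(k, l). norm (d k) * (norm (rvec l) * norm (w l)) * norm (v (k - l))) summable_on UNIV"
    using assms by (intro summable_on_convolution_form H_space_imp_summable) auto
  show "norm (euler_form d v w x) \<le> (case x of (k, l) \<Rightarrow> norm (d k) * (norm (rvec l) * norm (w l)) * norm (v (k - l)))" for x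
    using abs_euler_form_le[of d v w "fst x" "snd x"] by (simp add: case_prod_unfold mult_ac)
qed simp

text \<open>Since d is divergence free, \<open>inner_leray\<close> removes the projection. The
  substitution l = k - h makes the wave vector of w the summation index.\<close>

lemma has_sum_euler_form:
  assumes d: "d \<in> H_space n" and v: "v \<in> H_space n" and w: "w \<in> H_space n" and n: "n > 5 / 2"
  shows "((\<lambda>l. euler_form d v w (k, l)) has_sum (d k \<bullet> euler_P v w k)) UNIV"
proof -
  let ?F = "\<lambda>l. cdot (v (k - l)) (cvec l) *s leray k (w l)"
  have sF: "?F summable_on UNIV"
  proof (rule abs_summable_summable, rule summable_on_comparison_test)
    let ?B = "\<Sum>\<^sub>\<infinity>h. norm (v h)"
    show "(\<lambda>l. 2 * ?B * (norm (rvec l) * norm (w l))) summable_on UNIV"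
      by (intro summable_on_cmult_right summable_on_H_gradient[OF w n])
    fix l
    have B: "norm (v h) \<le> ?B" for h
      using finite_sum_le_infsum[OF H_space_imp_summable(1)[OF v n], of "{h}"] by simp
    have "norm (?F l) \<le> (norm (v (k - l)) * norm (rvec l)) * (2 * norm (w l))"
      unfolding norm_vector_smult using norm_cdot_le[of "v (k - l)" "cvec l"]
      by (intro mult_mono norm_leray_le) auto
    also have "\<dots> \<le> (?B * norm (rvec l)) * (2 * norm (w l))"
      by (intro mult_right_mono B) auto
    finally show "norm (?F l) \<le> 2 * ?B * (norm (rvec l) * norm (w l))" by (simp add: mult_ac)
  qed simp
  have bl: "bounded_linear (\<lambda>x. d k \<bullet> (- \<i> *s x))"
    by (rule bounded_linear_compose[OF bounded_linear_inner_right bounded_linear_vector_smult])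
  have "((\<lambda>l. d k \<bullet> (- \<i> *s ?F l)) has_sum (d k \<bullet> (- \<i> *s (\<Sum>\<^sub>\<infinity>l. ?F l)))) UNIV"
    by (rule has_sum_bounded_linear[OF bl has_sum_infsum[OF sF]])
  moreover have "d k \<bullet> (- \<i> *s ?F l) = euler_form d v w (k, l)" for l
    unfolding euler_form_def split vector_smult_assoc
    by (rule inner_leray) (rule solenoidal_cdot[OF H_space_solenoidal[OF d]])
  moreover have "(\<Sum>\<^sub>\<infinity>l. ?F l) = (\<Sum>\<^sub>\<infinity>h. cdot (v h) (cvec (k - h)) *s leray k (w (k - h)))"
    by (rule infsum_reindex_bij_witness[of UNIV "\<lambda>h. k - h" "\<lambda>l. k - l"]) auto
  ultimately show ?thesis by (simp add: euler_P_def)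
qed

lemma has_sum_inner_euler_P:
  assumes "d \<in> H_space n" "v \<in> H_space n" "w \<in> H_space n" "n > 5 / 2"
  shows "((\<lambda>k. d k \<bullet> euler_P v w k) has_sum (infsum (euler_form d v w) UNIV)) UNIV"
proof (rule has_sum_SigmaD)
  show "(euler_form d v w has_sum infsum (euler_form d v w) UNIV) (UNIV \<times> UNIV)"
    using has_sum_infsum[OF summable_on_euler_form[OF assms]] by simp
qed (rule has_sum_euler_form[OF assms])

text \<open>Incompressibility of \<open>v\<close> makes the form antisymmetric in its outer arguments.\<close>

lemma infsum_euler_form_diagonal:
  assumes v: "v \<in> solenoidal_mean_zero"
  shows "infsum (euler_form d v d) UNIV = 0"
proof -
  have anti: "euler_form d v d (l, k) = - euler_form d v d (k, l)" for k l
  proof -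
    let ?z = "cdot (v (k - l)) (cvec l)" and ?c = "cdot (cconj (d k)) (d l)"
    \<comment> \<open>The coefficient v_(k-l) is orthogonal to k - l, so k and l have the same
      product with it.\<close>
    have "cdot (v (k - l)) (cvec k) = ?z"
      using solenoidal_cdot[OF v, of "k - l"] by simp
    moreover have "v (l - k) = cconj (v (k - l))"
      using solenoidal_reality[OF v, of "k - l"] by (simp add: cconj_def vec_eq_iff)
    ultimately have z: "cdot (v (l - k)) (cvec k) = cnj ?z"
      by (simp add: cdot_cconj)
    have c: "cdot (cconj (d l)) (d k) = cnj ?c"
      by (simp add: cdot_def cconj_def mult.commute)
    \<comment> \<open>The factor -i turns the real part into an imaginary part; exchanging k and l
      conjugates both factors and thereby changes its sign.\<close>
    have "euler_form d v d (k, l) = Im (?z * ?c)"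
      by (simp add: euler_form_def inner_eq_Re_cdot)
    moreover have "euler_form d v d (l, k) = Im (cnj ?z * cnj ?c)"
      by (simp add: euler_form_def inner_eq_Re_cdot z c)
    ultimately show ?thesis by simp
  qed
  have "euler_form d v d (prod.swap x) = - euler_form d v d x" for x
    using anti[of "snd x" "fst x"] by (simp add: prod.swap_def)
  then have "infsum (euler_form d v d) UNIV = infsum (\<lambda>x. - euler_form d v d x) UNIV"
    using infsum_reindex_bij_betw[OF bij_swap, of "euler_form d v d"] by simp
  then show ?thesis by (simp add: infsum_uminus)
qed

text \<open>Schur's test with the roles changed: after the substitution h = k - l the kernel is |j|
  |w_j| at j = k - h, and both copies of d enter through their L^2 norm. No derivative falls on d,
  which is what lets the estimate close in L^2.\<close>

lemma abs_infsum_euler_form_le: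
  assumes d: "d \<in> H_space n" and w: "w \<in> H_space n" and n: "n > 5 / 2"
  shows "\<bar>infsum (euler_form d d w) UNIV\<bar> \<le>
     (\<Sum>\<^sub>\<infinity>k. (norm (d k))\<^sup>2) * (\<Sum>\<^sub>\<infinity>k. norm (rvec k) * norm (w k))"
proof -
  let ?T = "\<lambda>(k, h). euler_form d d w (k, k - h)"
  let ?C = "\<lambda>(k, h). norm (d k) * norm (d h) * (norm (rvec (k - h)) * norm (w (k - h)))"
  have bij: "bij (\<lambda>(k, h). (k, k - h :: int^3))"
    by (rule bij_betwI[of _ _ _ "\<lambda>(k, h). (k, k - h)"]) auto
  have sT: "(\<lambda>x. euler_form d d w (case x of (k, h) \<Rightarrow> (k, k - h))) summable_on UNIV"
    using summable_on_euler_form[OF d d w n]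
    by (simp only: summable_on_reindex_bij_betw[OF bij, of "euler_form d d w"])
  note dd = H_space_imp_summable(2)[OF d n]
  have sC: "?C summable_on UNIV"
    by (rule summable_on_convolution_form[OF dd _ dd _ summable_on_H_gradient[OF w n]]) auto
  have "norm (infsum (euler_form d d w) UNIV) = norm (\<Sum>\<^sub>\<infinity>x. euler_form d d w (case x of (k, h) \<Rightarrow> (k, k - h)))"
    by (simp only: infsum_reindex_bij_betw[OF bij, of "euler_form d d w"])
  also have "\<dots> \<le> infsum ?C UNIV"
  proof (rule norm_infsum_le[OF has_sum_infsum[OF sT] has_sum_infsum[OF sC]])
    fix x :: "(int^3) \<times> (int^3)"
    show "norm (euler_form d d w (case x of (k, h) \<Rightarrow> (k, k - h))) \<le> ?C x"
      using abs_euler_form_le[of d d w "fst x" "fst x - snd x"] by (simp add: case_prod_unfold)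
  qed
  also have "\<dots> \<le> ((\<Sum>\<^sub>\<infinity>k. (norm (d k))\<^sup>2) + (\<Sum>\<^sub>\<infinity>k. (norm (d k))\<^sup>2)) / 2 * (\<Sum>\<^sub>\<infinity>k. norm (rvec k) * norm (w k))"
    by (rule infsum_convolution_form_le[OF dd _ dd _ summable_on_H_gradient[OF w n]]) auto
  finally show ?thesis by simp
qed

lemma energy_estimate:
  assumes u: "u \<in> H_space n" and w: "w \<in> H_space n" and n: "n > 5 / 2"
  shows "\<bar>\<Sum>\<^sub>\<infinity>k. (u k - w k) \<bullet> (euler_P u u k - euler_P w w k)\<bar> \<le>
     (\<Sum>\<^sub>\<infinity>k. (norm (u k - w k))\<^sup>2) * (\<Sum>\<^sub>\<infinity>k. norm (rvec k) * norm (w k))"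
proof -
  define d where "d = u - w"
  have d: "d \<in> H_space n" unfolding d_def by (rule H_space_diff[OF u w])
  note s = summable_on_euler_form[OF _ _ _ n]
  have "((\<lambda>k. d k \<bullet> euler_P u u k - d k \<bullet> euler_P w w k) has_sum
      (infsum (euler_form d u u) UNIV - infsum (euler_form d w w) UNIV)) UNIV"
    by (intro has_sum_diff has_sum_inner_euler_P[OF _ _ _ n] d u w)
  then have "(\<Sum>\<^sub>\<infinity>k. (u k - w k) \<bullet> (euler_P u u k - euler_P w w k)) =
      infsum (euler_form d u u) UNIV - infsum (euler_form d w w) UNIV"
    by (simp add: d_def inner_diff_right infsumI)
  also have "\<dots> = infsum (\<lambda>x. euler_form d u u x - euler_form d w w x) UNIV"
    by (rule infsumI[symmetric]) (intro has_sum_diff has_sum_infsum s d u w)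
  \<comment> \<open>The splitting P(u, u) - P(w, w) = P(u, d) + P(d, w), carried out termwise in the
    double series, where summability of each form is known.\<close>
  also have "(\<lambda>x. euler_form d u u x - euler_form d w w x) = (\<lambda>x. euler_form d u d x + euler_form d d w x)"
  proof
    fix x :: "(int^3) \<times> (int^3)"
    obtain k l where x: "x = (k, l)" by (cases x)
    have "p *s (y :: complex^3) - q *s z = p *s (y - z) + (p - q) *s z" for p q y z
      by (simp add: vec_eq_iff algebra_simps)
    then show "euler_form d u u x - euler_form d w w x = euler_form d u d x + euler_form d d w x"
      by (simp only: x euler_form_def split inner_diff_right[symmetric] inner_add_right[symmetric])
        (simp add: d_def algebra_simps)
  qed
  also have "infsum \<dots> UNIV = infsum (euler_form d u d) UNIV + infsum (euler_form d d w) UNIV"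
    by (rule infsum_add) (intro s d u w)+
  also have "\<dots> = infsum (euler_form d d w) UNIV"
    by (simp add: infsum_euler_form_diagonal H_space_solenoidal[OF u])
  finally show ?thesis
    using abs_infsum_euler_form_le[OF d w n] by (simp add: d_def)
qed

section \<open>Uniqueness by the energy method\<close>

text \<open>Solutions extend to both sides of time 0, so |e'| is bounded rather than e'. For
  positive times e(s) exp(-K s) is nonincreasing, and for negative times e(s) exp(K s) is
  nondecreasing; either way e(t) is at most 0.\<close>

lemma gronwall_zero:
  fixes e e' :: "real \<Rightarrow> real"
  assumes e: "\<And>s. s \<in> closed_segment 0 t \<Longrightarrow> (e has_real_derivative e' s) (at s)"
    and le: "\<And>s. s \<in> closed_segment 0 t \<Longrightarrow> \<bar>e' s\<bar> \<le> K * e s"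
    and e0: "e 0 = 0" and nonneg: "0 \<le> e t"
  shows "e t = 0"
proof (cases "0 \<le> t")
  case True
  have "e t * exp (- K * t) \<le> e 0 * exp (- K * 0)"
  proof (rule DERIV_nonpos_imp_nonincreasing[OF True])
    fix s assume "0 \<le> s" "s \<le> t"
    then have s: "s \<in> closed_segment 0 t" by (simp add: closed_segment_eq_real_ivl)
    have "((\<lambda>s. e s * exp (- K * s)) has_real_derivative (e' s - K * e s) * exp (- K * s)) (at s)"
      by (auto intro!: derivative_eq_intros e[OF s] simp: algebra_simps)
    moreover have "(e' s - K * e s) * exp (- K * s) \<le> 0"
      using le[OF s] by (intro mult_nonpos_nonneg) auto
    ultimately show "\<exists>y. ((\<lambda>s. e s * exp (- K * s)) has_real_derivative y) (at s) \<and> y \<le> 0" by blast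
  qed
  then show ?thesis using e0 nonneg by (simp add: mult_le_0_iff)
next
  case False
  then have t: "t \<le> 0" by simp
  have "e t * exp (K * t) \<le> e 0 * exp (K * 0)"
  proof (rule DERIV_nonneg_imp_nondecreasing[OF t])
    fix s assume "t \<le> s" "s \<le> 0"
    then have s: "s \<in> closed_segment 0 t" by (simp add: closed_segment_eq_real_ivl)
    have "((\<lambda>s. e s * exp (K * s)) has_real_derivative (e' s + K * e s) * exp (K * s)) (at s)"
      by (auto intro!: derivative_eq_intros e[OF s] simp: algebra_simps)
    moreover have "0 \<le> (e' s + K * e s) * exp (K * s)"
      using le[OF s] by (intro mult_nonneg_nonneg) auto
    ultimately show "\<exists>y. ((\<lambda>s. e s * exp (K * s)) has_real_derivative y) (at s) \<and> 0 \<le> y" by blast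
  qed
  then show ?thesis using e0 nonneg by (simp add: mult_le_0_iff)
qed

lemma inner_sobolev_embed_0:
  assumes "v \<in> H_space 0" "w \<in> H_space 0"
  shows "sobolev_embed 0 v \<bullet> sobolev_embed 0 w = (\<Sum>\<^sub>\<infinity>k. v k \<bullet> w k)"
proof -
  \<comment> \<open>The weight is 1 except at k = 0, where \<open>powr\<close> gives 0; there the
    mean zero condition makes both sides vanish.\<close>
  have "(norm (rvec k) powr 0 *\<^sub>R v k) \<bullet> (norm (rvec k) powr 0 *\<^sub>R w k) = v k \<bullet> w k" for k
    using solenoidal_at_0[OF H_space_solenoidal[OF assms(1)]] by (cases "k = 0") auto
  then show ?thesis by (simp only: inner_ell2.rep_eq ell2_coeff_sobolev_embed assms)
qed

text \<open>The energy estimate is asymmetric: its rate involves the gradient of w alone. Continuity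
  in H^n is therefore assumed for w, so that its norm is bounded on the compact segment from 0 to
  t.\<close>

lemma euler_unique:
  fixes t :: real
  assumes n: "n > 5 / 2"
    and U: "open I" "closed_segment 0 t \<subseteq> I"
    and u: "\<And>s. s \<in> I \<Longrightarrow> u s \<in> H_space n"
      "\<And>s. s \<in> I \<Longrightarrow> has_derivative_in (H_topology 0) u (euler_P (u s) (u s)) s"
    and w: "\<And>s. s \<in> I \<Longrightarrow> w s \<in> H_space n"
      "\<And>s. s \<in> I \<Longrightarrow> limitin (H_topology n) w (w s) (at s)"
      "\<And>s. s \<in> I \<Longrightarrow> has_derivative_in (H_topology 0) w (euler_P (w s) (w s)) s"
    and init: "u 0 = w 0"
  shows "u t = w t"
proof -
  let ?J = "sobolev_embed 0"
  have H0: "u s \<in> H_space 0" "w s \<in> H_space 0" if "s \<in> I" for s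
    using H_space_mono[of 0 n] n u(1)[OF that] w(1)[OF that] by auto
  have ev: "\<forall>\<^sub>F s in at t'. s \<in> I" if "t' \<in> I" for t'
    using U(1) that by (intro eventually_at_in_open') auto
  have P0: "euler_P (u s) (u s) \<in> H_space 0" "euler_P (w s) (w s) \<in> H_space 0" if "s \<in> I" for s
    using u(2)[OF that] w(3)[OF that] by (auto simp: has_derivative_in_def limitin_H_topology)
  define D where "D = (\<lambda>s. ?J (u s) - ?J (w s))"
  define D' where "D' = (\<lambda>s. ?J (euler_P (u s) (u s)) - ?J (euler_P (w s) (w s)))"
  have D: "(D has_vector_derivative D' s) (at s)" if s: "s \<in> I" for s
    unfolding D_def D'_def
    by (intro has_vector_derivative_diff has_derivative_in_H_imp_vector_derivative u(2) w(3) s H0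
        eventually_mono[OF ev[OF s]])
  have e: "((\<lambda>s. D s \<bullet> D s) has_real_derivative (2 * (D s \<bullet> D' s))) (at s)" if "s \<in> I" for s
    using bounded_bilinear.has_vector_derivative[OF bounded_bilinear_inner D[OF that] D[OF that]]
    by (simp add: has_real_derivative_iff_has_vector_derivative inner_commute)
  have cont: "continuous_on (closed_segment 0 t) (\<lambda>s. sobolev_embed n (w s))"
    unfolding continuous_on_def
    using limitin_H_imp_tendsto[OF w(2)] U(2) tendsto_within_subset by blast
  have "compact ((\<lambda>s. sobolev_embed n (w s)) ` closed_segment 0 t)"
    by (intro compact_continuous_image cont compact_segment)
  then obtain B where B: "\<And>s. s \<in> closed_segment 0 t \<Longrightarrow> norm (sobolev_embed n (w s)) \<le> B"
    using compact_imp_bounded bounded_iff by (metis imageI)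
  \<comment> \<open>The right-hand side of \<open>H_gradient_sum_le\<close> with B in place of the
    norm. That lemma bounds twice the gradient sum, and the 2 is the one produced by differentiating
    the square.\<close>
  define K where "K = (\<Sum>\<^sub>\<infinity>k. (1 + norm (rvec k)) powr (- (2 * n - 2))) + 2 powr (2 * n) * B\<^sup>2"
  have "D t \<bullet> D t = 0"
  proof (rule gronwall_zero[where e = "\<lambda>s. D s \<bullet> D s" and e' = "\<lambda>s. 2 * (D s \<bullet> D' s)" and K = K])
    fix s assume s: "s \<in> closed_segment 0 t"
    then have sI: "s \<in> I" using U(2) by blast
    show "((\<lambda>s. D s \<bullet> D s) has_real_derivative 2 * (D s \<bullet> D' s)) (at s)" by (rule e[OF sI])
    let ?M = "\<Sum>\<^sub>\<infinity>k. norm (rvec k) * norm (w s k)"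
    have 1: "D s = ?J (u s - w s)" "D' s = ?J (euler_P (u s) (u s) - euler_P (w s) (w s))"
      by (simp_all only: D_def D'_def sobolev_embed_diff H0[OF sI] P0[OF sI])
    have 2: "u s - w s \<in> H_space 0" "euler_P (u s) (u s) - euler_P (w s) (w s) \<in> H_space 0"
      by (intro H_space_diff H0[OF sI] P0[OF sI])+
    have DD: "D s \<bullet> D s = (\<Sum>\<^sub>\<infinity>k. (norm (u s k - w s k))\<^sup>2)"
      by (simp only: 1 inner_sobolev_embed_0[OF 2(1) 2(1)] power2_norm_eq_inner minus_apply)
    have "D s \<bullet> D' s = (\<Sum>\<^sub>\<infinity>k. (u s k - w s k) \<bullet> (euler_P (u s) (u s) k - euler_P (w s) (w s) k))"
      by (simp only: 1 inner_sobolev_embed_0[OF 2] minus_apply)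
    then have "\<bar>D s \<bullet> D' s\<bar> \<le> (D s \<bullet> D s) * ?M"
      using energy_estimate[OF u(1)[OF sI] w(1)[OF sI] n] DD by simp
    moreover have "2 * ?M \<le> K"
    proof -
      have "(H_norm n (w s))\<^sup>2 \<le> B\<^sup>2"
        using B[OF s] by (simp add: H_norm_eq w(1) sI power_mono)
      then have "2 powr (2 * n) * (H_norm n (w s))\<^sup>2 \<le> 2 powr (2 * n) * B\<^sup>2"
        by (intro mult_left_mono) auto
      then show ?thesis
        using H_gradient_sum_le[OF w(1)[OF sI] n] unfolding K_def by linarith
    qed
    then have "(D s \<bullet> D s) * (2 * ?M) \<le> (D s \<bullet> D s) * K" by (intro mult_left_mono) auto
    ultimately show "\<bar>2 * (D s \<bullet> D' s)\<bar> \<le> K * (D s \<bullet> D s)" by (simp add: abs_mult mult_ac)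
  qed (auto simp: D_def init)
  moreover have t: "t \<in> I" using U(2) by auto
  ultimately have "u t - w t = 0"
    using sobolev_embed_eq_0_iff[OF H_space_diff[OF H0[OF t]]] by (simp add: D_def sobolev_embed_diff H0 t)
  then show ?thesis by simp
qed

section \<open>Solutions\<close>

lemma open_time_interval: "open (time_interval Tm Tp)"
proof -
  have "time_interval Tm Tp = ereal -` {- Tm<..<Tp}"
    by (auto simp: time_interval_def)
  then show ?thesis by (simp add: open_vimage continuous_on_ereal)
qed

lemma minus_in_time_interval_iff [simp]: "- t \<in> time_interval Tm Tp \<longleftrightarrow> t \<in> time_interval Tp Tm"
  unfolding time_interval_def mem_Collect_eq uminus_ereal.simps(1)[symmetric]
  by (simp only: ereal_minus_less_minus ereal_uminus_less_reorder conj_commute)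

lemma zero_in_time_interval: "0 < Tm \<Longrightarrow> 0 < Tp \<Longrightarrow> 0 \<in> time_interval Tm Tp"
  by (simp add: time_interval_def ereal_uminus_less_reorder flip: zero_ereal_def)

lemma closed_segment_subset_time_interval:
  assumes "0 < Tm" "0 < Tp" "t \<in> time_interval Tm Tp"
  shows "closed_segment 0 t \<subseteq> time_interval Tm Tp"
proof
  fix s assume "s \<in> closed_segment 0 t"
  then have "0 \<le> s \<and> s \<le> t \<or> t \<le> s \<and> s \<le> 0"
    by (auto simp: closed_segment_eq_real_ivl split: if_splits)
  moreover have "- Tm < ereal 0" "ereal 0 < Tp"
    using zero_in_time_interval[OF assms(1,2)] by (auto simp: time_interval_def)
  moreover have "- Tm < ereal t" "ereal t < Tp" using assms(3) by (auto simp: time_interval_def)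
  ultimately show "s \<in> time_interval Tm Tp"
    unfolding time_interval_def mem_Collect_eq
    by (meson ereal_less_eq(3) order_le_less_trans order_less_le_trans)
qed

text \<open>Both intervals contain 0, so their union is again an interval, with the farther end
  point on each side.\<close>

lemma time_interval_max:
  assumes "0 < Tm" "0 < Tp" "0 < Tm'" "0 < Tp'"
  shows "time_interval (max Tm Tm') (max Tp Tp') = time_interval Tm Tp \<union> time_interval Tm' Tp'"
  unfolding set_eq_iff
proof
  fix t
  have neg: "- T < ereal 0" if "0 < T" for T :: ereal
    using that by (simp add: ereal_uminus_less_reorder flip: zero_ereal_def)
  have "- T < ereal t \<longleftrightarrow> ereal (- t) < T" for T
    using ereal_uminus_less_reorder[of T "ereal t"] by simp
  then have max_iff: "- max Tm Tm' < ereal t \<longleftrightarrow> - Tm < ereal t \<or> - Tm' < ereal t"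
    by (simp only: less_max_iff_disj)
  show "t \<in> time_interval (max Tm Tm') (max Tp Tp') \<longleftrightarrow> t \<in> time_interval Tm Tp \<union> time_interval Tm' Tp'"
  proof (cases "t \<le> 0")
    case True
    then have "ereal t \<le> 0" by simp
    then have "ereal t < T" if "0 < T" for T using that by (rule order_le_less_trans)
    then show ?thesis
      using assms max_iff by (simp add: time_interval_def less_max_iff_disj)
  next
    case False
    then have "ereal 0 \<le> ereal t" by simp
    then have "- T < ereal t" if "0 < T" for T using neg[OF that] by (rule order_less_le_trans[rotated])
    then show ?thesis
      using assms max_iff by (simp only: time_interval_def less_max_iff_disj mem_Collect_eq Un_iff simp_thms)
  qed
qed

text \<open>On an open set the punctured neighbourhood filters of the subspace and of the real line
  agree, which turns continuity into a condition on germs.\<close>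

lemma C0_map_iff:
  assumes "open I"
  shows "C0_map X I u \<longleftrightarrow> (\<forall>t\<in>I. limitin X u (u t) (at t))"
proof -
  have "eventually P (atin (top_of_set I) t) \<longleftrightarrow> eventually P (at t)" if t: "t \<in> I" for P t
  proof
    assume "eventually P (atin (top_of_set I) t)"
    then obtain U where "openin (top_of_set I) U" "t \<in> U" "\<forall>x\<in>U - {t}. P x"
      using t unfolding eventually_atin by auto
    then show "eventually P (at t)"
      unfolding eventually_at_topological using openin_open_eq[OF assms] by blast
  next
    assume "eventually P (at t)"
    then obtain U where "open U" "t \<in> U" "\<forall>x\<in>U. x \<noteq> t \<longrightarrow> P x"
      unfolding eventually_at_topological by blast
    moreover from this have "openin (top_of_set I) (U \<inter> I)"
      using openin_open_eq[OF assms] assms by blast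
    ultimately show "eventually P (atin (top_of_set I) t)"
      unfolding eventually_atin using t by (intro disjI2 exI[of _ "U \<inter> I"]) auto
  qed
  then show ?thesis
    unfolding C0_map_def continuous_map_atin by (simp add: limitin_def)
qed

lemma limitin_compose_filterlim:
  "limitin X f l F' \<Longrightarrow> filterlim g F' F \<Longrightarrow> limitin X (\<lambda>x. f (g x)) l F"
  by (auto simp: limitin_def filterlim_iff)

lemma has_derivative_in_cong:
  assumes "has_derivative_in X u d t" "\<epsilon> > 0" "\<And>s. \<bar>s - t\<bar> < \<epsilon> \<Longrightarrow> u s = w s"
  shows "has_derivative_in X w d t"
  unfolding has_derivative_in_def
proof (rule limitin_transform_eventually)
  show "limitin X (\<lambda>h. (1 / h) *\<^sub>R (u (t + h) - u t)) d (at 0)"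
    using assms(1) by (simp add: has_derivative_in_def)
  have "\<forall>\<^sub>F h in at 0. \<bar>h\<bar> < \<epsilon>"
    using assms(2) by (auto simp: eventually_at dist_real_def)
  then show "\<forall>\<^sub>F h in at 0. (1 / h) *\<^sub>R (u (t + h) - u t) = (1 / h) *\<^sub>R (w (t + h) - w t)"
    by (rule eventually_mono) (use assms in simp)
qed

lemma has_derivative_in_linear:
  assumes "\<And>f l (F :: real filter). limitin X f l F \<Longrightarrow> limitin X (\<lambda>x. \<phi> (f x)) (\<phi> l) F"
    and "\<And>v w. \<phi> (v - w) = \<phi> v - \<phi> w" "\<And>c v. \<phi> (c *\<^sub>R v) = c *\<^sub>R \<phi> v"
    and "has_derivative_in X u d t"
  shows "has_derivative_in X (\<lambda>s. \<phi> (u s)) (\<phi> d) t"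
  using assms(1)[OF assms(4)[unfolded has_derivative_in_def]]
  by (simp add: has_derivative_in_def assms(2,3))

lemma filterlim_uminus_at: "filterlim uminus (at (- t)) (at (t :: real))"
  unfolding filterlim_at by (auto intro!: tendsto_eq_intros simp: eventually_at intro: exI[of _ 1])

text \<open>The sign from the chain rule cancels the sign in front of u. The right-hand side of the
  equation is quadratic and unchanged under negation as well, by \<open>euler_P_minus\<close>; hence
  the time reversal symmetry.\<close>

lemma has_derivative_in_reverse:
  assumes "has_derivative_in X u d (- t)"
  shows "has_derivative_in X (\<lambda>s. - u (- s)) d t"
proof -
  have "limitin X (\<lambda>h. (1 / (- h)) *\<^sub>R (u (- t + (- h)) - u (- t))) d (at 0)"
    using limitin_compose_filterlim[OF assms[unfolded has_derivative_in_def], of uminus "at 0"]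
      filterlim_uminus_at[of 0] by simp
  moreover have "(1 / (- h)) *\<^sub>R (u (- t + (- h)) - u (- t)) = (1 / h) *\<^sub>R (- u (- (t + h)) - - u (- t))" for h
    by (simp add: scaleR_diff_right)
  ultimately show ?thesis by (simp add: has_derivative_in_def)
qed

text \<open>Being a solution is a property of the germs of \<open>u\<close>. Since limits are unique, the
  derivative in \<open>C1_map\<close> is the right-hand side of the equation.\<close>

fun local_solution :: "setting \<Rightarrow> (real \<Rightarrow> vec_field) \<Rightarrow> real \<Rightarrow> bool" where
  "local_solution (Sobolev n) u t \<longleftrightarrow>
     limitin (H_topology n) u (u t) (at t) \<and>
     limitin (H_topology (n - 1)) (\<lambda>s. euler_P (u s) (u s)) (euler_P (u t) (u t)) (at t) \<and>
     has_derivative_in (H_topology (n - 1)) u (euler_P (u t) (u t)) t"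
| "local_solution Analytic u t \<longleftrightarrow>
     (\<exists>\<epsilon>>0. \<exists>c :: nat \<Rightarrow> vec_field. (\<forall>j. c j \<in> A_space) \<and>
        (\<forall>s. \<bar>s - t\<bar> < \<epsilon> \<longrightarrow>
           limitin A_topology (\<lambda>N. \<Sum>j<N. (s - t) ^ j *\<^sub>R c j) (u s) sequentially)) \<and>
     has_derivative_in A_topology u (euler_P (u t) (u t)) t"

lemma H_solution_iff:
  "H_solution n Tm Tp u \<longleftrightarrow> 0 < Tm \<and> 0 < Tp \<and> (\<forall>t\<in>time_interval Tm Tp. local_solution (Sobolev n) u t)"
proof -
  let ?I = "time_interval Tm Tp"
  note C0 = C0_map_iff[OF open_time_interval]
  have "(C0_map (H_topology n) ?I u \<and> C1_map (H_topology (n - 1)) ?I u \<and> satisfies_Euler (H_topology (n - 1)) ?I u)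
     \<longleftrightarrow> (\<forall>t\<in>?I. local_solution (Sobolev n) u t)" (is "?L \<longleftrightarrow> ?R")
  proof
    assume L: ?L
    then obtain u' where u': "C0_map (H_topology (n - 1)) ?I u'"
      "\<And>t. t \<in> ?I \<Longrightarrow> has_derivative_in (H_topology (n - 1)) u (u' t) t"
      by (auto simp: C1_map_def)
    have eq: "u' t = euler_P (u t) (u t)" if "t \<in> ?I" for t
    proof -
      have "limitin (H_topology (n - 1)) (\<lambda>h. (1 / h) *\<^sub>R (u (t + h) - u t)) (u' t) (at 0)"
        "limitin (H_topology (n - 1)) (\<lambda>h. (1 / h) *\<^sub>R (u (t + h) - u t)) (euler_P (u t) (u t)) (at 0)"
        using u'(2) L that by (auto simp: satisfies_Euler_def has_derivative_in_def)
      then show ?thesis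
        unfolding H_topology_def by (rule Metric_space.limitin_metric_unique[OF Metric_space_H]) simp
    qed
    show ?R
    proof
      fix t assume t: "t \<in> ?I"
      have ev: "\<forall>\<^sub>F s in at t. s \<in> ?I"
        using open_time_interval t by (intro eventually_at_in_open') auto
      have "limitin (H_topology (n - 1)) u' (euler_P (u t) (u t)) (at t)"
        using u'(1) t by (simp add: C0 flip: eq)
      then have "limitin (H_topology (n - 1)) (\<lambda>s. euler_P (u s) (u s)) (euler_P (u t) (u t)) (at t)"
        by (rule limitin_transform_eventually[rotated]) (rule eventually_mono[OF ev eq])
      then show "local_solution (Sobolev n) u t"
        using L t by (simp add: C0 satisfies_Euler_def)
    qed
  next
    assume R: ?R
    then have "limitin (H_topology n) u (u t) (at t)" if "t \<in> ?I" for t using that by simp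
    moreover from this have "limitin (H_topology (n - 1)) u (u t) (at t)" if "t \<in> ?I" for t
      using that by (intro limitin_H_topology_mono[of "n - 1" n]) auto
    ultimately show ?L
      using R unfolding C1_map_def C0 satisfies_Euler_def
      by (auto intro!: exI[of _ "\<lambda>s. euler_P (u s) (u s)"])
  qed
  then show ?thesis by (auto simp: H_solution_def)
qed

lemma A_solution_iff:
  "A_solution Tm Tp u \<longleftrightarrow> 0 < Tm \<and> 0 < Tp \<and> (\<forall>t\<in>time_interval Tm Tp. local_solution Analytic u t)"
proof -
  let ?I = "time_interval Tm Tp"
  have "A_analytic_map ?I u \<longleftrightarrow>
    (\<forall>t\<in>?I. \<exists>\<epsilon>>0. \<exists>c :: nat \<Rightarrow> vec_field. (\<forall>j. c j \<in> A_space) \<and>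
        (\<forall>s. \<bar>s - t\<bar> < \<epsilon> \<longrightarrow> limitin A_topology (\<lambda>N. \<Sum>j<N. (s - t) ^ j *\<^sub>R c j) (u s) sequentially))"
    (is "?L \<longleftrightarrow> ?R")
  proof
    assume L: ?L
    show ?R
    proof
      fix t assume t: "t \<in> ?I"
      obtain e c where e: "e > 0" "\<forall>j. c j \<in> A_space"
        "\<And>s. s \<in> ?I \<Longrightarrow> \<bar>s - t\<bar> < e \<Longrightarrow> limitin A_topology (\<lambda>N. \<Sum>j<N. (s - t) ^ j *\<^sub>R c j) (u s) sequentially"
        using L t unfolding A_analytic_map_def by meson
      obtain d where d: "d > 0" "ball t d \<subseteq> ?I" using open_time_interval t openE by blast
      have "s \<in> ?I" if "\<bar>s - t\<bar> < d" for s
        using d(2) that by (auto simp: dist_real_def abs_minus_commute subset_iff)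
      then show "\<exists>\<epsilon>>0. \<exists>c :: nat \<Rightarrow> vec_field. (\<forall>j. c j \<in> A_space) \<and>
        (\<forall>s. \<bar>s - t\<bar> < \<epsilon> \<longrightarrow> limitin A_topology (\<lambda>N. \<Sum>j<N. (s - t) ^ j *\<^sub>R c j) (u s) sequentially)"
        using e d by (intro exI[of _ "min e d"] conjI exI[of _ c]) auto
    qed
  next
    assume ?R then show ?L unfolding A_analytic_map_def by meson
  qed
  then show ?thesis by (auto simp: A_solution_def satisfies_Euler_def)
qed

lemma solution_iff:
  "solution r Tm Tp u \<longleftrightarrow> 0 < Tm \<and> 0 < Tp \<and> (\<forall>t\<in>time_interval Tm Tp. local_solution r u t)"
  by (cases r) (simp_all only: solution.simps H_solution_iff A_solution_iff)

lemma local_solution_cong: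
  assumes sol: "local_solution r u t" and \<epsilon>: "\<epsilon> > 0" "\<And>s. \<bar>s - t\<bar> < \<epsilon> \<Longrightarrow> u s = w s"
  shows "local_solution r w t"
proof -
  have ut: "u t = w t" using \<epsilon> by simp
  have ev: "\<forall>\<^sub>F s in at t. u s = w s"
    using \<epsilon> by (auto simp: eventually_at dist_real_def)
  show ?thesis
  proof (cases r)
    case (Sobolev n)
    have evP: "\<forall>\<^sub>F s in at t. euler_P (u s) (u s) = euler_P (w s) (w s)"
      using ev by (rule eventually_mono) simp
    have 1: "limitin (H_topology n) u (w t) (at t)"
      and 2: "limitin (H_topology (n - 1)) (\<lambda>s. euler_P (u s) (u s)) (euler_P (w t) (w t)) (at t)"
      and 3: "has_derivative_in (H_topology (n - 1)) u (euler_P (w t) (w t)) t"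
      using sol unfolding Sobolev local_solution.simps ut by auto
    show ?thesis
      unfolding Sobolev local_solution.simps
      by (intro conjI limitin_transform_eventually[OF ev 1] limitin_transform_eventually[OF evP 2] has_derivative_in_cong[OF 3 \<epsilon>])
  next
    case Analytic
    obtain e c where e: "e > 0" "\<forall>j. c j \<in> A_space"
        "\<And>s. \<bar>s - t\<bar> < e \<Longrightarrow> limitin A_topology (\<lambda>N. \<Sum>j<N. (s - t) ^ j *\<^sub>R c j) (u s) sequentially"
      using sol unfolding Analytic local_solution.simps by meson
    have "limitin A_topology (\<lambda>N. \<Sum>j<N. (s - t) ^ j *\<^sub>R c j) (w s) sequentially" if "\<bar>s - t\<bar> < min e \<epsilon>" for s
      using e(3)[of s] \<epsilon>(2)[of s] that by simp
    moreover have "has_derivative_in A_topology w (euler_P (w t) (w t)) t"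
      using sol has_derivative_in_cong[OF _ \<epsilon>] unfolding Analytic by (simp add: ut)
    ultimately show ?thesis
      unfolding Analytic local_solution.simps using e \<epsilon>(1)
      by (intro conjI exI[of _ "min e \<epsilon>"] exI[of _ c]) auto
  qed
qed

section \<open>Symmetries and time reversal acting on solutions\<close>

text \<open>In H^n the action is an isometry. In the analytic topology it permutes the moduli of the
  coefficients among indices with equal \<open>one_norm\<close>, so decay bounds persist with the
  constant K = 1.\<close>

lemma
  assumes S: "S \<in> O_h"
  shows limitin_H_E_star: "limitin (H_topology n) f l F \<Longrightarrow> limitin (H_topology n) (\<lambda>x. E_star (S, a) (f x)) (E_star (S, a) l) F"
    and limitin_A_E_star: "limitin A_topology f l F \<Longrightarrow> limitin A_topology (\<lambda>x. E_star (S, a) (f x)) (E_star (S, a) l) F"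
proof -
  assume L: "limitin (H_topology n) f l F"
  show "limitin (H_topology n) (\<lambda>x. E_star (S, a) (f x)) (E_star (S, a) l) F"
    unfolding limitin_H_topology
  proof (intro conjI allI impI)
    show "E_star (S, a) l \<in> H_space n" using L by (auto simp: limitin_H_topology intro: E_star_H_space[OF S])
    fix e :: real assume "e > 0"
    then have "\<forall>\<^sub>F x in F. f x \<in> H_space n \<and> H_norm n (f x - l) < e"
      using L by (simp add: limitin_H_topology)
    then show "\<forall>\<^sub>F x in F. E_star (S, a) (f x) \<in> H_space n \<and> H_norm n (E_star (S, a) (f x) - E_star (S, a) l) < e"
      by (rule eventually_mono) (simp add: E_star_H_space[OF S] H_norm_E_star[OF S] flip: E_star_diff)
  qed
next
  assume L: "limitin A_topology f l F"
  have decay: "norm (E_star (S, a) v k) \<le> 1 * M * r powr (- one_norm k)"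
    if "\<And>k. norm (v k) \<le> M * r powr (- one_norm k)" for v M r k
    using that[of "transpose S *v k"]
    by (simp add: norm_E_star[OF S] one_norm_O_h[OF O_h_transpose[OF S]] del: transpose_matrix_vector)
  show "limitin A_topology (\<lambda>x. E_star (S, a) (f x)) (E_star (S, a) l) F"
    unfolding limitin_A_topology
  proof (intro conjI ballI)
    have "l \<in> A_space" using L by (simp add: limitin_A_topology)
    then obtain r C where "l \<in> solenoidal_mean_zero" "r > 1" "\<And>k. norm (l k) \<le> C * r powr (- one_norm k)"
      unfolding A_space_iff by blast
    then show "E_star (S, a) l \<in> A_space"
      by (intro A_spaceI[OF E_star_solenoidal[OF S] _ decay])
    fix U assume "U \<in> A_zero_nhds"
    then have "{v \<in> A_space. E_star (S, a) v \<in> U} \<in> A_zero_nhds"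
      by (rule A_zero_nhds_vimage[where K = 1]) (simp_all only: E_star_add E_star_scaleR E_star_solenoidal[OF S] decay zero_less_one)
    then have "\<forall>\<^sub>F x in F. f x - l \<in> {v \<in> A_space. E_star (S, a) v \<in> U}"
      using L unfolding limitin_A_topology by blast
    then show "\<forall>\<^sub>F x in F. E_star (S, a) (f x) - E_star (S, a) l \<in> U"
      by (rule eventually_mono) (simp add: E_star_diff)
  qed
qed

lemma limitin_H_minus: "limitin (H_topology n) f l F \<Longrightarrow> limitin (H_topology n) (\<lambda>x. - f x) (- l) F"
proof -
  assume L: "limitin (H_topology n) f l F"
  have eq: "H_norm n (- x - - y) = H_norm n (x - y)" for x y
    using H_norm_minus[of n "x - y"] by simp
  show ?thesis
    unfolding limitin_H_topology
  proof (intro conjI allI impI)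
    show "- l \<in> H_space n" using L by (simp add: limitin_H_topology H_space_minus)
    fix e :: real assume "e > 0"
    then have "\<forall>\<^sub>F x in F. f x \<in> H_space n \<and> H_norm n (f x - l) < e"
      using L by (simp add: limitin_H_topology)
    then show "\<forall>\<^sub>F x in F. - f x \<in> H_space n \<and> H_norm n (- f x - - l) < e"
      unfolding eq by (rule eventually_mono) (simp add: H_space_minus)
  qed
qed

lemma limitin_A_minus: "limitin A_topology f l F \<Longrightarrow> limitin A_topology (\<lambda>x. - f x) (- l) F"
proof -
  assume L: "limitin A_topology f l F"
  show ?thesis
    unfolding limitin_A_topology
  proof (intro conjI ballI)
    show "- l \<in> A_space" using L by (simp add: limitin_A_topology A_space_minus)
    fix U assume U: "U \<in> A_zero_nhds"
    then have "\<forall>\<^sub>F x in F. f x - l \<in> U" using L by (simp add: limitin_A_topology)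
    then show "\<forall>\<^sub>F x in F. - f x - - l \<in> U"
    proof (rule eventually_mono)
      fix x assume x: "f x - l \<in> U"
      have "\<forall>v\<in>U. - v \<in> U" using U by (simp add: A_zero_nhds_def)
      from bspec[OF this x] show "- f x - - l \<in> U" by simp
    qed
  qed
qed

lemma local_solution_E_star:
  assumes S: "S \<in> O_h" and sol: "local_solution r u t"
  shows "local_solution r (\<lambda>s. E_star (S, a) (u s)) t"
proof (cases r)
  case (Sobolev n)
  then show ?thesis
    using sol by (simp add: euler_P_E_star[OF S] limitin_H_E_star[OF S]
        has_derivative_in_linear[OF limitin_H_E_star[OF S] E_star_diff E_star_scaleR])
next
  case Analytic
  obtain e c where e: "e > 0" "\<forall>j. c j \<in> A_space"
      "\<And>s. \<bar>s - t\<bar> < e \<Longrightarrow> limitin A_topology (\<lambda>N. \<Sum>j<N. (s - t) ^ j *\<^sub>R c j) (u s) sequentially"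
    using sol unfolding Analytic local_solution.simps by meson
  have sum: "E_star (S, a) (\<Sum>j<N. x ^ j *\<^sub>R c j) = (\<Sum>j<N. x ^ j *\<^sub>R E_star (S, a) (c j))" for N x
  proof (induction N)
    case 0
    show ?case using E_star_scaleR[of "(S, a)" 0 0] by (simp only: lessThan_0 sum.empty scaleR_zero_left)
  qed (simp only: sum.lessThan_Suc E_star_add E_star_scaleR)
  \<comment> \<open>Membership is read off from the preservation of limits, applied to a constant
    sequence.\<close>
  have "E_star (S, a) (c j) \<in> A_space" for j
  proof -
    have "limitin A_topology (\<lambda>_. c j) (c j) sequentially"
      using e(2) by (simp add: topspace_A_topology)
    from limitin_A_E_star[OF S this] show ?thesis by (simp add: topspace_A_topology)
  qed
  moreover have "limitin A_topology (\<lambda>N. \<Sum>j<N. (s - t) ^ j *\<^sub>R E_star (S, a) (c j)) (E_star (S, a) (u s)) sequentially"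
    if "\<bar>s - t\<bar> < e" for s
    using limitin_A_E_star[OF S e(3)[OF that], of a] by (simp add: sum)
  moreover have "has_derivative_in A_topology (\<lambda>s. E_star (S, a) (u s)) (E_star (S, a) (euler_P (u t) (u t))) t"
  proof (rule has_derivative_in_linear[OF limitin_A_E_star[OF S] E_star_diff E_star_scaleR])
    show "has_derivative_in A_topology u (euler_P (u t) (u t)) t"
      using sol unfolding Analytic local_solution.simps by blast
  qed
  ultimately show ?thesis
    unfolding Analytic local_solution.simps euler_P_E_star[OF S] using e(1)
    by (intro conjI exI[of _ e] exI[of _ "\<lambda>j. E_star (S, a) (c j)"] allI impI)
qed

lemma local_solution_reverse:
  assumes sol: "local_solution r u (- t)"
  shows "local_solution r (\<lambda>s. - u (- s)) t"
proof (cases r)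
  case (Sobolev n)
  have "limitin (H_topology n) (\<lambda>s. - u (- s)) (- u (- t)) (at t)"
    using sol Sobolev by (intro limitin_H_minus limitin_compose_filterlim[OF _ filterlim_uminus_at]) auto
  moreover have "limitin (H_topology (n - 1)) (\<lambda>s. euler_P (u (- s)) (u (- s))) (euler_P (u (- t)) (u (- t))) (at t)"
    using sol Sobolev limitin_compose_filterlim[OF _ filterlim_uminus_at] by fastforce
  ultimately show ?thesis
    using sol by (simp add: Sobolev euler_P_minus has_derivative_in_reverse)
next
  case Analytic
  obtain e c where e: "e > 0" "\<forall>j. c j \<in> A_space"
      "\<And>s. \<bar>s - - t\<bar> < e \<Longrightarrow> limitin A_topology (\<lambda>N. \<Sum>j<N. (s - - t) ^ j *\<^sub>R c j) (u s) sequentially"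
    using sol unfolding Analytic local_solution.simps by meson
  \<comment> \<open>Taylor coefficients of the reversed map: the sign (-1)^j comes from reversing
    the argument, the outer sign from negating the value.\<close>
  define b where "b = (\<lambda>j. - ((- 1) ^ j *\<^sub>R c j))"
  have "b j \<in> A_space" for j using e(2) by (simp add: b_def A_space_minus A_space_scaleR)
  moreover have "limitin A_topology (\<lambda>N. \<Sum>j<N. (s - t) ^ j *\<^sub>R b j) (- u (- s)) sequentially" if "\<bar>s - t\<bar> < e" for s
  proof -
    have "(- s - - t) ^ j *\<^sub>R c j = - ((s - t) ^ j *\<^sub>R b j)" for j
    proof -
      have "(- s - - t) ^ j = (- 1) ^ j * (s - t) ^ j" by (simp flip: power_mult_distrib)
      then show ?thesis by (simp add: b_def mult.commute)
    qed
    then have "- (\<Sum>j<N. (- s - - t) ^ j *\<^sub>R c j) = (\<Sum>j<N. (s - t) ^ j *\<^sub>R b j)" for N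
      by (simp add: sum_negf)
    then show ?thesis
      using limitin_A_minus[OF e(3)[of "- s"]] that by simp
  qed
  moreover have "has_derivative_in A_topology (\<lambda>s. - u (- s)) (euler_P (u (- t)) (u (- t))) t"
  proof (rule has_derivative_in_reverse)
    show "has_derivative_in A_topology u (euler_P (u (- t)) (u (- t))) (- t)"
      using sol unfolding Analytic local_solution.simps by blast
  qed
  ultimately show ?thesis
    unfolding Analytic local_solution.simps euler_P_minus using e(1)
    by (intro conjI exI[of _ e] exI[of _ b] allI impI)
qed

lemma solution_E_star:
  "S \<in> O_h \<Longrightarrow> solution r Tm Tp u \<Longrightarrow> solution r Tm Tp (\<lambda>t. E_star (S, a) (u t))"
  by (simp add: solution_iff local_solution_E_star)

lemma solution_reverse: "solution r Tm Tp u \<Longrightarrow> solution r Tp Tm (\<lambda>t. - u (- t))"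
  by (simp add: solution_iff local_solution_reverse)

section \<open>Uniqueness and maximality\<close>

text \<open>A common interface that lets one uniqueness proof serve both settings. In the Sobolev
  case n - 1 is nonnegative, so the derivative in H^(n-1) is also one in H^0. An open set of times
  appears because the analytic case uses membership in H^3 at all times near t.\<close>

lemma local_solution_regular:
  assumes "admissible r"
  obtains n where "n > 5 / 2"
    "\<And>I u t. open I \<Longrightarrow> (\<And>s. s \<in> I \<Longrightarrow> local_solution r u s) \<Longrightarrow> t \<in> I \<Longrightarrow>
       u t \<in> H_space n \<and> limitin (H_topology n) u (u t) (at t) \<and>
       has_derivative_in (H_topology 0) u (euler_P (u t) (u t)) t"
proof (cases r)
  case (Sobolev n)
  then have n: "n > 5 / 2" using assms by simp
  show ?thesis
  proof (rule that[OF n])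
    fix I u t assume "\<And>s. s \<in> I \<Longrightarrow> local_solution r u s" "t \<in> (I :: real set)"
    then have "local_solution (Sobolev n) u t" using Sobolev by simp
    moreover from this have "has_derivative_in (H_topology 0) u (euler_P (u t) (u t)) t"
      unfolding has_derivative_in_def using n by (intro limitin_H_topology_mono[of 0 "n - 1"]) (auto simp: has_derivative_in_def)
    ultimately show "u t \<in> H_space n \<and> limitin (H_topology n) u (u t) (at t) \<and>
       has_derivative_in (H_topology 0) u (euler_P (u t) (u t)) t"
      by (simp add: limitin_H_topology)
  qed
next
  case Analytic
  show ?thesis
  \<comment> \<open>The number 3 is a convenient order above 5/2. Continuity in H^3 is obtained from
    differentiability in H^3, which the finer analytic topology supplies.\<close>
  proof (rule that[of 3])
    fix I u t assume I: "open I" and sol: "\<And>s. s \<in> I \<Longrightarrow> local_solution r u s" and t: "t \<in> (I :: real set)"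
    have H3: "u s \<in> H_space 3" if s: "s \<in> I" for s
    proof -
      obtain e c where "e > 0"
          "\<And>s'. \<bar>s' - s\<bar> < e \<Longrightarrow> limitin A_topology (\<lambda>N. \<Sum>j<N. (s' - s) ^ j *\<^sub>R c j) (u s') sequentially"
        using sol[OF s] unfolding Analytic local_solution.simps by meson
      from this(2)[of s] this(1) have "u s \<in> A_space" by (simp add: limitin_A_topology)
      then show ?thesis using A_space_subset_H_space[of 3] by auto
    qed
    have ev: "\<forall>\<^sub>F s in at t. s \<in> I" using I t by (intro eventually_at_in_open') auto
    have "has_derivative_in A_topology u (euler_P (u t) (u t)) t"
      using sol[OF t] unfolding Analytic local_solution.simps by blast
    then have dH: "has_derivative_in (H_topology m) u (euler_P (u t) (u t)) t" if "0 \<le> m" for m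
      unfolding has_derivative_in_def by (rule limitin_A_imp_limitin_H[OF that])
    have "((\<lambda>s. sobolev_embed 3 (u s)) has_vector_derivative sobolev_embed 3 (euler_P (u t) (u t))) (at t)"
      by (rule has_derivative_in_H_imp_vector_derivative[OF dH])
        (auto intro: eventually_mono[OF ev] H3 t)
    then have "((\<lambda>s. sobolev_embed 3 (u s)) \<longlongrightarrow> sobolev_embed 3 (u t)) (at t)"
      using has_vector_derivative_continuous isCont_def by blast
    then have "limitin (H_topology 3) u (u t) (at t)"
      by (rule tendsto_imp_limitin_H) (auto intro: eventually_mono[OF ev] H3 t)
    then show "u t \<in> H_space 3 \<and> limitin (H_topology 3) u (u t) (at t) \<and>
       has_derivative_in (H_topology 0) u (euler_P (u t) (u t)) t"
      using dH[of 0] H3 t by simp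
  qed simp
qed

lemma solution_unique:
  assumes adm: "admissible r" and u: "solution r Tm Tp u" and w: "solution r Tm' Tp' w"
    and init: "u 0 = w 0" and t: "t \<in> time_interval Tm Tp" "t \<in> time_interval Tm' Tp'"
  shows "u t = w t"
proof -
  obtain n where n: "n > 5 / 2"
    and reg: "\<And>I u t. open I \<Longrightarrow> (\<And>s. s \<in> I \<Longrightarrow> local_solution r u s) \<Longrightarrow> t \<in> I \<Longrightarrow>
       u t \<in> H_space n \<and> limitin (H_topology n) u (u t) (at t) \<and>
       has_derivative_in (H_topology 0) u (euler_P (u t) (u t)) t"
    using local_solution_regular[OF adm] by blast
  let ?I = "time_interval Tm Tp \<inter> time_interval Tm' Tp'"
  have I: "open ?I" by (intro open_Int open_time_interval)
  have T: "0 < Tm" "0 < Tp" "0 < Tm'" "0 < Tp'" using u w by (auto simp: solution_iff)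
  have lu: "local_solution r u s" and lw: "local_solution r w s" if "s \<in> ?I" for s
    using u w that by (auto simp: solution_iff)
  show ?thesis
  proof (rule euler_unique[OF n I])
    show "closed_segment 0 t \<subseteq> ?I"
      using closed_segment_subset_time_interval[OF T(1,2) t(1)] closed_segment_subset_time_interval[OF T(3,4) t(2)] by blast
  qed (use reg[OF I lu] reg[OF I lw] init in auto)
qed

text \<open>Each time in the union has a neighbourhood on which the glued map coincides with one of
  the two solutions; on the overlap this holds by agreement, and \<open>local_solution_cong\<close>
  does the rest.\<close>

lemma solution_glue:
  assumes u: "solution r Tm Tp u" and w: "solution r Tm' Tp' w"
    and agree: "\<And>t. t \<in> time_interval Tm Tp \<Longrightarrow> t \<in> time_interval Tm' Tp' \<Longrightarrow> u t = w t"
  shows "solution r (max Tm Tm') (max Tp Tp') (\<lambda>t. if t \<in> time_interval Tm Tp then u t else w t)"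
    (is "solution r _ _ ?v")
proof -
  have T: "0 < Tm" "0 < Tp" "0 < Tm'" "0 < Tp'" using u w by (auto simp: solution_iff)
  have loc: "local_solution r ?v t" if "open J" "t \<in> J" "local_solution r y t" "\<And>s. s \<in> J \<Longrightarrow> y s = ?v s" for J y t
  proof -
    obtain e where e: "e > 0" "ball t e \<subseteq> J" using \<open>open J\<close> \<open>t \<in> J\<close> openE by blast
    show ?thesis
      by (rule local_solution_cong[OF that(3) e(1)], rule that(4))
        (use e(2) in \<open>auto simp: dist_real_def abs_minus_commute subset_iff\<close>)
  qed
  have "local_solution r ?v t" if "t \<in> time_interval Tm Tp" for t
    by (rule loc[OF open_time_interval that, of u]) (use u that in \<open>auto simp: solution_iff\<close>)
  moreover have "local_solution r ?v t" if "t \<in> time_interval Tm' Tp'" for t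
    by (rule loc[OF open_time_interval that, of w]) (use w that agree in \<open>auto simp: solution_iff\<close>)
  ultimately show ?thesis
    using T by (auto simp: solution_iff time_interval_max less_max_iff_disj)
qed

lemma maximal_solution_nonextendable:
  assumes "maximal_solution r u\<^sub>0 Tm Tp u" "solution r Tm' Tp' w" "Tm \<le> Tm'" "Tp \<le> Tp'"
    and "\<And>t. t \<in> time_interval Tm Tp \<Longrightarrow> w t = u t"
  shows "Tm' = Tm \<and> Tp' = Tp"
  using assms(1)[unfolded maximal_solution_def, THEN conjunct2, THEN conjunct2, rule_format, of Tm' Tp' w] assms(2-5)
  by blast

text \<open>The glued solution extends both maximal solutions. Non-extendability of each forces its
  end points to equal the pairwise maxima, so the two intervals coincide.\<close>

lemma maximal_solution_unique:
  assumes adm: "admissible r" and u: "maximal_solution r u\<^sub>0 Tm Tp u" and w: "maximal_solution r u\<^sub>0 Tm' Tp' w"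
  shows "Tm = Tm' \<and> Tp = Tp' \<and> (\<forall>t\<in>time_interval Tm Tp. u t = w t)"
proof -
  have su: "solution r Tm Tp u" and sw: "solution r Tm' Tp' w" and init: "u 0 = w 0"
    using u w by (auto simp: maximal_solution_def)
  note agree = solution_unique[OF adm su sw init]
  note glue = solution_glue[OF su sw agree]
  have "max Tm Tm' = Tm \<and> max Tp Tp' = Tp"
    by (rule maximal_solution_nonextendable[OF u glue]) auto
  moreover have "max Tm Tm' = Tm' \<and> max Tp Tp' = Tp'"
    by (rule maximal_solution_nonextendable[OF w glue]) (auto intro: agree)
  ultimately show ?thesis using agree by auto
qed

lemma maximal_solution_E_star:
  assumes S: "S \<in> O_h" and u: "maximal_solution r u\<^sub>0 Tm Tp u"
  shows "maximal_solution r (E_star (S, a) u\<^sub>0) Tm Tp (\<lambda>t. E_star (S, a) (u t))"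
  unfolding maximal_solution_def
proof (intro conjI allI impI; (elim conjE)?)
  show "solution r Tm Tp (\<lambda>t. E_star (S, a) (u t))" "E_star (S, a) (u 0) = E_star (S, a) u\<^sub>0"
    using u by (auto simp: maximal_solution_def solution_E_star[OF S])
  fix Tm' Tp' and w :: "real \<Rightarrow> vec_field"
  let ?w = "\<lambda>t. E_star (transpose S, - torus_act (transpose S) a) (w t)"
  assume "solution r Tm' Tp' w" and le: "Tm \<le> Tm'" "Tp \<le> Tp'"
    and w: "\<forall>t\<in>time_interval Tm Tp. w t = E_star (S, a) (u t)"
  then have "solution r Tm' Tp' ?w" by (intro solution_E_star O_h_transpose S)
  from maximal_solution_nonextendable[OF u this le] w have "Tm' = Tm \<and> Tp' = Tp"
    by (simp add: E_star_inverse[OF S])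
  then show "Tm' = Tm" "Tp' = Tp" by auto
qed

lemma maximal_solution_reverse:
  assumes u: "maximal_solution r u\<^sub>0 Tm Tp u"
  shows "maximal_solution r (- u\<^sub>0) Tp Tm (\<lambda>t. - u (- t))"
  unfolding maximal_solution_def
proof (intro conjI allI impI; (elim conjE)?)
  show "solution r Tp Tm (\<lambda>t. - u (- t))" "- u (- 0) = - u\<^sub>0"
    using u by (auto simp: maximal_solution_def solution_reverse)
  fix Tm' Tp' and w :: "real \<Rightarrow> vec_field"
  let ?w = "\<lambda>t. - w (- t)"
  assume "solution r Tm' Tp' w" and le: "Tp \<le> Tm'" "Tm \<le> Tp'"
    and w: "\<forall>t\<in>time_interval Tp Tm. w t = - u (- t)"
  then have "solution r Tp' Tm' ?w" by (intro solution_reverse)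
  from maximal_solution_nonextendable[OF u this le(2,1)] w have "Tp' = Tm \<and> Tm' = Tp"
    by simp
  then show "Tm' = Tp" "Tp' = Tm" by auto
qed

theorem mainTheorem3:
  fixes S :: "int^3^3" and a :: torus and r :: setting
  assumes "(S, a) \<in> carrier O_h_torus" and "admissible r"
  shows
    "(\<forall>Tm Tp u. solution r Tm Tp u \<longrightarrow>
        solution r Tm Tp (\<lambda>t. E_star (S, a) (u t)) \<and>
        solution r Tp Tm (\<lambda>t. - E_star (S, a) (u (- t)))) \<and>
     (\<forall>u\<^sub>0\<in>data_space r. \<forall>Tm Tp u. maximal_solution r u\<^sub>0 Tm Tp u \<longrightarrow>
        maximal_solution r (E_star (S, a) u\<^sub>0) Tm Tp (\<lambda>t. E_star (S, a) (u t)) \<and>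
        maximal_solution r (- E_star (S, a) u\<^sub>0) Tp Tm (\<lambda>t. - E_star (S, a) (u (- t)))) \<and>
     (\<forall>u\<^sub>0\<in>data_space r. \<forall>Tm Tp u. maximal_solution r u\<^sub>0 Tm Tp u \<longrightarrow>
        (E_star (S, a) u\<^sub>0 = u\<^sub>0 \<longrightarrow>
           (\<forall>t\<in>time_interval Tm Tp. E_star (S, a) (u t) = u t)) \<and>
        (- E_star (S, a) u\<^sub>0 = u\<^sub>0 \<longrightarrow>
           Tm = Tp \<and> (\<forall>t\<in>time_interval Tp Tp. - E_star (S, a) (u (- t)) = u t))) \<and>
     (\<forall>n>5/2. \<forall>u\<^sub>0\<in>H_space n. \<forall>Tm Tp u.
        maximal_solution (Sobolev n) u\<^sub>0 Tm Tp u \<and> - E_star (S, a) u\<^sub>0 = u\<^sub>0 \<longrightarrow>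
          Tm = Tp \<and> (\<forall>t\<in>time_interval Tp Tp. H_norm n (u (- t)) = H_norm n (u t)))"
proof -
  have S: "S \<in> O_h" using assms(1) by (simp add: O_h_torus_def)
  have rev: "maximal_solution q (- E_star (S, a) u\<^sub>0) Tp Tm (\<lambda>t. - E_star (S, a) (u (- t)))"
    if "maximal_solution q u\<^sub>0 Tm Tp u" for q u\<^sub>0 Tm Tp u
    using maximal_solution_reverse[OF maximal_solution_E_star[OF S that]] .
  have iii: "Tm = Tp \<and> (\<forall>t\<in>time_interval Tp Tp. - E_star (S, a) (u (- t)) = u t)"
    if adm: "admissible q" and max: "maximal_solution q u\<^sub>0 Tm Tp u" and inv: "- E_star (S, a) u\<^sub>0 = u\<^sub>0"
    for q u\<^sub>0 Tm Tp u
  proof -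
    \<comment> \<open>The reversed solution has the same datum by \<open>inv\<close>, but its end
      points are interchanged; equality of the two maximal intervals is therefore the identity
      \<open>Tm = Tp\<close>.\<close>
    note uniq = maximal_solution_unique[OF adm max rev[OF max, unfolded inv]]
    have T: "Tm = Tp" using uniq by (rule conjunct1)
    have "- E_star (S, a) (u (- t)) = u t" if "t \<in> time_interval Tp Tp" for t
      by (rule sym, rule bspec[OF uniq[THEN conjunct2, THEN conjunct2]]) (use that T in simp)
    with T show ?thesis by blast
  qed
  have iv: "Tm = Tp \<and> (\<forall>t\<in>time_interval Tp Tp. H_norm n (u (- t)) = H_norm n (u t))"
    if "n > 5 / 2" "maximal_solution (Sobolev n) u\<^sub>0 Tm Tp u" "- E_star (S, a) u\<^sub>0 = u\<^sub>0" for n u\<^sub>0 Tm Tp u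
  proof -
    have "admissible (Sobolev n)" using that(1) by simp
    note T = iii[OF this that(2,3), THEN conjunct1] iii[OF this that(2,3), THEN conjunct2, rule_format]
    have "H_norm n (u (- t)) = H_norm n (u t)" if "t \<in> time_interval Tp Tp" for t
      unfolding T(2)[OF that, symmetric] H_norm_minus by (simp add: H_norm_E_star[OF S])
    with T(1) show ?thesis by blast
  qed
  show ?thesis
  proof (intro conjI allI ballI impI)
    fix Tm Tp u assume "solution r Tm Tp u"
    then show "solution r Tm Tp (\<lambda>t. E_star (S, a) (u t))" by (rule solution_E_star[OF S])
    then show "solution r Tp Tm (\<lambda>t. - E_star (S, a) (u (- t)))" by (rule solution_reverse)
  next
    fix u\<^sub>0 Tm Tp u assume max: "maximal_solution r u\<^sub>0 Tm Tp u"
    show E: "maximal_solution r (E_star (S, a) u\<^sub>0) Tm Tp (\<lambda>t. E_star (S, a) (u t))"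
      by (rule maximal_solution_E_star[OF S max])
    show "maximal_solution r (- E_star (S, a) u\<^sub>0) Tp Tm (\<lambda>t. - E_star (S, a) (u (- t)))"
      by (rule rev[OF max])
    show "E_star (S, a) (u t) = u t" if "E_star (S, a) u\<^sub>0 = u\<^sub>0" "t \<in> time_interval Tm Tp" for t
      using maximal_solution_unique[OF assms(2) max E[unfolded that(1)]] that(2) by simp
    show "Tm = Tp" if "- E_star (S, a) u\<^sub>0 = u\<^sub>0" using iii[OF assms(2) max that] by blast
    show "- E_star (S, a) (u (- t)) = u t" if "- E_star (S, a) u\<^sub>0 = u\<^sub>0" "t \<in> time_interval Tp Tp" for t
      using iii[OF assms(2) max that(1)] that(2) by blast
  qed (use iv in blast)+
qed

end
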